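(* Let $r\ge1$ be an integer and let $m$ be an $L^{2r}(\mathbb{R})$ multiplier supported in $(-1/2,1/2]$. Let $Z$ be a finite set of integers contained in $(1,q(Z)]$, and suppose $0<\varepsilon<q(Z)^{-2}$. Then for all $f\in\ell^{2r}(\mathbb{Z})$, $$\Big\|\Big(\sum_{q\in Z}\Big|\sum_{a/q\in\mathcal{R}(q)}f_{a/q}\Big|^{2r}\Big)^{1/2r}\Big\|_{\ell^{2r}(\mathbb{Z})}\le C_{2r}\big(2^{\Omega(Z)}\big)^{1-1/r}\|f\|_{\ell^{2r}(\mathbb{Z})},$$ for a constant $C_{2r}$ depending (besides $r$) only on the $L^{2r}(\mathbb{R})$ multiplier norm of $m$.
   Context: For $f\in\ell^1(\mathbb{Z})$ put $\widehat f(\xi)=\sum_{n\in\mathbb{Z}}f(n)e^{-2\pi i n\xi}$, a 1-periodic function. Let $\mathscr{F}$ be the Euclidean Fourier transform on $\mathbb{R}$. A bounded measurable function $m:\mathbb{R}\to\mathbb{C}$ is an $L^p(\mathbb{R})$ multiplier of norm $B_p$ if $Tf=\mathscr{F}^{-1}(m\cdot\mathscr{F}f)$ satisfies $\|Tf\|_{L^p}\le B_p\|f\|_{L^p}$ for all $f\in L^p(\mathbb{R})$. For a positive integer $q$, $\mathcal{R}(q)=\{a/q: 1\le a\le q,\ \gcd(a,q)=1\}$. $q(Z)$ denotes a number with $Z\subset(1,q(Z)]$. $\omega(q)$ is the number of distinct prime divisors of $q$, and $\Omega(Z)=\max\{\omega(q):q\in Z\}$. Given $m$ and $\varepsilon$,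 the function $f_{a/q}$ on $\mathbb{Z}$ is defined for $f\in\ell^1(\mathbb{Z})$ by $$\widehat{f_{a/q}}(\xi)=\sum_{\ell\in\mathbb{Z}}m\big(\varepsilon^{-1}(\xi-\ell-a/q)\big)\,\widehat f(\xi);$$ for $f\in\ell^{2r}(\mathbb{Z})$ the operators $f\mapsto f_{a/q}$ are understood as the bounded extensions by density. *)

theory Defs
  imports "HOL-Analysis.Analysis" "HOL-Computational_Algebra.Primes"
begin

section \<open>Lebesgue spaces\<close>

definition Lp_space :: "'a measure \<Rightarrow> real \<Rightarrow> ('a \<Rightarrow> 'b::real_normed_vector) set" where
  "Lp_space M p = {f \<in> borel_measurable M. integrable M (\<lambda>x. norm (f x) powr p)}"

text \<open>Meaningful only on \<open>Lp_space M p\<close>: the Bochner integral of a non-integrable function is 0.\<close>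

definition Lp_norm :: "'a measure \<Rightarrow> real \<Rightarrow> ('a \<Rightarrow> 'b::real_normed_vector) \<Rightarrow> real" where
  "Lp_norm M p f = (\<integral>x. norm (f x) powr p \<partial>M) powr (1 / p)"

abbreviation ell :: "real \<Rightarrow> (int \<Rightarrow> 'b::real_normed_vector) set" where
  "ell p \<equiv> Lp_space (count_space UNIV) p"

abbreviation ell_norm :: "real \<Rightarrow> (int \<Rightarrow> 'b::real_normed_vector) \<Rightarrow> real" where
  "ell_norm p \<equiv> Lp_norm (count_space UNIV) p"

text \<open>
  \<open>T\<close> is a linear operator on \<open>L\<^sup>p(M)\<close> of norm at most \<open>B\<close> that agrees with \<open>S\<close> on the
  functions of \<open>D\<close> lying in \<open>L\<^sup>p(M)\<close>. When these are dense, \<open>T\<close> is determined on \<open>L\<^sup>p(M)\<close> up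
  to null sets: it is the extension of \<open>S\<close> by density. Functions are not
  identified when they agree almost everywhere, hence the almost-everywhere equalities.
\<close>

definition bounded_Lp_extension ::
  "'a measure \<Rightarrow> real \<Rightarrow> real \<Rightarrow> ('a \<Rightarrow> complex) set
    \<Rightarrow> (('a \<Rightarrow> complex) \<Rightarrow> 'a \<Rightarrow> complex) \<Rightarrow> (('a \<Rightarrow> complex) \<Rightarrow> 'a \<Rightarrow> complex) \<Rightarrow> bool" where
  "bounded_Lp_extension M p B D S T \<longleftrightarrow>
     (\<forall>f\<in>Lp_space M p. T f \<in> Lp_space M p \<and> Lp_norm M p (T f) \<le> B * Lp_norm M p f) \<and>
     (\<forall>f\<in>Lp_space M p. \<forall>g\<in>Lp_space M p.
        AE x in M. T (\<lambda>y. f y + g y) x = T f x + T g x) \<and>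
     (\<forall>f\<in>Lp_space M p. \<forall>c. AE x in M. T (\<lambda>y. c * f y) x = c * T f x) \<and>
     (\<forall>f\<in>D \<inter> Lp_space M p. AE x in M. T f x = S f x)"

section \<open>Multipliers on the real line\<close>

definition fourier :: "(real \<Rightarrow> complex) \<Rightarrow> real \<Rightarrow> complex" where
  "fourier f \<xi> = (\<integral>x. f x * cis (- 2 * pi * x * \<xi>) \<partial>lebesgue)"

definition inv_fourier :: "(real \<Rightarrow> complex) \<Rightarrow> real \<Rightarrow> complex" where
  "inv_fourier g x = (\<integral>\<xi>. g \<xi> * cis (2 * pi * x * \<xi>) \<partial>lebesgue)"

text \<open>
  For bounded \<open>m\<close>, both integrals in \<open>inv_fourier (\<lambda>\<xi>. m \<xi> * fourier f \<xi>)\<close> converge absolutely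
  when \<open>f\<close> and its Fourier transform are integrable. For \<open>1 \<le> p < \<infinity>\<close> such \<open>f\<close> (which include
  the Schwartz functions) are dense in \<open>L\<^sup>p(\<real>)\<close>, and the multiplier operator on \<open>L\<^sup>p(\<real>)\<close> is the
  bounded extension from this class.
\<close>

definition fourier_integrable :: "(real \<Rightarrow> complex) set" where
  "fourier_integrable = {f. integrable lebesgue f \<and> integrable lebesgue (fourier f)}"

definition Lp_multiplier :: "real \<Rightarrow> real \<Rightarrow> (real \<Rightarrow> complex) \<Rightarrow> bool" where
  "Lp_multiplier p B m \<longleftrightarrow>
     m \<in> borel_measurable lebesgue \<and> bounded (range m) \<and>
     (\<exists>T. bounded_Lp_extension lebesgue p B fourier_integrable
            (\<lambda>f. inv_fourier (\<lambda>\<xi>. m \<xi> * fourier f \<xi>)) T)"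

section \<open>Operators on the integers\<close>

definition fourier_series :: "(int \<Rightarrow> complex) \<Rightarrow> real \<Rightarrow> complex" where
  "fourier_series f \<xi> = (\<Sum>\<^sub>\<infinity>n. f n * cis (- 2 * pi * of_int n * \<xi>))"

text \<open>
  The function on the integers whose Fourier series is
  \<open>\<Sum>\<ell>. m ((\<xi> - \<ell> - \<theta>) / \<epsilon>) * fourier_series f \<xi>\<close>, recovered from its Fourier coefficients;
  it is in general square-summable but not summable.
\<close>

definition arc_piece_ell1 ::
  "(real \<Rightarrow> complex) \<Rightarrow> real \<Rightarrow> real \<Rightarrow> (int \<Rightarrow> complex) \<Rightarrow> int \<Rightarrow> complex" where
  "arc_piece_ell1 m \<epsilon> \<theta> f n =
     (LINT \<xi>:{0..1}|lebesgue.
        (\<Sum>\<^sub>\<infinity>l::int. m ((\<xi> - of_int l - \<theta>) / \<epsilon>) * fourier_series f \<xi>)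
          * cis (2 * pi * of_int n * \<xi>))"

text \<open>
  The bounded extension to \<open>\<ell>\<^sup>p(\<int>)\<close>; the chosen operator is unique on \<open>ell p\<close>, since
  \<open>ell 1\<close> is dense there and null sets of the counting measure are empty.
\<close>

definition arc_piece ::
  "real \<Rightarrow> (real \<Rightarrow> complex) \<Rightarrow> real \<Rightarrow> real \<Rightarrow> (int \<Rightarrow> complex) \<Rightarrow> int \<Rightarrow> complex" where
  "arc_piece p m \<epsilon> \<theta> =
     (SOME T. \<exists>B. bounded_Lp_extension (count_space UNIV) p B (ell 1) (arc_piece_ell1 m \<epsilon> \<theta>) T)"

section \<open>Reduced fractions and prime divisors\<close>

definition reduced_fractions :: "nat \<Rightarrow> real set" where
  "reduced_fractions q = {real a / real q | a. 1 \<le> a \<and> a \<le> q \<and> coprime a q}"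

definition num_prime_divisors :: "nat \<Rightarrow> nat" where
  "num_prime_divisors q = card {p. prime p \<and> p dvd q}"

definition max_prime_divisors :: "nat set \<Rightarrow> nat" where
  "max_prime_divisors Z = Max (num_prime_divisors ` Z)"

end

theory Submission
  imports Defs "HOL-Probability.Probability"
begin

text \<open>
  Let \<open>\<chi>\<close> be a trapezoid equal to 1 on the support of \<open>m\<close> and let \<open>\<Phi>\<close> be its Fourier transform, which
  decays quadratically. Put \<open>F\<^sub>q = \<Sum>\<^sub>a f\<^bsub>a/q\<^esub>\<close> and let \<open>G\<^sub>q\<close> be the same sum with \<open>\<chi>\<close> in place of \<open>m\<close>; its kernel
  is \<open>c\<^sub>q(n) \<epsilon> \<Phi>(\<epsilon>n)\<close> with the Ramanujan sum \<open>c\<^sub>q\<close>. Since fractions with denominators at most \<open>q(Z)\<close> are more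
  than \<open>\<epsilon>\<close> apart, Bessel's inequality bounds \<open>f \<mapsto> (G\<^sub>q)\<^sub>q\<close> on \<open>l\<^sup>2\<close> by a constant. Expanding \<open>c\<^sub>q\<close> over the
  \<open>2\<^bsup>\<omega>(q)\<^esup>\<close> sets of prime divisors of \<open>q\<close> gives multiples of indicators of subgroups, hence the bound
  \<open>C 2\<^sup>\<Omega>\<close> on \<open>l\<^sup>\<infinity>\<close>. Interpolation yields \<open>C (2\<^sup>\<Omega>)\<^bsup>1 - 1/r\<^esup>\<close> on \<open>l\<^bsup>2r\<^esup>\<close>. Finally \<open>F\<^sub>q\<close> is the image of \<open>G\<^sub>q\<close> under
  the multiplier \<open>\<xi> \<mapsto> \<Sum>\<^sub>b m((\<xi> - b/q)/\<epsilon>)\<close> with \<open>b\<close> running over all integers. Being \<open>1/q\<close>-periodic, it acts on each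
  residue class modulo \<open>q\<close> separately, as the periodization of a dilate of \<open>m\<close>, and is bounded on
  \<open>l\<^bsup>2r\<^esup>\<close> by transference from \<open>\<real>\<close>.
\<close>

section \<open>The trapezoid kernel\<close>

text \<open>The detour through the trapezoid is forced by \<open>m\<close>: the kernel of an L^p
  multiplier need not be summable, so no sup-norm bound for the pieces is at hand. The trapezoid
  kernel is summable uniformly in its scale, which is all the endpoint estimate asks for; quadratic
  decay suffices, so no smoother bump is constructed. The multiplier \<open>m\<close> is put back
  for one denominator at a time, inside the sum of p-th powers with p = 2r, at a cost independent of
  q. It runs over all b and not just the reduced ones because only then is it 1/q-periodic; around
  the other fractions the transform of G_q vanishes, since 2 \<epsilon> q is at most 1. The exponent
  is that of interpolation in power form: an l^2 constant times K^(p - 2), with K a multiple of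
  2^\<Omega>, has p-th root of order (2^\<Omega>)^(1 - 1/r). All estimates are first proved for
  finitely supported f on finite windows and then passed to the limit. The pieces of the theorem are
  extensions selected by a choice operator, so it must also be shown that an extension exists, is
  unique, and is given by a convergent convolution.\<close>

definition e2pi :: "real \<Rightarrow> complex" where
  "e2pi t = cis (2 * pi * t)"

lemma e2pi_add: "e2pi (s + t) = e2pi s * e2pi t"
  by (simp add: e2pi_def cis_mult algebra_simps)

lemma e2pi_0 [simp]: "e2pi 0 = 1"
  by (simp add: e2pi_def)

lemma norm_e2pi [simp]: "norm (e2pi t) = 1"
  by (simp add: e2pi_def)

lemma cnj_e2pi: "cnj (e2pi t) = e2pi (- t)"
  by (simp add: e2pi_def cis_cnj)

lemma e2pi_of_int [simp]: "e2pi (of_int n) = 1"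
  using cis_multiple_2pi[of "of_int n"] by (simp add: e2pi_def)

lemma e2pi_power: "e2pi t ^ n = e2pi (of_nat n * t)"
  by (induction n) (simp_all add: distrib_right e2pi_add)

lemma continuous_on_e2pi [continuous_intros]:
  "continuous_on A f \<Longrightarrow> continuous_on A (\<lambda>x. e2pi (f x))"
  unfolding e2pi_def by (intro continuous_intros)

lemma borel_measurable_e2pi [measurable]: "e2pi \<in> borel_measurable borel"
  by (intro borel_measurable_continuous_onI continuous_intros)

section \<open>Jensen's inequality and Riemann sums of the Cauchy density\<close>

lemma power_tangent_le:
  fixes u a :: real
  assumes "0 \<le> u" "0 \<le> a" "0 < p"
  shows "a ^ p + of_nat p * a ^ (p - 1) * (u - a) \<le> u ^ p"
proof (cases "a = 0")
  case True
  with assms show ?thesis by (cases "p = 1") (auto simp: power_0_left)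
next
  case False
  with assms have a: "a > 0" by simp
  have "1 + real p * ((u - a) / a) \<le> (1 + (u - a) / a) ^ p"
    using a assms by (intro Bernoulli_inequality) (simp add: field_simps)
  also have "1 + (u - a) / a = u / a" using a by (simp add: field_simps)
  finally have "(1 + real p * ((u - a) / a)) * a ^ p \<le> (u / a) ^ p * a ^ p"
    using a by (intro mult_right_mono) auto
  also have "(u / a) ^ p * a ^ p = u ^ p"
    using a by (simp add: power_divide)
  also have "(1 + real p * ((u - a) / a)) * a ^ p = a ^ p + of_nat p * a ^ (p - 1) * (u - a)"
    using a assms by (cases p) (auto simp: field_simps)
  finally show ?thesis .
qed

text \<open>Jensen's inequality for the weight \<open>w\<close> of arbitrary total mass. The tangent
  inequality \<open>power_tangent_le\<close> is taken at the weighted mean of \<open>u\<close> and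
  integrated against \<open>w\<close>; its linear term then integrates to zero.\<close>

lemma weighted_power_integral_le:
  fixes w u :: "'a \<Rightarrow> real"
  assumes "\<And>x. 0 \<le> w x" "\<And>x. 0 \<le> u x" and p: "0 < p"
    and w: "integrable M w" and wu: "integrable M (\<lambda>x. w x * u x)"
    and wup: "integrable M (\<lambda>x. w x * u x ^ p)"
  shows "(\<integral>x. w x * u x \<partial>M) ^ p \<le> (\<integral>x. w x \<partial>M) ^ (p - 1) * (\<integral>x. w x * u x ^ p \<partial>M)"
proof -
  define W where "W = (\<integral>x. w x \<partial>M)"
  define a where "a = (\<integral>x. w x * u x \<partial>M) / W"
  have W0: "W \<ge> 0" unfolding W_def using assms by (intro integral_nonneg_AE) auto
  have I0: "(\<integral>x. w x * u x ^ p \<partial>M) \<ge> 0" using assms by (intro integral_nonneg_AE) auto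
  show ?thesis
  proof (cases "W = 0")
    case True
    then have "AE x in M. w x = 0"
      using integral_nonneg_eq_0_iff_AE[OF w] assms unfolding W_def by auto
    then have "(\<integral>x. w x * u x \<partial>M) = (\<integral>x. 0 \<partial>M)"
      by (intro integral_cong_AE) (use w wu in auto)
    then show ?thesis using p I0 W0 by (simp add: power_0_left W_def[symmetric])
  next
    case False
    with W0 have W: "W > 0" by simp
    have a0: "a \<ge> 0" unfolding a_def using W assms by (intro divide_nonneg_pos integral_nonneg_AE) auto
    have *: "w x * (a ^ p) + of_nat p * a ^ (p - 1) * (w x * u x - a * w x) \<le> w x * u x ^ p" for x
      using mult_left_mono[OF power_tangent_le[OF assms(2) a0 p], of "w x" x] assms(1)[of x]
      by (simp add: algebra_simps)
    have "(\<integral>x. w x * (a ^ p) + of_nat p * a ^ (p - 1) * (w x * u x - a * w x) \<partial>M) \<le> (\<integral>x. w x * u x ^ p \<partial>M)"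
      using w wu wup * by (intro Bochner_Integration.integral_mono) (auto intro!: Bochner_Integration.integrable_add Bochner_Integration.integrable_diff)
    also have "(\<integral>x. w x * (a ^ p) + of_nat p * a ^ (p - 1) * (w x * u x - a * w x) \<partial>M)
       = W * a ^ p + of_nat p * a ^ (p - 1) * (a * W - a * W)"
      using w wu W by (simp add: W_def[symmetric]) (simp add: a_def)
    finally have "W * a ^ p \<le> (\<integral>x. w x * u x ^ p \<partial>M)" by simp
    then have "W ^ (p - 1) * (W * a ^ p) \<le> W ^ (p - 1) * (\<integral>x. w x * u x ^ p \<partial>M)"
      using W by (intro mult_left_mono) auto
    also have "W ^ (p - 1) * (W * a ^ p) = (W * a) ^ p"
      using p by (cases p) (auto simp: power_mult_distrib)
    also have "W * a = (\<integral>x. w x * u x \<partial>M)" using W by (simp add: a_def)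
    finally show ?thesis by (simp add: W_def)
  qed
qed

lemma weighted_power_sum_le:
  fixes w u :: "'a \<Rightarrow> real"
  assumes "finite A" "\<And>x. 0 \<le> w x" "\<And>x. 0 \<le> u x" and p: "0 < p"
  shows "(\<Sum>x\<in>A. w x * u x) ^ p \<le> (\<Sum>x\<in>A. w x) ^ (p - 1) * (\<Sum>x\<in>A. w x * u x ^ p)"
  using weighted_power_integral_le[of w u p "count_space A"] assms
  by (simp add: integrable_count_space lebesgue_integral_count_space_finite)

text \<open>One step of an integral test without monotonicity. By the mean value theorem the
  increment of arctan is (b - a) / (1 + z^2), and moving by at most 1 changes 1 + x^2 by a factor of
  at most 3.\<close>

lemma cauchy_density_le_arctan_diff:
  fixes a b :: real
  assumes "a \<le> b" "b \<le> a + 1"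
  shows "(b - a) / (1 + a\<^sup>2) \<le> 3 * (arctan b - arctan a)"
proof (cases "a = b")
  case False
  with assms have "a < b" by simp
  then obtain z where z: "a < z" "z < b" "arctan b - arctan a = (b - a) * inverse (1 + z\<^sup>2)"
    using MVT2[of a b arctan "\<lambda>x. inverse (1 + x\<^sup>2)"] DERIV_arctan by blast
  have zd: "\<bar>z - a\<bar> \<le> 1" using z assms by auto
  have "(z - a)\<^sup>2 \<le> 1" using zd by (simp add: abs_square_le_1)
  moreover have "z\<^sup>2 \<le> 2 * a\<^sup>2 + 2 * (z - a)\<^sup>2"
    using zero_le_power2[of "z - 2 * a"] by (simp add: power2_eq_square algebra_simps)
  ultimately have "1 + z\<^sup>2 \<le> 3 * (1 + a\<^sup>2)"
    using zero_le_power2[of a] by argo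
  then have "1 / (1 + a\<^sup>2) \<le> 3 / (1 + z\<^sup>2)"
    using add_pos_nonneg[of 1 "a\<^sup>2"] add_pos_nonneg[of 1 "z\<^sup>2"] by (simp add: divide_simps)
  then have "(b - a) * (1 / (1 + a\<^sup>2)) \<le> (b - a) * (3 / (1 + z\<^sup>2))"
    using \<open>a < b\<close> by (intro mult_left_mono) auto
  then show ?thesis using z(3) by (simp add: divide_inverse)
qed auto

text \<open>The bounds by arctan increments telescope, and arctan varies by less than pi in total.
  Hence the bound depends neither on the step \<delta> nor on the shift \<open>y\<close>.\<close>

lemma sum_cauchy_density_le:
  fixes N :: "int set" and \<delta> y :: real
  assumes "finite N" "0 < \<delta>" "\<delta> \<le> 1"
  shows "(\<Sum>n\<in>N. \<delta> / (1 + (y - \<delta> * of_int n)\<^sup>2)) \<le> 3 * pi"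
proof -
  \<comment> \<open>The finite set is enlarged to an interval, where consecutive points allow
    telescoping; all terms are nonnegative.\<close>
  obtain a m where N: "N \<subseteq> (\<lambda>i. a + int i) ` {..<m}"
  proof -
    obtain k where k: "\<And>n. n \<in> N \<Longrightarrow> \<bar>n\<bar> \<le> k"
      using finite_imageI[OF assms(1), of abs] Max_ge by (metis imageI)
    have "N \<subseteq> (\<lambda>i. - k + int i) ` {..<nat (2 * k + 1)}"
    proof
      fix n assume "n \<in> N"
      then have "n = - k + int (nat (n + k))" "nat (n + k) < nat (2 * k + 1)"
        using k[of n] by auto
      then show "n \<in> (\<lambda>i. - k + int i) ` {..<nat (2 * k + 1)}" by blast
    qed
    then show ?thesis using that by blast
  qed
  define F where "F i = arctan (\<delta> * (of_int a + of_nat i) - y)" for i :: nat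
  have "(\<Sum>n\<in>N. \<delta> / (1 + (y - \<delta> * of_int n)\<^sup>2)) \<le>
      (\<Sum>n\<in>(\<lambda>i. a + int i) ` {..<m}. \<delta> / (1 + (y - \<delta> * of_int n)\<^sup>2))"
    using N assms by (intro sum_mono2) (auto intro!: divide_nonneg_pos add_pos_nonneg)
  also have "\<dots> = (\<Sum>i<m. \<delta> / (1 + (y - \<delta> * (of_int a + of_nat i))\<^sup>2))"
    by (subst sum.reindex) (auto simp: inj_on_def)
  also have "\<dots> \<le> (\<Sum>i<m. 3 * (F (Suc i) - F i))"
  proof (intro sum_mono)
    fix i
    show "\<delta> / (1 + (y - \<delta> * (of_int a + of_nat i))\<^sup>2) \<le> 3 * (F (Suc i) - F i)"
      using cauchy_density_le_arctan_diff[of "\<delta> * (of_int a + of_nat i) - y" "\<delta> * (of_int a + of_nat (Suc i)) - y"] assms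
      by (simp add: F_def algebra_simps power2_commute[of y])
  qed
  also have "\<dots> = 3 * (F m - F 0)"
    by (simp only: sum_distrib_left[symmetric] sum_lessThan_telescope)
  also have "\<dots> \<le> 3 * pi"
  proof -
    have "F m < pi / 2" "- (pi / 2) < F 0" unfolding F_def by (rule arctan_ubound arctan_lbound)+
    then show ?thesis by simp
  qed
  finally show ?thesis .
qed

section \<open>The trapezoid and the decay of its transform\<close>

definition triangle :: "real \<Rightarrow> real" where
  "triangle \<xi> = max 0 (1 - \<bar>\<xi>\<bar>)"

text \<open>The multiplier of de la Vallee Poussin type. Written as a difference of triangles, it
  has as transform a combination of two Fejer kernels, whence the quadratic decay.\<close>

definition trapezoid :: "real \<Rightarrow> real" where
  "trapezoid \<xi> = 2 * triangle \<xi> - triangle (2 * \<xi>)"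

definition trapezoid_ft :: "real \<Rightarrow> complex" where
  "trapezoid_ft x = (LBINT \<xi>. of_real (trapezoid \<xi>) * e2pi (x * \<xi>))"

text \<open>The integral of \<open>trapezoid (\<xi> / \<epsilon>)\<close> against the character of
  frequency n, by \<open>trapezoid_ft_dilate\<close>. The next abbreviation is its counterpart for
  \<open>m\<close>.\<close>

abbreviation trapezoid_kernel :: "real \<Rightarrow> int \<Rightarrow> complex" where
  "trapezoid_kernel \<epsilon> n \<equiv> of_real \<epsilon> * trapezoid_ft (\<epsilon> * of_int n)"

abbreviation multiplier_kernel :: "(real \<Rightarrow> complex) \<Rightarrow> real \<Rightarrow> int \<Rightarrow> complex" where
  "multiplier_kernel m \<epsilon> n \<equiv> of_real \<epsilon> * inv_fourier m (\<epsilon> * of_int n)"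

lemma trapezoid_eq_1: "\<bar>\<xi>\<bar> \<le> 1/2 \<Longrightarrow> trapezoid \<xi> = 1"
  by (auto simp: trapezoid_def triangle_def max_def)

lemma trapezoid_eq_0: "1 \<le> \<bar>\<xi>\<bar> \<Longrightarrow> trapezoid \<xi> = 0"
  by (auto simp: trapezoid_def triangle_def max_def)

lemma trapezoid_bounds: "0 \<le> trapezoid \<xi>" "trapezoid \<xi> \<le> 1"
  by (auto simp: trapezoid_def triangle_def max_def abs_mult)

lemma trapezoid_lipschitz: "\<bar>trapezoid x - trapezoid y\<bar> \<le> 2 * \<bar>x - y\<bar>"
proof -
  have "trapezoid \<xi> = max 0 (min 1 (2 - 2 * \<bar>\<xi>\<bar>))" for \<xi>
    by (auto simp: trapezoid_def triangle_def max_def min_def abs_mult)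
  moreover have "\<bar>max 0 (min 1 a) - max 0 (min 1 b)\<bar> \<le> \<bar>a - b\<bar>" for a b :: real
    by (auto simp: max_def min_def)
  moreover have "\<bar>\<bar>x\<bar> - \<bar>y\<bar>\<bar> \<le> \<bar>x - y\<bar>" by simp
  ultimately show ?thesis by (smt (verit))
qed

lemma continuous_on_triangle [continuous_intros]:
  "continuous_on A f \<Longrightarrow> continuous_on A (\<lambda>x. triangle (f x))"
  unfolding triangle_def by (intro continuous_intros)

lemma continuous_on_trapezoid [continuous_intros]:
  "continuous_on A f \<Longrightarrow> continuous_on A (\<lambda>x. trapezoid (f x))"
  unfolding trapezoid_def by (intro continuous_intros)

lemma borel_measurable_triangle [measurable]: "triangle \<in> borel_measurable borel"
  by (intro borel_measurable_continuous_onI continuous_intros)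

lemma borel_measurable_trapezoid [measurable]: "trapezoid \<in> borel_measurable borel"
  by (intro borel_measurable_continuous_onI continuous_intros)

lemma integrable_bounded_support:
  fixes f :: "real \<Rightarrow> 'b::{banach, second_countable_topology}"
  assumes "f \<in> borel_measurable borel" "\<And>x. norm (f x) \<le> C" "\<And>x. x \<notin> {a..b} \<Longrightarrow> f x = 0"
  shows "integrable lborel f"
proof (rule Bochner_Integration.integrable_bound)
  show "integrable lborel (\<lambda>x. indicator {a..b} x * C)" by (intro integrable_mult_left integrable_real_indicator) (auto simp: emeasure_lborel_Icc_eq)
  show "AE x in lborel. norm (f x) \<le> norm (indicator {a..b} x * C)"
    using assms(2,3) by (intro always_eventually) (fastforce simp: indicator_def intro: order_trans)
qed (use assms in auto)

lemma integrable_triangle_e2pi: "integrable lborel (\<lambda>\<xi>. of_real (triangle (c * \<xi>)) * e2pi (x * \<xi>))"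
  if "c \<noteq> 0"
proof (rule integrable_bounded_support)
  show "norm (of_real (triangle (c * \<xi>)) * e2pi (x * \<xi>)) \<le> 1" for \<xi>
    by (simp add: norm_mult triangle_def)
  show "of_real (triangle (c * \<xi>)) * e2pi (x * \<xi>) = 0" if "\<xi> \<notin> {- (1 / \<bar>c\<bar>)..1 / \<bar>c\<bar>}" for \<xi>
  proof -
    have "1 / \<bar>c\<bar> < \<bar>\<xi>\<bar>" using that by auto
    then have "1 \<le> \<bar>c * \<xi>\<bar>" using \<open>c \<noteq> 0\<close> by (simp add: abs_mult field_simps)
    then show ?thesis by (simp add: triangle_def)
  qed
qed measurable

text \<open>With explicit antiderivatives on [-1,0] and [0,1] the boundary terms of order 1/c cancel
  at the corner 0. What remains is the second difference e(x) + e(-x) - 2 over c^2, of modulus at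
  most 4 / |c|^2.\<close>

lemma triangle_ft:
  assumes "x \<noteq> 0"
  shows "norm (LBINT \<xi>. of_real (triangle \<xi>) * e2pi (x * \<xi>)) \<le> 1 / (pi\<^sup>2 * x\<^sup>2)"
proof -
  define c where "c = 2 * pi * \<i> * x"
  have c: "c \<noteq> 0" using assms by (simp add: c_def)
  have e: "e2pi (x * \<xi>) = exp (of_real \<xi> * c)" for \<xi>
    by (simp add: e2pi_def cis_conv_exp c_def mult_ac)
  have d1: "((\<lambda>\<xi>. (1 - of_real \<xi>) * exp (of_real \<xi> * c) / c + exp (of_real \<xi> * c) / c\<^sup>2) has_vector_derivative
      (1 - of_real \<xi>) * exp (of_real \<xi> * c)) (at \<xi> within A)" for \<xi> A
  proof -
    have "((\<lambda>z. (1 - z) * exp (z * c) / c + exp (z * c) / c\<^sup>2) has_field_derivative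
        (1 - of_real \<xi>) * exp (of_real \<xi> * c)) (at (of_real \<xi>))"
      by (rule derivative_eq_intros refl c | simp add: c)+ (simp add: c field_simps power2_eq_square power4_eq_xxxx)
    from has_vector_derivative_real_field[OF this] show ?thesis .
  qed
  have d2: "((\<lambda>\<xi>. (1 + of_real \<xi>) * exp (of_real \<xi> * c) / c - exp (of_real \<xi> * c) / c\<^sup>2) has_vector_derivative
      (1 + of_real \<xi>) * exp (of_real \<xi> * c)) (at \<xi> within A)" for \<xi> A
  proof -
    have "((\<lambda>z. (1 + z) * exp (z * c) / c - exp (z * c) / c\<^sup>2) has_field_derivative
        (1 + of_real \<xi>) * exp (of_real \<xi> * c)) (at (of_real \<xi>))"
      by (rule derivative_eq_intros refl c | simp add: c)+ (simp add: c field_simps power2_eq_square power4_eq_xxxx)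
    from has_vector_derivative_real_field[OF this] show ?thesis .
  qed
  have c1: "continuous_on A (\<lambda>\<xi>. (1 - of_real \<xi>) * exp (of_real \<xi> * c))"
    and c2: "continuous_on A (\<lambda>\<xi>. (1 + of_real \<xi>) * exp (of_real \<xi> * c))" for A :: "real set"
    by (intro continuous_intros)+
  have 1: "has_bochner_integral lborel (\<lambda>\<xi>. indicator {0..1} \<xi> *\<^sub>R (of_real (1 - \<xi>) * e2pi (x * \<xi>)))
     (e2pi x / c\<^sup>2 - (1 / c + 1 / c\<^sup>2))"
    using has_bochner_integral_FTC_Icc[OF _ d1 c1, of 0 1] e[of 1] by (simp add: e)
  have 2: "has_bochner_integral lborel (\<lambda>\<xi>. indicator {-1..0} \<xi> *\<^sub>R (of_real (1 + \<xi>) * e2pi (x * \<xi>)))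
     (1 / c - 1 / c\<^sup>2 + e2pi (- x) / c\<^sup>2)"
    using has_bochner_integral_FTC_Icc[OF _ d2 c2, of "-1" 0] e[of "-1"] by (simp add: e)
  \<comment> \<open>The two closed halves overlap at 0, so the integrands agree only almost
    everywhere.\<close>
  have "(LBINT \<xi>. of_real (triangle \<xi>) * e2pi (x * \<xi>)) =
     (LBINT \<xi>. indicator {-1..0} \<xi> *\<^sub>R (of_real (1 + \<xi>) * e2pi (x * \<xi>)) + indicator {0..1} \<xi> *\<^sub>R (of_real (1 - \<xi>) * e2pi (x * \<xi>)))"
  proof (rule integral_cong_AE)
    show "AE \<xi> in lborel. of_real (triangle \<xi>) * e2pi (x * \<xi>) =
      indicator {-1..0} \<xi> *\<^sub>R (of_real (1 + \<xi>) * e2pi (x * \<xi>)) + indicator {0..1} \<xi> *\<^sub>R (of_real (1 - \<xi>) * e2pi (x * \<xi>))"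
      using AE_lborel_singleton[of "0::real"]
      by eventually_elim (auto simp: triangle_def indicator_def max_def)
  qed measurable
  also have "\<dots> = (1 / c - 1 / c\<^sup>2 + e2pi (- x) / c\<^sup>2) + (e2pi x / c\<^sup>2 - (1 / c + 1 / c\<^sup>2))"
    by (rule has_bochner_integral_integral_eq[OF has_bochner_integral_add[OF 2 1]])
  also have "\<dots> = (e2pi x + e2pi (- x) - 2) / c\<^sup>2"
    by (simp add: diff_divide_distrib add_divide_distrib)
  also have "norm \<dots> \<le> 4 / (norm c)\<^sup>2"
  proof -
    have "norm (e2pi x + e2pi (- x) - 2) \<le> norm (e2pi x) + norm (e2pi (- x)) + norm (2::complex)"
      by (meson norm_triangle_ineq norm_triangle_ineq4 add_right_mono order_trans)
    then show ?thesis by (simp add: norm_divide norm_power divide_right_mono)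
  qed
  also have "(norm c)\<^sup>2 = 4 * pi\<^sup>2 * x\<^sup>2" by (simp add: c_def norm_mult power_mult_distrib)
  finally show ?thesis by simp
qed

text \<open>The trivial bound 2, the length of [-1,1], is added to
  \<open>x\<^sup>2 * norm (trapezoid_ft x) \<le> 1\<close>. The latter comes from the triangle
  bounds at x and x/2, with total 4 / (pi x)^2, and from pi being at least 2.\<close>

lemma norm_trapezoid_ft_le: "norm (trapezoid_ft x) \<le> 3 / (1 + x\<^sup>2)"
proof -
  have a: "norm (trapezoid_ft x) \<le> 2"
  proof -
    have "norm (trapezoid_ft x) \<le> (LBINT \<xi>. norm (of_real (trapezoid \<xi>) * e2pi (x * \<xi>)))"
      unfolding trapezoid_ft_def by (rule integral_norm_bound)
    also have "\<dots> \<le> (LBINT \<xi>. indicator {-1..1::real} \<xi>)"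
    proof (rule Bochner_Integration.integral_mono)
      show "integrable lborel (\<lambda>\<xi>. norm (of_real (trapezoid \<xi>) * e2pi (x * \<xi>)))"
        by (rule integrable_bounded_support[where C=1 and a="-1" and b=1])
           (auto simp: norm_mult trapezoid_bounds trapezoid_eq_0)
      show "norm (of_real (trapezoid \<xi>) * e2pi (x * \<xi>)) \<le> indicator {-1..1} \<xi>" for \<xi>
        by (auto simp: norm_mult trapezoid_bounds trapezoid_eq_0 indicator_def)
    qed (auto simp: emeasure_lborel_Icc_eq intro!: integrable_real_indicator)
    finally show ?thesis by simp
  qed
  show ?thesis
  proof (cases "x = 0")
    case True
    with a show ?thesis by simp
  next
    case False
    define T where "T x = (LBINT \<xi>. of_real (triangle \<xi>) * e2pi (x * \<xi>))" for x
    have "trapezoid_ft x = 2 * T x - (LBINT \<xi>. of_real (triangle (2 * \<xi>)) * e2pi (x * \<xi>))"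
      using integrable_triangle_e2pi[of 1 x] integrable_triangle_e2pi[of 2 x]
      by (simp add: trapezoid_ft_def trapezoid_def T_def algebra_simps)
    also have "(LBINT \<xi>. of_real (triangle (2 * \<xi>)) * e2pi (x * \<xi>)) = T (x / 2) / 2"
      unfolding T_def
      by (subst (2) lborel_integral_real_affine[of 2 _ 0]) (auto simp: scaleR_conv_of_real)
    finally have "norm (trapezoid_ft x) \<le> 2 * norm (T x) + norm (T (x / 2)) / 2"
      by (simp add: norm_triangle_le_diff norm_mult norm_divide)
    also have "\<dots> \<le> 2 * (1 / (pi\<^sup>2 * x\<^sup>2)) + (1 / (pi\<^sup>2 * (x / 2)\<^sup>2)) / 2"
      unfolding T_def using False
      by (intro add_mono mult_left_mono divide_right_mono triangle_ft) auto
    also have "\<dots> = 4 / pi\<^sup>2 / x\<^sup>2" using False by (simp add: field_simps)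
    also have "\<dots> \<le> 1 / x\<^sup>2"
    proof -
      have "2 * 2 \<le> pi * pi" using pi_ge_two by (intro mult_mono) auto
      then have "4 / pi\<^sup>2 \<le> 1" by (simp add: power2_eq_square)
      then show ?thesis by (intro divide_right_mono) auto
    qed
    finally have "x\<^sup>2 * norm (trapezoid_ft x) \<le> 1" using False by (simp add: field_simps)
    then have "(1 + x\<^sup>2) * norm (trapezoid_ft x) \<le> 3" using a by (simp add: algebra_simps)
    then show ?thesis using add_pos_nonneg[of 1 "x\<^sup>2"] by (simp add: field_simps)
  qed
qed

text \<open>Uniform summability at every scale \<delta> up to 1 and every shift. The constant 9 pi,
  three times three pi, recurs in all later bounds.\<close>

lemma sum_norm_trapezoid_ft_le:
  fixes N :: "int set" and \<delta> y :: real
  assumes "finite N" "0 < \<delta>" "\<delta> \<le> 1"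
  shows "(\<Sum>n\<in>N. \<delta> * norm (trapezoid_ft (y - \<delta> * of_int n))) \<le> 9 * pi"
proof -
  have "(\<Sum>n\<in>N. \<delta> * norm (trapezoid_ft (y - \<delta> * of_int n))) \<le> (\<Sum>n\<in>N. 3 * (\<delta> / (1 + (y - \<delta> * of_int n)\<^sup>2)))"
    using assms mult_left_mono[OF norm_trapezoid_ft_le, of \<delta>] by (intro sum_mono) (simp add: mult_ac)
  also have "\<dots> = 3 * (\<Sum>n\<in>N. \<delta> / (1 + (y - \<delta> * of_int n)\<^sup>2))" by (simp only: sum_distrib_left)
  also have "\<dots> \<le> 3 * (3 * pi)" using assms by (intro mult_left_mono sum_cauchy_density_le) auto
  finally show ?thesis by simp
qed

lemma sum_norm_trapezoid_ft_lattice_le: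
  fixes N :: "int set"
  assumes "finite N" "0 < \<delta>" "\<delta> \<le> 1"
  shows "(\<Sum>n\<in>N. \<delta> * norm (trapezoid_ft (\<delta> * of_int n))) \<le> 9 * pi"
proof -
  have "(\<Sum>n\<in>N. \<delta> * norm (trapezoid_ft (\<delta> * of_int n))) = (\<Sum>n\<in>uminus ` N. \<delta> * norm (trapezoid_ft (0 - \<delta> * of_int n)))"
    by (subst sum.reindex) (auto simp: inj_on_def)
  also have "\<dots> \<le> 9 * pi" using assms by (intro sum_norm_trapezoid_ft_le) auto
  finally show ?thesis .
qed

section \<open>Fourier inversion for the trapezoid\<close>

lemma integrable_trapezoid_e2pi: "integrable lborel (\<lambda>\<xi>. of_real (trapezoid \<xi>) * e2pi (x * \<xi>))"
  by (rule integrable_bounded_support[where C=1 and a="-1" and b=1])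
     (auto simp: norm_mult trapezoid_bounds trapezoid_eq_0)

lemma integrable_cauchy_density: "integrable lborel (\<lambda>x::real. 1 / (1 + x\<^sup>2))"
proof -
  have "einterval (-\<infinity>) \<infinity> = (UNIV :: real set)" by (auto simp: einterval_def)
  with Sinc_Integral.integrable_inverse_1_plus_square show ?thesis
    by (simp add: set_integrable_def inverse_eq_divide)
qed

text \<open>Dominated convergence with majorant |u|. It serves to make transforms Borel
  measurable.\<close>

lemma continuous_on_ft:
  fixes u :: "real \<Rightarrow> complex"
  assumes u: "integrable lborel u"
  shows "continuous_on UNIV (\<lambda>x. LBINT \<xi>. u \<xi> * e2pi (x * \<xi>))"
proof (rule continuous_at_imp_continuous_on, rule ballI)
  fix x
  have [measurable]: "u \<in> borel_measurable borel" using u by simp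
  show "isCont (\<lambda>x. LBINT \<xi>. u \<xi> * e2pi (x * \<xi>)) x"
    unfolding continuous_at_sequentially comp_def
  proof (intro allI impI)
    fix y :: "nat \<Rightarrow> real" assume y: "y \<longlonglongrightarrow> x"
    show "(\<lambda>n. LBINT \<xi>. u \<xi> * e2pi (y n * \<xi>)) \<longlonglongrightarrow> (LBINT \<xi>. u \<xi> * e2pi (x * \<xi>))"
    proof (rule integral_dominated_convergence[where w="\<lambda>\<xi>. norm (u \<xi>)"])
      show "AE \<xi> in lborel. (\<lambda>n. u \<xi> * e2pi (y n * \<xi>)) \<longlonglongrightarrow> u \<xi> * e2pi (x * \<xi>)"
        unfolding e2pi_def by (intro always_eventually allI tendsto_intros y)
    qed (use u in \<open>auto simp: norm_mult\<close>)
  qed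
qed

lemma borel_measurable_trapezoid_ft [measurable]: "trapezoid_ft \<in> borel_measurable borel"
  unfolding trapezoid_ft_def[abs_def] using integrable_trapezoid_e2pi[of 0]
  by (intro borel_measurable_continuous_onI continuous_on_ft) simp

lemma integrable_trapezoid_ft: "integrable lborel trapezoid_ft"
proof (rule Bochner_Integration.integrable_bound)
  show "integrable lborel (\<lambda>x::real. 3 * (1 / (1 + x\<^sup>2)))"
    using integrable_cauchy_density by (intro integrable_mult_right)
qed (use norm_trapezoid_ft_le in \<open>auto simp: abs_of_nonneg\<close>)

lemma std_normal_ft:
  "(LBINT x. of_real (std_normal_density x) * e2pi (s * x)) = of_real (exp (- (2 * pi * s)\<^sup>2 / 2))"
proof -
  have "of_real (exp (- (2 * pi * s)\<^sup>2 / 2)) = char std_normal_distribution (2 * pi * s)"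
    by (simp add: char_std_normal_distribution)
  also have "\<dots> = (LBINT x. std_normal_density x *\<^sub>R iexp (2 * pi * s * x))"
    unfolding char_def by (subst integral_density) (auto simp: normal_density_nonneg)
  also have "\<dots> = (LBINT x. of_real (std_normal_density x) * e2pi (s * x))"
    by (simp add: scaleR_conv_of_real e2pi_def cis_conv_exp mult_ac)
  finally show ?thesis by simp
qed

text \<open>Inserting the factor \<open>exp (- (2 * pi * t * x)\<^sup>2 / 2)\<close> turns the double integral into the
  convolution of \<open>u\<close> with a Gaussian of width \<open>t\<close>, which is an approximate identity.\<close>

lemma fourier_inversion:
  fixes u :: "real \<Rightarrow> complex"
  assumes cont: "continuous_on UNIV u" and bdd: "\<And>x. norm (u x) \<le> C" and u: "integrable lborel u"
    and ft: "integrable lborel (\<lambda>x. LBINT \<xi>. u \<xi> * e2pi (x * \<xi>))"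
  shows "(LBINT x. (LBINT \<xi>. u \<xi> * e2pi (x * \<xi>)) * e2pi (- (x * \<eta>))) = u \<eta>"
proof -
  define U where "U x = (LBINT \<xi>. u \<xi> * e2pi (x * \<xi>))" for x
  define t where "t n = 1 / real (Suc n)" for n
  have t0: "t n > 0" for n by (simp add: t_def)
  have tlim: "t \<longlonglongrightarrow> 0" unfolding t_def using LIMSEQ_Suc[OF lim_1_over_n] by simp
  have [measurable]: "u \<in> borel_measurable borel" using u by simp
  have Uint: "integrable lborel U" using ft by (simp add: U_def[abs_def])
  have [measurable]: "U \<in> borel_measurable borel" using Uint by simp
  define G where "G s x = exp (- (2 * pi * s * x)\<^sup>2 / 2)" for s x :: real
  have Gm[measurable]: "G s \<in> borel_measurable borel" for s unfolding G_def by measurable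
  have Gint: "integrable lborel (G s)" if "s > 0" for s
  proof -
    have "integrable lborel (\<lambda>x. sqrt (2 * pi) * std_normal_density (0 + (2 * pi * s) * x))"
      using that by (intro integrable_mult_right lborel_integrable_real_affine integrable_normal_density) auto
    also have "(\<lambda>x. sqrt (2 * pi) * std_normal_density (0 + (2 * pi * s) * x)) = G s"
      by (auto simp: std_normal_density_def G_def fun_eq_iff)
    finally show ?thesis .
  qed
  have Gft: "(LBINT x. of_real (G s x) * e2pi (y * x)) = of_real (std_normal_density (y / s) / s)" if s: "s > 0" for s y
  proof -
    \<comment> \<open>At this frequency the substitution with factor \<open>2 * pi * s\<close> turns
      the transform of the standard normal density into that of \<open>G s\<close>.\<close>
    define z where "z = y / (2 * pi * s)"
    have "(LBINT x. of_real (std_normal_density x) * e2pi (z * x)) =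
       (2 * pi * s) *\<^sub>R (LBINT x. of_real (std_normal_density (0 + (2 * pi * s) * x)) * e2pi (z * (0 + (2 * pi * s) * x)))"
      using s by (subst lborel_integral_real_affine[of "2 * pi * s" _ 0]) auto
    also have "(\<lambda>x. of_real (std_normal_density (0 + (2 * pi * s) * x)) * e2pi (z * (0 + (2 * pi * s) * x))) =
       (\<lambda>x. of_real (1 / sqrt (2 * pi)) * (of_real (G s x) * e2pi (y * x)))"
      using s by (auto simp: std_normal_density_def G_def fun_eq_iff z_def)
    finally have "of_real (2 * pi * s / sqrt (2 * pi)) * (LBINT x. of_real (G s x) * e2pi (y * x))
        = (of_real (exp (- (y / s)\<^sup>2 / 2)) :: complex)"
      using s unfolding std_normal_ft z_def by (simp add: scaleR_conv_of_real)
    moreover have "2 * pi * s / sqrt (2 * pi) = sqrt (2 * pi) * s"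
      by (simp add: real_div_sqrt field_simps)
    ultimately have "of_real (sqrt (2 * pi) * s) * (LBINT x. of_real (G s x) * e2pi (y * x))
        = (of_real (exp (- (y / s)\<^sup>2 / 2)) :: complex)" by metis
    then have "(LBINT x. of_real (G s x) * e2pi (y * x)) = (of_real (exp (- (y / s)\<^sup>2 / 2)) :: complex) / of_real (sqrt (2 * pi) * s)"
      using s by (simp add: nonzero_eq_divide_eq mult.commute)
    then show ?thesis by (simp add: std_normal_density_def field_simps)
  qed
  have eq: "(LBINT x. U x * e2pi (- (x * \<eta>)) * of_real (G (t n) x)) =
     (LBINT z. u (\<eta> + t n * z) * of_real (std_normal_density z))" for n
  proof -
    have int2: "integrable (lborel \<Otimes>\<^sub>M lborel) (\<lambda>(x, \<xi>). (u \<xi> * e2pi (x * \<xi>)) * e2pi (- (x * \<eta>)) * of_real (G (t n) x))"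
    proof (rule Bochner_Integration.integrable_bound)
      show "integrable (lborel \<Otimes>\<^sub>M lborel) (\<lambda>(x, \<xi>). G (t n) x * norm (u \<xi>))"
      proof (rule lborel_pair.Fubini_integrable)
        show "integrable lborel (\<lambda>x. LBINT y. norm (case (x, y) of (x, \<xi>) \<Rightarrow> G (t n) x * norm (u \<xi>)))"
          using Gint[OF t0[of n]] by (simp add: abs_mult)
      qed (use u Gint in auto)
      show "AE x in lborel \<Otimes>\<^sub>M lborel. norm (case x of (x, \<xi>) \<Rightarrow> (u \<xi> * e2pi (x * \<xi>)) * e2pi (- (x * \<eta>)) * of_real (G (t n) x))
        \<le> norm (case x of (x, \<xi>) \<Rightarrow> G (t n) x * norm (u \<xi>))"
        by (auto simp: norm_mult abs_mult mult.commute)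
    qed measurable
    have "(LBINT x. U x * e2pi (- (x * \<eta>)) * of_real (G (t n) x)) =
       (LBINT x. LBINT \<xi>. (u \<xi> * e2pi (x * \<xi>)) * e2pi (- (x * \<eta>)) * of_real (G (t n) x))"
      by (simp only: U_def integral_mult_left_zero)
    also have "\<dots> = (LBINT \<xi>. LBINT x. (u \<xi> * e2pi (x * \<xi>)) * e2pi (- (x * \<eta>)) * of_real (G (t n) x))"
      by (rule lborel_pair.Fubini_integral[symmetric]) (fact int2)
    also have "\<dots> = (LBINT \<xi>. u \<xi> * (LBINT x. of_real (G (t n) x) * e2pi ((\<xi> - \<eta>) * x)))"
    proof (intro Bochner_Integration.integral_cong refl)
      fix \<xi>
      have "(LBINT x. (u \<xi> * e2pi (x * \<xi>)) * e2pi (- (x * \<eta>)) * of_real (G (t n) x)) =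
        (LBINT x. u \<xi> * (of_real (G (t n) x) * e2pi ((\<xi> - \<eta>) * x)))"
        by (intro Bochner_Integration.integral_cong refl) (simp add: algebra_simps e2pi_add flip: e2pi_add)
      then show "(LBINT x. (u \<xi> * e2pi (x * \<xi>)) * e2pi (- (x * \<eta>)) * of_real (G (t n) x)) =
        u \<xi> * (LBINT x. of_real (G (t n) x) * e2pi ((\<xi> - \<eta>) * x))" by simp
    qed
    also have "\<dots> = (LBINT \<xi>. u \<xi> * of_real (std_normal_density ((\<xi> - \<eta>) / t n) / t n))"
      by (simp only: Gft[OF t0])
    also have "\<dots> = t n *\<^sub>R (LBINT z. u (\<eta> + t n * z) * of_real (std_normal_density ((\<eta> + t n * z - \<eta>) / t n) / t n))"
      using t0[of n] by (subst lborel_integral_real_affine[of "t n" _ \<eta>]) auto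
    also have "\<dots> = (LBINT z. u (\<eta> + t n * z) * of_real (std_normal_density z))"
      using t0[of n] by (simp add: scaleR_conv_of_real)
    finally show ?thesis .
  qed
  have "(\<lambda>n. LBINT z. u (\<eta> + t n * z) * of_real (std_normal_density z)) \<longlonglongrightarrow>
     (LBINT z. u \<eta> * of_real (std_normal_density z))"
  proof (rule integral_dominated_convergence[where w="\<lambda>z. C * std_normal_density z"])
    show "AE z in lborel. (\<lambda>n. u (\<eta> + t n * z) * of_real (std_normal_density z)) \<longlonglongrightarrow> u \<eta> * of_real (std_normal_density z)"
    proof (intro always_eventually allI tendsto_mult tendsto_const)
      fix z
      have "(\<lambda>n. \<eta> + t n * z) \<longlonglongrightarrow> \<eta> + 0 * z" by (intro tendsto_intros tlim)
      then show "(\<lambda>n. u (\<eta> + t n * z)) \<longlonglongrightarrow> u \<eta>"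
        using cont by (intro continuous_on_tendsto_compose[OF cont]) auto
    qed
    show "AE z in lborel. norm (u (\<eta> + t n * z) * of_real (std_normal_density z)) \<le> C * std_normal_density z" for n
      by (auto simp: norm_mult normal_density_nonneg intro!: mult_right_mono bdd)
  qed auto
  also have "(LBINT z. u \<eta> * of_real (std_normal_density z)) = u \<eta>"
    by simp
  finally have lim1: "(\<lambda>n. LBINT x. U x * e2pi (- (x * \<eta>)) * of_real (G (t n) x)) \<longlonglongrightarrow> u \<eta>"
    by (simp only: eq)
  have lim2: "(\<lambda>n. LBINT x. U x * e2pi (- (x * \<eta>)) * of_real (G (t n) x)) \<longlonglongrightarrow> (LBINT x. U x * e2pi (- (x * \<eta>)))"
  proof (rule integral_dominated_convergence[where w="\<lambda>x. norm (U x)"])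
    show "AE x in lborel. (\<lambda>n. U x * e2pi (- (x * \<eta>)) * of_real (G (t n) x)) \<longlonglongrightarrow> U x * e2pi (- (x * \<eta>))"
    proof (intro always_eventually allI)
      fix x
      have "(\<lambda>n. U x * e2pi (- (x * \<eta>)) * of_real (G (t n) x)) \<longlonglongrightarrow> U x * e2pi (- (x * \<eta>)) * of_real (exp (- (2 * pi * 0 * x)\<^sup>2 / 2))"
        unfolding G_def by (intro tendsto_intros tlim) auto
      then show "(\<lambda>n. U x * e2pi (- (x * \<eta>)) * of_real (G (t n) x)) \<longlonglongrightarrow> U x * e2pi (- (x * \<eta>))" by simp
    qed
    show "AE x in lborel. norm (U x * e2pi (- (x * \<eta>)) * of_real (G (t n) x)) \<le> norm (U x)" for n
      by (auto simp: norm_mult G_def intro!: mult_left_le)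
  qed (use Uint in auto)
  show ?thesis using LIMSEQ_unique[OF lim2 lim1] by (simp add: U_def)
qed

lemma fourier_trapezoid_ft:
  "(LBINT x. trapezoid_ft x * e2pi (- (x * \<eta>))) = of_real (trapezoid \<eta>)"
  unfolding trapezoid_ft_def
proof (rule fourier_inversion[where C=1])
  show "integrable lborel (\<lambda>x. complex_of_real (trapezoid x))"
    using integrable_trapezoid_e2pi[of 0] by simp
  show "integrable lborel (\<lambda>x. LBINT \<xi>. of_real (trapezoid \<xi>) * e2pi (x * \<xi>))"
    using integrable_trapezoid_ft by (simp add: trapezoid_ft_def[abs_def])
qed (auto intro!: continuous_intros simp: trapezoid_bounds)

section \<open>Transference of multipliers from the line to the integers\<close>

lemma Lp_norm_power:
  assumes "0 < p"
  shows "Lp_norm M (real p) f ^ p = (\<integral>x. norm (f x) ^ p \<partial>M)"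
proof -
  have eq: "(\<integral>x. norm (f x) powr real p \<partial>M) = (\<integral>x. norm (f x) ^ p \<partial>M)"
    using assms by (intro Bochner_Integration.integral_cong refl powr_realpow') auto
  have "(\<integral>x. norm (f x) ^ p \<partial>M) \<ge> 0" by simp
  then show ?thesis
    unfolding Lp_norm_def eq using assms
    by (simp flip: powr_realpow' add: powr_powr)
qed

lemma Lp_norm_nonneg: "0 \<le> Lp_norm M p f"
  by (simp add: Lp_norm_def)

lemma Lp_space_nat_iff:
  assumes "0 < p"
  shows "f \<in> Lp_space M (real p) \<longleftrightarrow> f \<in> borel_measurable M \<and> integrable M (\<lambda>x. norm (f x) ^ p)"
proof -
  have "(\<lambda>x. norm (f x) powr real p) = (\<lambda>x. norm (f x) ^ p)"
    using assms by (intro ext powr_realpow') auto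
  then show ?thesis by (simp add: Lp_space_def)
qed

text \<open>Transfers the operator bound from \<open>T f\<close> to a measurable function
  \<open>h\<close> that agrees with \<open>S f\<close> almost everywhere. The sign of
  \<open>B\<close> is not prescribed, and taking p-th powers is monotone only on nonnegative
  numbers, hence the absolute value.\<close>

lemma bounded_Lp_extension_power_le:
  assumes T: "bounded_Lp_extension M (real p) B D S T" and p: "0 < p"
    and f: "f \<in> D" "f \<in> Lp_space M (real p)"
    and h: "h \<in> borel_measurable M" "AE x in M. S f x = h x"
  shows "integrable M (\<lambda>x. norm (h x) ^ p)"
    and "(\<integral>x. norm (h x) ^ p \<partial>M) \<le> \<bar>B\<bar> ^ p * (\<integral>x. norm (f x) ^ p \<partial>M)"
proof -
  have Tf: "T f \<in> Lp_space M (real p)" and le: "Lp_norm M (real p) (T f) \<le> B * Lp_norm M (real p) f"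
    and ae: "AE x in M. T f x = S f x"
    using T f unfolding bounded_Lp_extension_def by auto
  have ae': "AE x in M. norm (T f x) ^ p = norm (h x) ^ p" using ae h(2) by eventually_elim simp
  have m: "T f \<in> borel_measurable M" "integrable M (\<lambda>x. norm (T f x) ^ p)"
    using Tf p by (auto simp: Lp_space_nat_iff)
  show "integrable M (\<lambda>x. norm (h x) ^ p)"
    using integrable_cong_AE[OF _ _ ae'] m h(1) by simp
  have "(\<integral>x. norm (h x) ^ p \<partial>M) = (\<integral>x. norm (T f x) ^ p \<partial>M)"
    using integral_cong_AE[OF _ _ ae'] m h(1) by simp
  also have "\<dots> = Lp_norm M (real p) (T f) ^ p" by (simp only: Lp_norm_power[OF p])
  also have "\<dots> \<le> (\<bar>B\<bar> * Lp_norm M (real p) f) ^ p"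
    using le Lp_norm_nonneg[of M "real p"]
    by (intro power_mono order_trans[OF le] mult_right_mono) auto
  also have "\<dots> = \<bar>B\<bar> ^ p * (\<integral>x. norm (f x) ^ p \<partial>M)"
    by (simp only: power_mult_distrib Lp_norm_power[OF p])
  finally show "(\<integral>x. norm (h x) ^ p \<partial>M) \<le> \<bar>B\<bar> ^ p * (\<integral>x. norm (f x) ^ p \<partial>M)" .
qed

text \<open>The multiplier is only Lebesgue measurable, whereas Fubini is applied on products of
  \<open>lborel\<close>. Bound and support are required at every point, not just almost
  everywhere.\<close>

lemma lebesgue_bounded_borel_representative:
  fixes m :: "real \<Rightarrow> complex"
  assumes "m \<in> borel_measurable lebesgue" "bounded (range m)" "{x. m x \<noteq> 0} \<subseteq> A" "A \<in> sets borel"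
  obtains m' C where "m' \<in> borel_measurable borel" "\<And>x. norm (m' x) \<le> C" "{x. m' x \<noteq> 0} \<subseteq> A"
    "AE x in lebesgue. m x = m' x"
proof -
  obtain C where C: "\<And>x. norm (m x) \<le> C" using assms(2) by (auto simp: bounded_iff)
  have C0: "C \<ge> 0" using C[of 0] norm_ge_zero order_trans by blast
  obtain a where a[measurable]: "a \<in> borel_measurable lborel" "AE x in lborel. Re (m x) = a x"
    using completion_ex_borel_measurable_real[of "\<lambda>x. Re (m x)" lborel] assms(1) by auto
  obtain b where b[measurable]: "b \<in> borel_measurable lborel" "AE x in lborel. Im (m x) = b x"
    using completion_ex_borel_measurable_real[of "\<lambda>x. Im (m x)" lborel] assms(1) by auto
  note [measurable] = assms(4)
  \<comment> \<open>Truncation outside \<open>A\<close> and above the level \<open>C\<close> changes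
    the function only on a null set and makes the bound and the support hold everywhere.\<close>
  define m' where "m' x = (if x \<in> A \<and> norm (Complex (a x) (b x)) \<le> C then Complex (a x) (b x) else 0)" for x
  have [measurable]: "(\<lambda>x. Complex (a x) (b x)) \<in> borel_measurable borel"
    unfolding Complex_eq by measurable
  have ae: "AE x in lborel. m x = m' x"
    using a(2) b(2)
  proof eventually_elim
    case (elim x)
    then have "m x = Complex (a x) (b x)" by (simp add: complex_eq_iff)
    with C[of x] subsetD[OF assms(3), of x] show ?case by (auto simp: m'_def)
  qed
  show ?thesis
  proof (rule that)
    show "m' \<in> borel_measurable borel" unfolding m'_def by measurable
    show "norm (m' x) \<le> C" for x using C0 by (simp add: m'_def)
    show "{x. m' x \<noteq> 0} \<subseteq> A" by (auto simp: m'_def)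
    show "AE x in lebesgue. m x = m' x" using ae by (rule AE_completion)
  qed
qed

lemma inv_fourier_cong_AE:
  assumes "m \<in> borel_measurable lebesgue" "m' \<in> borel_measurable borel" "AE x in lebesgue. m x = m' x"
    and [measurable]: "u \<in> borel_measurable borel"
  shows "inv_fourier (\<lambda>\<xi>. m \<xi> * u \<xi>) x = (LBINT \<xi>. m' \<xi> * u \<xi> * e2pi (x * \<xi>))"
proof -
  note [measurable] = assms(1,2)
  have [measurable]: "m' \<in> borel_measurable lebesgue" "u \<in> borel_measurable lebesgue" "e2pi \<in> borel_measurable lebesgue"
    "(\<lambda>\<xi>. e2pi (x * \<xi>)) \<in> borel_measurable lebesgue"
    using assms(2,4) by (auto intro!: measurable_completion)
  have "inv_fourier (\<lambda>\<xi>. m \<xi> * u \<xi>) x = (LINT \<xi>|lebesgue. m \<xi> * u \<xi> * e2pi (x * \<xi>))"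
    by (simp add: inv_fourier_def e2pi_def mult.assoc)
  also have "\<dots> = (LINT \<xi>|lebesgue. m' \<xi> * u \<xi> * e2pi (x * \<xi>))"
  proof (rule integral_cong_AE)
    show "AE \<xi> in lebesgue. m \<xi> * u \<xi> * e2pi (x * \<xi>) = m' \<xi> * u \<xi> * e2pi (x * \<xi>)"
      using assms(3) by eventually_elim simp
  qed measurable
  also have "\<dots> = (LBINT \<xi>. m' \<xi> * u \<xi> * e2pi (x * \<xi>))"
    using assms(2) by (intro integral_completion) measurable
  finally show ?thesis .
qed

lemma inv_fourier_borel_representative:
  fixes m :: "real \<Rightarrow> complex"
  assumes m: "m \<in> borel_measurable lebesgue" "bounded (range m)" "{x. m x \<noteq> 0} \<subseteq> {-1/2<..1/2}"
  obtains m' C where "m' \<in> borel_measurable borel" "\<And>x. norm (m' x) \<le> C" "{x. m' x \<noteq> 0} \<subseteq> {-1/2<..1/2}"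
    "AE x in lebesgue. m x = m' x" "\<And>x. inv_fourier m x = (LBINT \<xi>. m' \<xi> * e2pi (x * \<xi>))"
proof -
  obtain m' C where m': "m' \<in> borel_measurable borel" "\<And>x. norm (m' x) \<le> C" "{x. m' x \<noteq> 0} \<subseteq> {-1/2<..1/2}"
    "AE x in lebesgue. m x = m' x"
    using lebesgue_bounded_borel_representative[OF m] by auto
  show ?thesis
    using that[OF m'] inv_fourier_cong_AE[OF m(1) m'(1) m'(4), of "\<lambda>_. 1"] by simp
qed

lemma fourier_eq_lborel:
  assumes [measurable]: "f \<in> borel_measurable borel"
  shows "fourier f \<xi> = (LBINT x. f x * e2pi (- (x * \<xi>)))"
proof -
  have "fourier f \<xi> = (LINT x|lebesgue. f x * e2pi (- (x * \<xi>)))"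
    by (simp add: fourier_def e2pi_def mult_ac)
  also have "\<dots> = (LBINT x. f x * e2pi (- (x * \<xi>)))"
    by (intro integral_completion) measurable
  finally show ?thesis .
qed

section \<open>Band-limited functions: reproduction, sampling, synthesis\<close>

lemma norm_inv_fourier_le:
  fixes m' :: "real \<Rightarrow> complex"
  assumes m': "m' \<in> borel_measurable borel" "\<And>x. norm (m' x) \<le> C" "{x. m' x \<noteq> 0} \<subseteq> {-1/2<..1/2}"
  shows "integrable lborel (\<lambda>\<xi>. m' \<xi> * e2pi (x * \<xi>))"
    and "norm (LBINT \<xi>. m' \<xi> * e2pi (x * \<xi>)) \<le> C"
proof -
  note [measurable] = m'(1)
  show int: "integrable lborel (\<lambda>\<xi>. m' \<xi> * e2pi (x * \<xi>))" for x
    by (rule integrable_bounded_support[where C=C and a="-1/2" and b="1/2"])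
       (use m' in \<open>auto simp: norm_mult\<close>)
  have "norm (LBINT \<xi>. m' \<xi> * e2pi (x * \<xi>)) \<le> (LBINT \<xi>. norm (m' \<xi> * e2pi (x * \<xi>)))"
    by (rule integral_norm_bound)
  also have "\<dots> \<le> (LBINT \<xi>. indicator {-1/2..1/2::real} \<xi> * C)"
  proof (rule Bochner_Integration.integral_mono)
    show "integrable lborel (\<lambda>\<xi>. indicator {-1/2..1/2::real} \<xi> * C)"
      by (intro integrable_mult_left integrable_real_indicator) (auto simp: emeasure_lborel_Icc_eq)
    show "norm (m' \<xi> * e2pi (x * \<xi>)) \<le> indicator {-1/2..1/2} \<xi> * C" for \<xi>
      using m'(2)[of \<xi>] m'(3) by (auto simp: norm_mult indicator_def)
  qed (use int in auto)
  also have "\<dots> = C" by simp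
  finally show "norm (LBINT \<xi>. m' \<xi> * e2pi (x * \<xi>)) \<le> C" .
qed

text \<open>By Fubini, averaging against \<open>trapezoid_ft\<close> at scale \<delta> multiplies
  \<open>m'\<close> by \<open>trapezoid (\<delta> * \<xi>)\<close>. This factor is 1 on the support
  of \<open>m'\<close>, because \<delta> is at most 1 and the plateau of the trapezoid is
  [-1/2,1/2].\<close>

lemma inv_fourier_reproducing:
  fixes m' :: "real \<Rightarrow> complex" and \<delta> :: real
  assumes m': "m' \<in> borel_measurable borel" "\<And>x. norm (m' x) \<le> C" "{x. m' x \<noteq> 0} \<subseteq> {-1/2<..1/2}"
    and \<delta>: "0 < \<delta>" "\<delta> \<le> 1"
  defines "K \<equiv> (\<lambda>x. LBINT \<xi>. m' \<xi> * e2pi (x * \<xi>))"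
  shows "K x = (LBINT s. K (x - \<delta> * s) * trapezoid_ft s)"
proof -
  note [measurable] = m'(1)
  have int: "integrable lborel (\<lambda>\<xi>. norm (m' \<xi>))"
    using integrable_norm[OF norm_inv_fourier_le(1)[OF m', of 0]] by simp
  have int2: "integrable (lborel \<Otimes>\<^sub>M lborel) (\<lambda>(s, \<xi>). m' \<xi> * e2pi ((x - \<delta> * s) * \<xi>) * trapezoid_ft s)"
  proof (rule lborel_pair.Fubini_integrable)
    show "AE s in lborel. integrable lborel (\<lambda>\<xi>. case (s, \<xi>) of (s, \<xi>) \<Rightarrow> m' \<xi> * e2pi ((x - \<delta> * s) * \<xi>) * trapezoid_ft s)"
      using norm_inv_fourier_le(1)[OF m'] by simp
    show "integrable lborel (\<lambda>s. LBINT \<xi>. norm (case (s, \<xi>) of (s, \<xi>) \<Rightarrow> m' \<xi> * e2pi ((x - \<delta> * s) * \<xi>) * trapezoid_ft s))"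
      using integrable_norm[OF integrable_trapezoid_ft] by (simp add: norm_mult)
  qed measurable
  have "(LBINT s. K (x - \<delta> * s) * trapezoid_ft s) =
     (LBINT s. LBINT \<xi>. m' \<xi> * e2pi ((x - \<delta> * s) * \<xi>) * trapezoid_ft s)"
    by (simp only: K_def integral_mult_left_zero)
  also have "\<dots> = (LBINT \<xi>. LBINT s. m' \<xi> * e2pi ((x - \<delta> * s) * \<xi>) * trapezoid_ft s)"
    by (rule lborel_pair.Fubini_integral[symmetric]) (fact int2)
  also have "\<dots> = (LBINT \<xi>. m' \<xi> * e2pi (x * \<xi>) * (LBINT s. trapezoid_ft s * e2pi (- (s * (\<delta> * \<xi>)))))"
  proof (intro Bochner_Integration.integral_cong refl)
    fix \<xi>
    have "(LBINT s. m' \<xi> * e2pi ((x - \<delta> * s) * \<xi>) * trapezoid_ft s) =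
      (LBINT s. m' \<xi> * e2pi (x * \<xi>) * (trapezoid_ft s * e2pi (- (s * (\<delta> * \<xi>)))))"
    proof (intro Bochner_Integration.integral_cong refl)
      fix s
      have "e2pi ((x - \<delta> * s) * \<xi>) = e2pi (x * \<xi>) * e2pi (- (s * (\<delta> * \<xi>)))"
        by (simp add: algebra_simps flip: e2pi_add)
      then show "m' \<xi> * e2pi ((x - \<delta> * s) * \<xi>) * trapezoid_ft s = m' \<xi> * e2pi (x * \<xi>) * (trapezoid_ft s * e2pi (- (s * (\<delta> * \<xi>))))"
        by simp
    qed
    then show "(LBINT s. m' \<xi> * e2pi ((x - \<delta> * s) * \<xi>) * trapezoid_ft s) =
      m' \<xi> * e2pi (x * \<xi>) * (LBINT s. trapezoid_ft s * e2pi (- (s * (\<delta> * \<xi>))))" by simp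
  qed
  also have "\<dots> = (LBINT \<xi>. m' \<xi> * e2pi (x * \<xi>))"
  proof (intro Bochner_Integration.integral_cong refl)
    fix \<xi>
    have "m' \<xi> \<noteq> 0 \<Longrightarrow> \<bar>\<delta> * \<xi>\<bar> \<le> 1 * (1/2)"
      using subsetD[OF m'(3), of \<xi>] \<delta> unfolding abs_mult by (intro mult_mono) auto
    then show "m' \<xi> * e2pi (x * \<xi>) * (LBINT s. trapezoid_ft s * e2pi (- (s * (\<delta> * \<xi>)))) = m' \<xi> * e2pi (x * \<xi>)"
      unfolding fourier_trapezoid_ft by (cases "m' \<xi> = 0") (auto simp: trapezoid_eq_1)
  qed
  finally show ?thesis by (simp add: K_def)
qed

text \<open>A Plancherel--Polya type inequality: the assumption \<open>rep\<close> says that \<open>h\<close> is band limited, so its samples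
  are controlled by averages over unit scale.\<close>

lemma sum_samples_power_le:
  fixes h :: "real \<Rightarrow> complex"
  assumes h[measurable]: "h \<in> borel_measurable borel" and p: "0 < p"
    and int: "integrable lborel (\<lambda>y. norm (h y) ^ p)" and bdd: "\<And>y. norm (h y) \<le> C"
    and rep: "\<And>y. h y = (LBINT s. h (y - s) * trapezoid_ft s)"
    and N: "finite (N :: int set)"
  shows "(\<Sum>n\<in>N. norm (h (of_int n)) ^ p) \<le>
    (LBINT s. norm (trapezoid_ft s)) ^ (p - 1) * (9 * pi) * (LBINT y. norm (h y) ^ p)"
proof -
  define L where "L = (LBINT s. norm (trapezoid_ft s))"
  have L0: "L \<ge> 0" by (simp add: L_def)
  have intb: "integrable lborel (\<lambda>s. norm (trapezoid_ft s) * norm (h (y - s)) ^ k)" for y k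
  proof (rule Bochner_Integration.integrable_bound)
    show "integrable lborel (\<lambda>s. C ^ k * norm (trapezoid_ft s))"
      using integrable_norm[OF integrable_trapezoid_ft] by (intro integrable_mult_right)
    have "norm (h (y - s)) ^ k \<le> \<bar>C ^ k\<bar>" for s
      using power_mono[OF bdd[of "y - s"], of k] by simp
    then show "AE s in lborel. norm (norm (trapezoid_ft s) * norm (h (y - s)) ^ k) \<le> norm (C ^ k * norm (trapezoid_ft s))"
      by (intro always_eventually allI) (simp add: abs_mult mult.commute[of _ "norm (trapezoid_ft _)"] mult_left_mono)
  qed measurable
  have 1: "norm (h y) ^ p \<le> L ^ (p - 1) * (LBINT u. norm (trapezoid_ft (y - u)) * norm (h u) ^ p)" for y
  proof -
    have "norm (h y) \<le> (LBINT s. norm (h (y - s) * trapezoid_ft s))"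
      by (subst rep) (rule integral_norm_bound)
    then have "norm (h y) ^ p \<le> (LBINT s. norm (trapezoid_ft s) * norm (h (y - s))) ^ p"
      by (intro power_mono) (auto simp: norm_mult mult.commute)
    \<comment> \<open>Jensen with weight \<open>norm (trapezoid_ft s)\<close>, whose total mass is
      \<open>L\<close>.\<close>
    also have "\<dots> \<le> L ^ (p - 1) * (LBINT s. norm (trapezoid_ft s) * norm (h (y - s)) ^ p)"
      unfolding L_def using intb[of y 1] intb[of y p] integrable_norm[OF integrable_trapezoid_ft] p
      by (intro weighted_power_integral_le) auto
    also have "(LBINT s. norm (trapezoid_ft s) * norm (h (y - s)) ^ p) = (LBINT u. norm (trapezoid_ft (y - u)) * norm (h u) ^ p)"
      by (subst lborel_integral_real_affine[of "-1" _ y]) auto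
    finally show ?thesis .
  qed
  have int2: "integrable lborel (\<lambda>u. norm (trapezoid_ft (y - u)) * norm (h u) ^ p)" for y
  proof -
    have "integrable lborel (\<lambda>s. norm (trapezoid_ft (y - (y + (-1) * s))) * norm (h (y + (-1) * s)) ^ p)"
      using intb[of y p] by simp
    then show ?thesis
      by (subst (asm) lborel_integrable_real_affine_iff[of "-1" "\<lambda>u. norm (trapezoid_ft (y - u)) * norm (h u) ^ p"]) auto
  qed
  have "(\<Sum>n\<in>N. norm (h (of_int n)) ^ p) \<le> (\<Sum>n\<in>N. L ^ (p - 1) * (LBINT u. norm (trapezoid_ft (of_int n - u)) * norm (h u) ^ p))"
    by (intro sum_mono 1)
  also have "\<dots> = L ^ (p - 1) * (LBINT u. (\<Sum>n\<in>N. norm (trapezoid_ft (of_int n - u)) * norm (h u) ^ p))"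
    using int2 by (simp add: sum_distrib_left)
  also have "(LBINT u. (\<Sum>n\<in>N. norm (trapezoid_ft (of_int n - u)) * norm (h u) ^ p)) \<le> (LBINT u. (9 * pi) * norm (h u) ^ p)"
  proof (rule Bochner_Integration.integral_mono)
    fix u
    \<comment> \<open>After exchanging sum and integral, each \<open>u\<close> is charged by the
      kernel at all integer distances at once, which is a Riemann sum of step 1.\<close>
    have "(\<Sum>n\<in>N. norm (trapezoid_ft (of_int n - u))) = (\<Sum>n\<in>uminus ` N. 1 * norm (trapezoid_ft (- u - 1 * of_int n)))"
      by (subst sum.reindex) (auto simp: inj_on_def)
    also have "\<dots> \<le> 9 * pi" using N by (intro sum_norm_trapezoid_ft_le) auto
    finally show "(\<Sum>n\<in>N. norm (trapezoid_ft (of_int n - u)) * norm (h u) ^ p) \<le> 9 * pi * norm (h u) ^ p"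
      unfolding sum_distrib_right[symmetric] by (intro mult_right_mono) auto
  qed (use int2 int in auto)
  finally show ?thesis
    using L0 by (simp add: L_def mult_left_mono)
qed

text \<open>The converse of sampling: a sequence is synthesized into a function on the line. The
  roles of the two masses are exchanged: Jensen now runs over the sum in k, of mass at most 9 pi,
  and the integral in y contributes one factor of the L^1 norm of
  \<open>trapezoid_ft\<close>.\<close>

lemma integral_superposition_power_le:
  fixes f :: "int \<Rightarrow> complex"
  assumes p: "0 < p" and S: "finite S"
  defines "G \<equiv> (\<lambda>y. \<Sum>k\<in>S. f k * trapezoid_ft (y - of_int k))"
  shows "integrable lborel (\<lambda>y. norm (G y) ^ p)"
    and "(LBINT y. norm (G y) ^ p) \<le>
      (9 * pi) ^ (p - 1) * (LBINT s. norm (trapezoid_ft s)) * (\<Sum>k\<in>S. norm (f k) ^ p)"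
proof -
  have sh: "integrable lborel (\<lambda>y. norm (trapezoid_ft (y - of_int k)))" for k :: int
    using lborel_integrable_real_affine[OF integrable_norm[OF integrable_trapezoid_ft], of 1 "- of_int k"] by simp
  have int1: "integrable lborel (\<lambda>y. (9 * pi) ^ (p - 1) * (\<Sum>k\<in>S. norm (trapezoid_ft (y - of_int k)) * norm (f k) ^ p))"
    by (intro integrable_mult_right Bochner_Integration.integrable_sum integrable_mult_left sh)
  have le: "norm (G y) ^ p \<le> (9 * pi) ^ (p - 1) * (\<Sum>k\<in>S. norm (trapezoid_ft (y - of_int k)) * norm (f k) ^ p)" for y
  proof -
    have "norm (G y) \<le> (\<Sum>k\<in>S. norm (trapezoid_ft (y - of_int k)) * norm (f k))"
      unfolding G_def by (rule order_trans[OF norm_sum]) (simp add: norm_mult mult.commute)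
    then have "norm (G y) ^ p \<le> (\<Sum>k\<in>S. norm (trapezoid_ft (y - of_int k)) * norm (f k)) ^ p"
      by (intro power_mono) auto
    also have "\<dots> \<le> (\<Sum>k\<in>S. norm (trapezoid_ft (y - of_int k))) ^ (p - 1) * (\<Sum>k\<in>S. norm (trapezoid_ft (y - of_int k)) * norm (f k) ^ p)"
      using S p by (intro weighted_power_sum_le) auto
    also have "\<dots> \<le> (9 * pi) ^ (p - 1) * (\<Sum>k\<in>S. norm (trapezoid_ft (y - of_int k)) * norm (f k) ^ p)"
      using sum_norm_trapezoid_ft_le[OF S, of 1 y] by (intro mult_right_mono power_mono sum_nonneg) auto
    finally show ?thesis .
  qed
  show int: "integrable lborel (\<lambda>y. norm (G y) ^ p)"
  proof (rule Bochner_Integration.integrable_bound[OF int1])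
    show "AE y in lborel. norm (norm (G y) ^ p) \<le> norm ((9 * pi) ^ (p - 1) * (\<Sum>k\<in>S. norm (trapezoid_ft (y - of_int k)) * norm (f k) ^ p))"
      using le by (auto simp: abs_of_nonneg sum_nonneg)
  qed (simp add: G_def)
  have "(LBINT y. norm (G y) ^ p) \<le> (LBINT y. (9 * pi) ^ (p - 1) * (\<Sum>k\<in>S. norm (trapezoid_ft (y - of_int k)) * norm (f k) ^ p))"
    by (intro Bochner_Integration.integral_mono int int1 le)
  also have "\<dots> = (9 * pi) ^ (p - 1) * (\<Sum>k\<in>S. (LBINT y. norm (trapezoid_ft (y - of_int k))) * norm (f k) ^ p)"
    using sh by simp
  also have "\<dots> = (9 * pi) ^ (p - 1) * (\<Sum>k\<in>S. (LBINT s. norm (trapezoid_ft s)) * norm (f k) ^ p)"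
  proof -
    have "(LBINT y. norm (trapezoid_ft (y - of_int k))) = (LBINT s. norm (trapezoid_ft s))" for k :: int
      by (subst (2) lborel_integral_real_affine[of 1 _ "- of_int k"]) auto
    then show ?thesis by simp
  qed
  finally show "(LBINT y. norm (G y) ^ p) \<le>
      (9 * pi) ^ (p - 1) * (LBINT s. norm (trapezoid_ft s)) * (\<Sum>k\<in>S. norm (f k) ^ p)"
    by (simp add: sum_distrib_left mult.assoc)
qed

text \<open>Sampling contributes \<open>L ^ (p - 1) * (9 * pi)\<close>, synthesis
  \<open>(9 * pi) ^ (p - 1) * L\<close>, and the multiplier \<open>\<bar>B\<bar> ^ p\<close>, where
  \<open>L\<close> is the L^1 norm of \<open>trapezoid_ft\<close>; this is their product.\<close>

definition transference_const :: "nat \<Rightarrow> real \<Rightarrow> real" where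
  "transference_const p B = ((LBINT s. norm (trapezoid_ft s)) * (9 * pi) * \<bar>B\<bar>) ^ p"

text \<open>The sequence \<open>f\<close> is synthesized into \<open>G\<close>. Dilated by \<delta>,
  its transform is an exponential sum times \<open>trapezoid (\<delta> * \<xi>)\<close>, and the
  latter is 1 on the support of \<open>m\<close>. Hence the operator on the line sends the dilate of
  \<open>G\<close> to the dilate of \<open>h\<close>, and the values of \<open>h\<close> at the
  integers are the discrete convolution in question.\<close>

lemma multiplier_transference:
  fixes f :: "int \<Rightarrow> complex" and m :: "real \<Rightarrow> complex" and \<delta> :: real
  assumes m: "Lp_multiplier (real p) B m" "{x. m x \<noteq> 0} \<subseteq> {-1/2<..1/2}"
    and p: "0 < p" and \<delta>: "0 < \<delta>" "\<delta> \<le> 1" and S: "finite S" and N: "finite N"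
  shows "(\<Sum>n\<in>N. norm (\<Sum>k\<in>S. f k * multiplier_kernel m \<delta> (n - k)) ^ p)
    \<le> transference_const p B * (\<Sum>k\<in>S. norm (f k) ^ p)"
proof -
  obtain T where T: "bounded_Lp_extension lebesgue (real p) B fourier_integrable
            (\<lambda>f. inv_fourier (\<lambda>\<xi>. m \<xi> * fourier f \<xi>)) T"
    and mm: "m \<in> borel_measurable lebesgue" "bounded (range m)"
    using m(1) unfolding Lp_multiplier_def by blast
  obtain m' C where m': "m' \<in> borel_measurable borel" "\<And>x. norm (m' x) \<le> C" "{x. m' x \<noteq> 0} \<subseteq> {-1/2<..1/2}"
    and ae: "AE x in lebesgue. m x = m' x" and Km: "\<And>x. inv_fourier m x = (LBINT \<xi>. m' \<xi> * e2pi (x * \<xi>))"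
    by (rule inv_fourier_borel_representative[OF mm m(2)]) blast
  note [measurable] = m'(1)
  define K where "K = (\<lambda>x. LBINT \<xi>. m' \<xi> * e2pi (x * \<xi>))"
  have K: "inv_fourier m x = K x" for x by (simp add: Km K_def)
  have Kb: "norm (K x) \<le> C" for x unfolding K_def by (rule norm_inv_fourier_le(2)[OF m'])
  have [measurable]: "K \<in> borel_measurable borel"
    unfolding K_def using norm_inv_fourier_le(1)[OF m', of 0]
    by (intro borel_measurable_continuous_onI continuous_on_ft) simp
  define L where "L = (LBINT s. norm (trapezoid_ft s))"
  define G where "G = (\<lambda>y. \<Sum>k\<in>S. f k * trapezoid_ft (y - of_int k))"
  \<comment> \<open>The form \<open>0 + c * x\<close> matches the affine substitution rules for
    \<open>lborel\<close>.\<close>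
  define g where "g = (\<lambda>x. G (0 + (1 / \<delta>) * x))"
  define h where "h = (\<lambda>y. \<Sum>k\<in>S. f k * (of_real \<delta> * K (\<delta> * (y - of_int k))))"
  define H where "H = (\<lambda>x. h (0 + (1 / \<delta>) * x))"
  have [measurable]: "G \<in> borel_measurable borel" "h \<in> borel_measurable borel" unfolding G_def h_def by measurable
  have [measurable]: "g \<in> borel_measurable borel" "H \<in> borel_measurable borel" unfolding g_def H_def by measurable
  have Gint: "integrable lborel G"
  proof -
    have "integrable lborel (\<lambda>y. trapezoid_ft (- of_int k + 1 * y))" for k :: int
      by (rule lborel_integrable_real_affine[OF integrable_trapezoid_ft]) simp
    then show ?thesis unfolding G_def by auto
  qed
  have gint: "integrable lborel g" unfolding g_def
    using \<delta> by (intro lborel_integrable_real_affine[OF Gint]) auto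
  have gft: "fourier g \<xi> = (\<Sum>k\<in>S. f k * (of_real \<delta> * of_real (trapezoid (\<delta> * \<xi>)) * e2pi (- (\<delta> * of_int k * \<xi>))))" for \<xi>
  proof -
    have "fourier g \<xi> = (LBINT x. g x * e2pi (- (x * \<xi>)))"
      by (rule fourier_eq_lborel) measurable
    also have "\<dots> = (LBINT x. (\<Sum>k\<in>S. f k * (trapezoid_ft (x / \<delta> - of_int k) * e2pi (- (x * \<xi>)))))"
      by (simp add: g_def G_def sum_distrib_right mult.assoc)
    also have "\<dots> = (\<Sum>k\<in>S. LBINT x. f k * (trapezoid_ft (x / \<delta> - of_int k) * e2pi (- (x * \<xi>))))"
    proof (rule Bochner_Integration.integral_sum)
      fix k
      have "integrable lborel (\<lambda>x. trapezoid_ft (- of_int k + (1 / \<delta>) * x))"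
        using \<delta> by (intro lborel_integrable_real_affine[OF integrable_trapezoid_ft]) auto
      then have "integrable lborel (\<lambda>x. trapezoid_ft (x / \<delta> - of_int k) * e2pi (- (x * \<xi>)))"
        by (rule Bochner_Integration.integrable_bound) (auto simp: norm_mult)
      then show "integrable lborel (\<lambda>x. f k * (trapezoid_ft (x / \<delta> - of_int k) * e2pi (- (x * \<xi>))))"
        by simp
    qed
    also have "\<dots> = (\<Sum>k\<in>S. f k * (of_real \<delta> * of_real (trapezoid (\<delta> * \<xi>)) * e2pi (- (\<delta> * of_int k * \<xi>))))"
    proof (intro sum.cong refl)
      fix k
      have "(LBINT x. trapezoid_ft (x / \<delta> - of_int k) * e2pi (- (x * \<xi>))) =
         \<bar>\<delta>\<bar> *\<^sub>R (LBINT t. trapezoid_ft ((\<delta> * of_int k + \<delta> * t) / \<delta> - of_int k) * e2pi (- ((\<delta> * of_int k + \<delta> * t) * \<xi>)))"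
        using \<delta> by (intro lborel_integral_real_affine) auto
      also have "(\<lambda>t. trapezoid_ft ((\<delta> * of_int k + \<delta> * t) / \<delta> - of_int k) * e2pi (- ((\<delta> * of_int k + \<delta> * t) * \<xi>))) =
         (\<lambda>t. trapezoid_ft t * e2pi (- (t * (\<delta> * \<xi>))) * e2pi (- (\<delta> * of_int k * \<xi>)))"
      proof
        fix t
        have "e2pi (- ((\<delta> * of_int k + \<delta> * t) * \<xi>)) = e2pi (- (t * (\<delta> * \<xi>))) * e2pi (- (\<delta> * of_int k * \<xi>))"
          by (simp add: algebra_simps flip: e2pi_add)
        moreover have "(\<delta> * of_int k + \<delta> * t) / \<delta> - of_int k = t" using \<delta> by (simp add: add_divide_distrib)
        ultimately show "trapezoid_ft ((\<delta> * of_int k + \<delta> * t) / \<delta> - of_int k) * e2pi (- ((\<delta> * of_int k + \<delta> * t) * \<xi>)) =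
          trapezoid_ft t * e2pi (- (t * (\<delta> * \<xi>))) * e2pi (- (\<delta> * of_int k * \<xi>))" by simp
      qed
      finally show "(LBINT x. f k * (trapezoid_ft (x / \<delta> - of_int k) * e2pi (- (x * \<xi>)))) =
        f k * (of_real \<delta> * of_real (trapezoid (\<delta> * \<xi>)) * e2pi (- (\<delta> * of_int k * \<xi>)))"
        using \<delta> by (simp add: fourier_trapezoid_ft scaleR_conv_of_real)
    qed
    finally show ?thesis .
  qed
  have gftm[measurable]: "fourier g \<in> borel_measurable borel" unfolding gft[abs_def] by measurable
  have gftint: "integrable lborel (fourier g)"
    unfolding gft[abs_def]
  proof (intro Bochner_Integration.integrable_sum integrable_mult_right)
    fix k
    show "integrable lborel (\<lambda>\<xi>. of_real \<delta> * of_real (trapezoid (\<delta> * \<xi>)) * e2pi (- (\<delta> * of_int k * \<xi>)))"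
    proof (rule integrable_bounded_support[where C=\<delta> and a="-1/\<delta>" and b="1/\<delta>"])
      fix \<xi> assume "\<xi> \<notin> {-1/\<delta>..1/\<delta>}"
      then have "1 / \<delta> \<le> \<bar>\<xi>\<bar>" by auto
      then have "1 \<le> \<bar>\<delta> * \<xi>\<bar>" using \<delta> by (simp add: abs_mult field_simps)
      then show "of_real \<delta> * of_real (trapezoid (\<delta> * \<xi>)) * e2pi (- (\<delta> * of_int k * \<xi>)) = 0"
        by (simp add: trapezoid_eq_0)
    qed (use \<delta> in \<open>auto simp: norm_mult trapezoid_bounds abs_of_nonneg mult_left_le\<close>)
  qed
  \<comment> \<open>Puts \<open>g\<close> into the class on which the multiplier operator is given
    by the explicit formula.\<close>
  have gFI: "g \<in> fourier_integrable"
    using gint gftint by (auto simp: fourier_integrable_def integrable_completion)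
  have GLp: "integrable lborel (\<lambda>y. norm (G y) ^ p)"
    and Gle: "(LBINT y. norm (G y) ^ p) \<le> (9 * pi) ^ (p - 1) * L * (\<Sum>k\<in>S. norm (f k) ^ p)"
    using integral_superposition_power_le[OF p S, of f] by (simp_all add: G_def L_def)
  have gLp: "g \<in> Lp_space lebesgue (real p)"
  proof -
    have "integrable lborel (\<lambda>x. norm (g x) ^ p)"
      unfolding g_def using \<delta> by (intro lborel_integrable_real_affine[OF GLp]) auto
    then show ?thesis using p by (auto simp: Lp_space_nat_iff integrable_completion intro!: measurable_completion)
  qed
  have Tg: "inv_fourier (\<lambda>\<xi>. m \<xi> * fourier g \<xi>) x = H x" for x
  proof -
    have "inv_fourier (\<lambda>\<xi>. m \<xi> * fourier g \<xi>) x = (LBINT \<xi>. m' \<xi> * fourier g \<xi> * e2pi (x * \<xi>))"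
      by (rule inv_fourier_cong_AE[OF mm(1) m'(1) ae gftm])
    also have "\<dots> = (LBINT \<xi>. (\<Sum>k\<in>S. f k * (of_real \<delta> * (m' \<xi> * e2pi ((\<delta> * (x / \<delta> - of_int k)) * \<xi>)))))"
    proof (intro Bochner_Integration.integral_cong refl)
      fix \<xi>
      show "m' \<xi> * fourier g \<xi> * e2pi (x * \<xi>) = (\<Sum>k\<in>S. f k * (of_real \<delta> * (m' \<xi> * e2pi ((\<delta> * (x / \<delta> - of_int k)) * \<xi>))))"
      proof (cases "m' \<xi> = 0")
        case False
        then have "\<bar>\<delta> * \<xi>\<bar> \<le> 1 * (1/2)"
          using subsetD[OF m'(3), of \<xi>] \<delta> unfolding abs_mult by (intro mult_mono) auto
        then have t: "trapezoid (\<delta> * \<xi>) = 1" by (simp add: trapezoid_eq_1)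
        have e: "e2pi ((\<delta> * (x / \<delta> - of_int k)) * \<xi>) = e2pi (- (\<delta> * of_int k * \<xi>)) * e2pi (x * \<xi>)" for k
          using \<delta> by (simp add: algebra_simps flip: e2pi_add)
        show ?thesis unfolding gft t e sum_distrib_left sum_distrib_right by (simp add: mult_ac)
      qed simp
    qed
    also have "\<dots> = H x"
      unfolding H_def h_def K_def using norm_inv_fourier_le(1)[OF m'] by simp
    finally show ?thesis .
  qed
  have HLp: "integrable lebesgue (\<lambda>x. norm (H x) ^ p)"
    and Hle: "(LINT x|lebesgue. norm (H x) ^ p) \<le> \<bar>B\<bar> ^ p * (LINT x|lebesgue. norm (g x) ^ p)"
  proof -
    have "H \<in> borel_measurable lebesgue" by (intro measurable_completion) simp
    then show "integrable lebesgue (\<lambda>x. norm (H x) ^ p)"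
      "(LINT x|lebesgue. norm (H x) ^ p) \<le> \<bar>B\<bar> ^ p * (LINT x|lebesgue. norm (g x) ^ p)"
      using bounded_Lp_extension_power_le[OF T p gFI gLp, of H] Tg by auto
  qed
  have HLp': "integrable lborel (\<lambda>x. norm (H x) ^ p)" using HLp by (simp add: integrable_completion)
  have hLp: "integrable lborel (\<lambda>y. norm (h y) ^ p)"
    using lborel_integrable_real_affine[OF HLp', of \<delta> 0] \<delta> by (simp add: H_def)
  \<comment> \<open>Undoing the dilation produces the factor \<delta> on both sides.\<close>
  have hle: "(LBINT y. norm (h y) ^ p) \<le> \<bar>B\<bar> ^ p * (LBINT y. norm (G y) ^ p)"
  proof -
    have 1: "(LBINT x. norm (g x) ^ p) = \<delta> * (LBINT y. norm (G y) ^ p)"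
      using \<delta> by (subst lborel_integral_real_affine[of \<delta> _ 0]) (auto simp: g_def)
    have 2: "(LBINT x. norm (H x) ^ p) = \<delta> * (LBINT y. norm (h y) ^ p)"
      using \<delta> by (subst lborel_integral_real_affine[of \<delta> _ 0]) (auto simp: H_def)
    have "\<delta> * (LBINT y. norm (h y) ^ p) \<le> \<delta> * (\<bar>B\<bar> ^ p * (LBINT y. norm (G y) ^ p))"
      using Hle 1 2 by (simp add: integral_completion mult_ac)
    then show ?thesis using \<delta> by simp
  qed
  have rep: "h y = (LBINT s. h (y - s) * trapezoid_ft s)" for y
  proof -
    have Kint: "integrable lborel (\<lambda>s. K (\<delta> * (y - s - of_int k)) * trapezoid_ft s)" for k
    proof (rule Bochner_Integration.integrable_bound)
      show "integrable lborel (\<lambda>s. of_real C * trapezoid_ft s)" using integrable_trapezoid_ft by simp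
      show "AE s in lborel. norm (K (\<delta> * (y - s - of_int k)) * trapezoid_ft s) \<le> norm (of_real C * trapezoid_ft s)"
        using order_trans[OF Kb abs_ge_self] by (auto simp: norm_mult intro!: mult_right_mono)
    qed measurable
    have "(LBINT s. h (y - s) * trapezoid_ft s) =
      (LBINT s. (\<Sum>k\<in>S. (f k * of_real \<delta>) * (K (\<delta> * (y - s - of_int k)) * trapezoid_ft s)))"
      by (simp only: h_def sum_distrib_right mult.assoc)
    also have "\<dots> = (\<Sum>k\<in>S. (f k * of_real \<delta>) * (LBINT s. K (\<delta> * (y - s - of_int k)) * trapezoid_ft s))"
      using Kint by simp
    also have "\<dots> = (\<Sum>k\<in>S. (f k * of_real \<delta>) * K (\<delta> * (y - of_int k)))"
    proof (intro sum.cong refl arg_cong2[where f="(*)"])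
      fix k
      have "K (\<delta> * (y - of_int k)) = (LBINT s. K (\<delta> * (y - of_int k) - \<delta> * s) * trapezoid_ft s)"
        unfolding K_def by (rule inv_fourier_reproducing[OF m' \<delta>])
      also have "(\<lambda>s. K (\<delta> * (y - of_int k) - \<delta> * s)) = (\<lambda>s. K (\<delta> * (y - s - of_int k)))"
        by (simp add: algebra_simps)
      finally show "(LBINT s. K (\<delta> * (y - s - of_int k)) * trapezoid_ft s) = K (\<delta> * (y - of_int k))" by simp
    qed
    finally show ?thesis by (simp add: h_def mult.assoc)
  qed
  have hb: "norm (h y) \<le> (\<Sum>k\<in>S. norm (f k) * (\<delta> * C))" for y
    unfolding h_def using \<delta> Kb
    by (intro order_trans[OF norm_sum] sum_mono) (auto simp: norm_mult intro!: mult_left_mono)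
  have L0: "L \<ge> 0" by (simp add: L_def)
  have "(\<Sum>n\<in>N. norm (h (of_int n)) ^ p) \<le> L ^ (p - 1) * (9 * pi) * (LBINT y. norm (h y) ^ p)"
    unfolding L_def by (rule sum_samples_power_le[OF _ p hLp hb rep N]) measurable
  also have "\<dots> \<le> L ^ (p - 1) * (9 * pi) * (\<bar>B\<bar> ^ p * ((9 * pi) ^ (p - 1) * L * (\<Sum>k\<in>S. norm (f k) ^ p)))"
    using L0 by (intro mult_left_mono order_trans[OF hle] Gle) auto
  also have "\<dots> = transference_const p B * (\<Sum>k\<in>S. norm (f k) ^ p)"
    using p by (cases p) (auto simp: transference_const_def L_def power_mult_distrib)
  finally show ?thesis by (simp add: h_def K)
qed

section \<open>Fourier series and Poisson summation\<close>

lemma integral_e2pi_of_int: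
  fixes n :: int and a :: real
  shows "integrable lborel (\<lambda>\<xi>. indicator {a..a+1} \<xi> *\<^sub>R e2pi (of_int n * \<xi>))"
    and "(LBINT \<xi>. indicator {a..a+1} \<xi> *\<^sub>R e2pi (of_int n * \<xi>)) = (if n = 0 then 1 else 0)"
proof -
  define c where "c = 2 * pi * \<i> * of_int n"
  have e: "e2pi (of_int n * \<xi>) = exp (of_real \<xi> * c)" for \<xi>
    by (simp add: e2pi_def cis_conv_exp c_def mult_ac)
  have cont: "continuous_on A (\<lambda>\<xi>. exp (of_real \<xi> * c))" for A :: "real set"
    by (intro continuous_intros)
  show "integrable lborel (\<lambda>\<xi>. indicator {a..a+1} \<xi> *\<^sub>R e2pi (of_int n * \<xi>))"
    unfolding e using borel_integrable_compact[OF _ cont, of "{a..a+1}"] by simp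
  show "(LBINT \<xi>. indicator {a..a+1} \<xi> *\<^sub>R e2pi (of_int n * \<xi>)) = (if n = 0 then 1 else 0)"
  proof (cases "n = 0")
    case False
    then have c: "c \<noteq> 0" by (simp add: c_def)
    have d: "((\<lambda>\<xi>. exp (of_real \<xi> * c) / c) has_vector_derivative exp (of_real \<xi> * c)) (at \<xi> within A)" for \<xi> A
    proof -
      have "((\<lambda>z. exp (z * c) / c) has_field_derivative exp (of_real \<xi> * c)) (at (of_real \<xi>))"
        by (rule derivative_eq_intros refl c | simp add: c)+
      from has_vector_derivative_real_field[OF this] show ?thesis .
    qed
    have "e2pi (of_int n * (a + 1)) = e2pi (of_int n * a)"
      by (simp add: distrib_left e2pi_add)
    then have "exp (of_real (a + 1) * c) = exp (of_real a * c)" by (simp only: e)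
    then show ?thesis
      using False has_bochner_integral_integral_eq[OF has_bochner_integral_FTC_Icc[OF _ d cont, of a "a + 1"]]
      by (simp add: e)
  qed (simp add: emeasure_lborel_Icc_eq)
qed

lemma integral_trig_poly_square:
  fixes S :: "int set" and f :: "int \<Rightarrow> complex"
  assumes "finite S"
  shows "(LBINT \<xi>. indicator {a..a+1} \<xi> * (norm (\<Sum>k\<in>S. f k * e2pi (- (of_int k * \<xi>))))\<^sup>2) = (\<Sum>k\<in>S. (norm (f k))\<^sup>2)"
proof -
  have eq: "of_real (indicator {a..a+1} \<xi> * (norm (\<Sum>k\<in>S. f k * e2pi (- (of_int k * \<xi>))))\<^sup>2) =
     (\<Sum>k\<in>S. \<Sum>l\<in>S. (f k * cnj (f l)) * (indicator {a..a+1} \<xi> *\<^sub>R e2pi (of_int (l - k) * \<xi>)))" for \<xi>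
  proof -
    have "complex_of_real ((norm (\<Sum>k\<in>S. f k * e2pi (- (of_int k * \<xi>))))\<^sup>2) =
      (\<Sum>k\<in>S. \<Sum>l\<in>S. (f k * e2pi (- (of_int k * \<xi>))) * cnj (f l * e2pi (- (of_int l * \<xi>))))"
      by (simp only: complex_norm_square cnj_sum sum_product)
    also have "\<dots> = (\<Sum>k\<in>S. \<Sum>l\<in>S. (f k * cnj (f l)) * e2pi (of_int (l - k) * \<xi>))"
    proof (intro sum.cong refl)
      fix k l
      have "e2pi (of_int (l - k) * \<xi>) = e2pi (- (of_int k * \<xi>)) * e2pi (of_int l * \<xi>)"
        by (simp add: left_diff_distrib flip: e2pi_add)
      then show "(f k * e2pi (- (of_int k * \<xi>))) * cnj (f l * e2pi (- (of_int l * \<xi>))) = (f k * cnj (f l)) * e2pi (of_int (l - k) * \<xi>)"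
        by (simp add: cnj_e2pi mult_ac)
    qed
    finally show ?thesis
      by (simp add: scaleR_conv_of_real sum_distrib_left mult_ac)
  qed
  have "complex_of_real (LBINT \<xi>. indicator {a..a+1} \<xi> * (norm (\<Sum>k\<in>S. f k * e2pi (- (of_int k * \<xi>))))\<^sup>2) =
    (LBINT \<xi>. (\<Sum>k\<in>S. \<Sum>l\<in>S. (f k * cnj (f l)) * (indicator {a..a+1} \<xi> *\<^sub>R e2pi (of_int (l - k) * \<xi>))))"
    by (simp only: integral_complex_of_real[symmetric] eq)
  also have "\<dots> = (\<Sum>k\<in>S. (LBINT \<xi>. (\<Sum>l\<in>S. (f k * cnj (f l)) * (indicator {a..a+1} \<xi> *\<^sub>R e2pi (of_int (l - k) * \<xi>)))))"
    by (intro Bochner_Integration.integral_sum Bochner_Integration.integrable_sum integrable_mult_right integral_e2pi_of_int(1))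
  also have "\<dots> = (\<Sum>k\<in>S. \<Sum>l\<in>S. (LBINT \<xi>. (f k * cnj (f l)) * (indicator {a..a+1} \<xi> *\<^sub>R e2pi (of_int (l - k) * \<xi>))))"
    by (intro sum.cong refl Bochner_Integration.integral_sum integrable_mult_right integral_e2pi_of_int(1))
  also have "\<dots> = (\<Sum>k\<in>S. \<Sum>l\<in>S. (f k * cnj (f l)) * (LBINT \<xi>. indicator {a..a+1} \<xi> *\<^sub>R e2pi (of_int (l - k) * \<xi>)))"
    by (simp only: integral_mult_right_zero)
  also have "\<dots> = (\<Sum>k\<in>S. \<Sum>l\<in>S. if l = k then f k * cnj (f l) else 0)"
    unfolding integral_e2pi_of_int(2) by (intro sum.cong refl) auto
  also have "\<dots> = (\<Sum>k\<in>S. f k * cnj (f k))"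
    using assms by (simp add: sum.delta)
  also have "\<dots> = complex_of_real (\<Sum>k\<in>S. (norm (f k))\<^sup>2)"
    by (simp only: of_real_sum complex_norm_square)
  finally show ?thesis by (simp only: of_real_eq_iff)
qed

lemma bessel_inequality:
  fixes g :: "real \<Rightarrow> complex" and N :: "int set"
  assumes g[measurable]: "g \<in> borel_measurable borel" and b: "\<And>x. norm (g x) \<le> C"
    and supp: "\<And>x. x \<notin> {a..a+1} \<Longrightarrow> g x = 0" and N: "finite N"
  shows "(\<Sum>n\<in>N. (norm (LBINT \<xi>. g \<xi> * e2pi (of_int n * \<xi>)))\<^sup>2) \<le> (LBINT \<xi>. (norm (g \<xi>))\<^sup>2)"
proof -
  define c where "c n = (LBINT \<xi>. g \<xi> * e2pi (of_int n * \<xi>))" for n :: int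
  define P where "P \<xi> = (\<Sum>n\<in>N. c n * e2pi (- (of_int n * \<xi>)))" for \<xi>
  have C: "C \<ge> 0" using b[of 0] norm_ge_zero order_trans by blast
  have [measurable]: "P \<in> borel_measurable borel" unfolding P_def by measurable
  have Pb: "norm (P \<xi>) \<le> (\<Sum>n\<in>N. norm (c n))" for \<xi>
    unfolding P_def by (rule order_trans[OF norm_sum]) (simp add: norm_mult)
  have ig: "integrable lborel (\<lambda>\<xi>. g \<xi> * e2pi (of_int n * \<xi>))" for n :: int
    by (rule integrable_bounded_support[where C=C and a=a and b="a+1"])
      (use b supp in \<open>auto simp: norm_mult\<close>)
  have ig2: "integrable lborel (\<lambda>\<xi>. (norm (g \<xi>))\<^sup>2)"
    by (rule integrable_bounded_support[where C="C\<^sup>2" and a=a and b="a+1"])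
      (use b supp in \<open>auto intro!: power_mono\<close>)
  have igP: "integrable lborel (\<lambda>\<xi>. Re (g \<xi> * cnj (P \<xi>)))"
  proof (rule integrable_bounded_support[where C="C * (\<Sum>n\<in>N. norm (c n))" and a=a and b="a+1"])
    fix \<xi>
    have "\<bar>Re (g \<xi> * cnj (P \<xi>))\<bar> \<le> norm (g \<xi> * cnj (P \<xi>))" by (rule abs_Re_le_cmod)
    also have "\<dots> \<le> C * (\<Sum>n\<in>N. norm (c n))"
      unfolding norm_mult using C by (intro mult_mono b) (auto simp: Pb)
    finally show "norm (Re (g \<xi> * cnj (P \<xi>))) \<le> C * (\<Sum>n\<in>N. norm (c n))" by simp
  qed (use supp in auto)
  have iP2: "integrable lborel (\<lambda>\<xi>. indicator {a..a+1} \<xi> * (norm (P \<xi>))\<^sup>2)"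
    by (rule integrable_bounded_support[where C="(\<Sum>n\<in>N. norm (c n))\<^sup>2" and a=a and b="a+1"])
      (use Pb in \<open>auto simp: indicator_def intro!: power_mono\<close>)
  have 1: "(LBINT \<xi>. Re (g \<xi> * cnj (P \<xi>))) = (\<Sum>n\<in>N. (norm (c n))\<^sup>2)"
  proof -
    have eq: "g \<xi> * cnj (P \<xi>) = (\<Sum>n\<in>N. cnj (c n) * (g \<xi> * e2pi (of_int n * \<xi>)))" for \<xi>
      by (simp add: P_def sum_distrib_left cnj_e2pi mult_ac)
    have "(LBINT \<xi>. Re (g \<xi> * cnj (P \<xi>))) = Re (LBINT \<xi>. (\<Sum>n\<in>N. cnj (c n) * (g \<xi> * e2pi (of_int n * \<xi>))))"
      unfolding eq by (intro integral_Re Bochner_Integration.integrable_sum integrable_mult_right ig)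
    also have "\<dots> = Re (\<Sum>n\<in>N. cnj (c n) * c n)"
      using ig by (simp add: c_def)
    also have "\<dots> = (\<Sum>n\<in>N. (norm (c n))\<^sup>2)"
      by (simp add: cmod_power2 power2_eq_square[symmetric])
    finally show ?thesis .
  qed
  have 2: "(LBINT \<xi>. indicator {a..a+1} \<xi> * (norm (P \<xi>))\<^sup>2) = (\<Sum>n\<in>N. (norm (c n))\<^sup>2)"
    unfolding P_def by (rule integral_trig_poly_square[OF N])
  \<comment> \<open>The integrand is the squared modulus of \<open>g\<close> minus \<open>P\<close>
    restricted to one period.\<close>
  have "0 \<le> (LBINT \<xi>. (norm (g \<xi>))\<^sup>2 - 2 * Re (g \<xi> * cnj (P \<xi>)) + indicator {a..a+1} \<xi> * (norm (P \<xi>))\<^sup>2)"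
  proof (rule Bochner_Integration.integral_nonneg)
    fix \<xi>
    have "(norm (g \<xi> - P \<xi>))\<^sup>2 = (norm (g \<xi>))\<^sup>2 - 2 * Re (g \<xi> * cnj (P \<xi>)) + (norm (P \<xi>))\<^sup>2"
      unfolding cmod_power2 by (simp add: power2_eq_square algebra_simps)
    then show "0 \<le> (norm (g \<xi>))\<^sup>2 - 2 * Re (g \<xi> * cnj (P \<xi>)) + indicator {a..a+1} \<xi> * (norm (P \<xi>))\<^sup>2"
      using supp[of \<xi>] zero_le_power2[of "norm (g \<xi> - P \<xi>)"] by (cases "\<xi> \<in> {a..a+1}") auto
  qed
  also have "\<dots> = (LBINT \<xi>. (norm (g \<xi>))\<^sup>2) - 2 * (\<Sum>n\<in>N. (norm (c n))\<^sup>2) + (\<Sum>n\<in>N. (norm (c n))\<^sup>2)"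
  proof -
    define R where "R \<xi> = Re (g \<xi> * cnj (P \<xi>))" for \<xi>
    have "integrable lborel R" "(LBINT \<xi>. R \<xi>) = (\<Sum>n\<in>N. (norm (c n))\<^sup>2)"
      using igP 1 by (simp_all only: R_def[abs_def])
    then show ?thesis unfolding R_def[symmetric] using ig2 iP2 by (simp add: 2)
  qed
  finally show ?thesis by (simp add: c_def)
qed

text \<open>Bessel's inequality makes the coefficients square summable along any injective sequence
  of frequencies, so they tend to zero.\<close>

lemma riemann_lebesgue:
  fixes g :: "real \<Rightarrow> complex" and k :: "nat \<Rightarrow> int"
  assumes g: "g \<in> borel_measurable borel" "\<And>x. norm (g x) \<le> C" "\<And>x. x \<notin> {a..a+1} \<Longrightarrow> g x = 0"
    and k: "inj k"
  shows "(\<lambda>N. LBINT \<xi>. g \<xi> * e2pi (of_int (k N) * \<xi>)) \<longlonglongrightarrow> 0"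
proof -
  define c where "c n = (LBINT \<xi>. g \<xi> * e2pi (of_int n * \<xi>))" for n :: int
  have "summable (\<lambda>N. (norm (c (k N)))\<^sup>2)"
  proof (rule summableI_nonneg_bounded)
    fix n
    have "(\<Sum>i<n. (norm (c (k i)))\<^sup>2) = (\<Sum>j\<in>k ` {..<n}. (norm (c j))\<^sup>2)"
      using k by (subst sum.reindex) (auto intro: inj_on_subset)
    also have "\<dots> \<le> (LBINT \<xi>. (norm (g \<xi>))\<^sup>2)"
      unfolding c_def by (rule bessel_inequality[OF g]) auto
    finally show "(\<Sum>i<n. (norm (c (k i)))\<^sup>2) \<le> (LBINT \<xi>. (norm (g \<xi>))\<^sup>2)" .
  qed auto
  then have "(\<lambda>N. (norm (c (k N)))\<^sup>2) \<longlonglongrightarrow> 0" by (rule summable_LIMSEQ_zero)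
  then have "(\<lambda>N. sqrt ((norm (c (k N)))\<^sup>2)) \<longlonglongrightarrow> sqrt 0" by (intro tendsto_intros)
  then show ?thesis by (simp add: c_def tendsto_norm_zero_iff)
qed

lemma sum_telescope_int:
  fixes d :: "int \<Rightarrow> 'a::ab_group_add"
  shows "(\<Sum>k\<in>{- int N..int N}. d (k + 1) - d k) = d (int N + 1) - d (- int N)"
proof (induction N)
  case (Suc N)
  have "{- int (Suc N)..int (Suc N)} = insert (- 1 - int N) (insert (int N + 1) {- int N..int N})" by auto
  then show ?case using Suc by (simp add: algebra_simps)
qed simp

text \<open>Dini's criterion: dividing \<open>h\<close> by \<open>e2pi (\<xi> - \<eta>) - 1\<close> makes the Fourier partial sums telescope.\<close>

lemma dini_fourier_sum:
  fixes h :: "real \<Rightarrow> complex"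
  assumes h[measurable]: "h \<in> borel_measurable borel" and supp: "\<And>x. x \<notin> {a..a+1} \<Longrightarrow> h x = 0"
    and le: "\<And>\<xi>. norm (h \<xi>) \<le> C * norm (e2pi (\<xi> - \<eta>) - 1)" and C: "0 \<le> C"
  shows "(\<lambda>N. \<Sum>k\<in>{- int N..int N}. e2pi (- (of_int k * \<eta>)) * (LBINT \<xi>. h \<xi> * e2pi (of_int k * \<xi>))) \<longlonglongrightarrow> 0"
proof -
  define g where "g \<xi> = h \<xi> / (e2pi (\<xi> - \<eta>) - 1)" for \<xi>
  have gm[measurable]: "g \<in> borel_measurable borel" unfolding g_def by measurable
  \<comment> \<open>Where the denominator vanishes, the assumption \<open>le\<close> forces
    \<open>h\<close> to vanish too, so the convention for division by zero does no harm.\<close>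
  have gh: "h \<xi> = g \<xi> * (e2pi (\<xi> - \<eta>) - 1)" for \<xi>
    using le[of \<xi>] by (auto simp: g_def)
  have gb: "norm (g \<xi>) \<le> C" for \<xi>
    using le[of \<xi>] C by (auto simp: g_def norm_divide divide_le_eq)
  have gs: "g \<xi> = 0" if "\<xi> \<notin> {a..a+1}" for \<xi> using supp[OF that] by (simp add: g_def)
  define c where "c k = (LBINT \<xi>. g \<xi> * e2pi (of_int k * \<xi>))" for k :: int
  define d where "d k = e2pi (- (of_int k * \<eta>)) * c k" for k :: int
  have ig: "integrable lborel (\<lambda>\<xi>. g \<xi> * e2pi (of_int n * \<xi>))" for n :: int
    by (rule integrable_bounded_support[where C=C and a=a and b="a+1"])
      (use gb gs in \<open>auto simp: norm_mult\<close>)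
  have eq: "e2pi (- (of_int k * \<eta>)) * (LBINT \<xi>. h \<xi> * e2pi (of_int k * \<xi>)) = d (k + 1) - d k" for k
  proof -
    have "h \<xi> * e2pi (of_int k * \<xi>) = e2pi (- \<eta>) * (g \<xi> * e2pi (of_int (k + 1) * \<xi>)) - g \<xi> * e2pi (of_int k * \<xi>)" for \<xi>
    proof -
      have "e2pi (\<xi> - \<eta>) * e2pi (of_int k * \<xi>) = e2pi (- \<eta>) * e2pi (of_int (k + 1) * \<xi>)"
        by (simp add: algebra_simps flip: e2pi_add)
      then show ?thesis by (simp add: gh algebra_simps)
    qed
    then have "(LBINT \<xi>. h \<xi> * e2pi (of_int k * \<xi>)) = e2pi (- \<eta>) * c (k + 1) - c k"
      using ig[of "k + 1"] ig[of k] by (simp add: c_def)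
    moreover have "e2pi (- (of_int k * \<eta>)) * e2pi (- \<eta>) = e2pi (- (of_int (k + 1) * \<eta>))"
      by (simp add: algebra_simps flip: e2pi_add)
    ultimately show ?thesis by (simp add: d_def right_diff_distrib flip: mult.assoc)
  qed
  have lim: "(\<lambda>N. d (k N)) \<longlonglongrightarrow> 0" if "inj k" for k
  proof -
    have "(\<lambda>N. c (k N)) \<longlonglongrightarrow> 0" unfolding c_def by (rule riemann_lebesgue[OF gm gb gs that])
    then have "(\<lambda>N. norm (d (k N))) \<longlonglongrightarrow> 0" by (simp add: d_def norm_mult tendsto_norm_zero)
    then show ?thesis by (simp add: tendsto_norm_zero_iff)
  qed
  have "(\<lambda>N. d (int N + 1) - d (- int N)) \<longlonglongrightarrow> 0 - 0"
    by (intro tendsto_diff lim) (auto simp: inj_def)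
  then show ?thesis by (simp add: eq sum_telescope_int)
qed

text \<open>Converts a Lipschitz bound in the distance to an integer translate into the hypothesis
  of \<open>dini_fourier_sum\<close>. With s = t - round t the right side is 2 |sin (pi s)|, and
  since |pi s| is at most 2, the cubic Taylor error is at most two thirds of |pi s|.\<close>

lemma abs_sub_round_le_norm_e2pi:
  fixes t :: real
  obtains j :: int where "\<bar>t - of_int j\<bar> \<le> norm (e2pi t - 1)"
proof -
  define s where "s = t - of_int (round t)"
  have s: "\<bar>s\<bar> \<le> 1/2" using of_int_round_abs_le[of t] by (simp add: s_def abs_minus_commute)
  have e: "e2pi t = e2pi s"
  proof -
    have "t = s + of_int (round t)" by (simp add: s_def)
    then show ?thesis by (metis e2pi_add e2pi_of_int mult.right_neutral)
  qed
  define x where "x = pi * s"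
  have x: "\<bar>x\<bar> \<le> 2" using s pi_less_4 mult_mono[of pi 4 "\<bar>s\<bar>" "1/2"] by (simp add: x_def abs_mult)
  have "\<bar>sin x - x\<bar> \<le> \<bar>x\<bar> ^ 3 / 6"
    using Maclaurin_sin_bound[of x 3] by (simp add: sin_coeff_def fact_numeral eval_nat_numeral)
  also have "\<bar>x\<bar> ^ 3 / 6 \<le> \<bar>x\<bar> * (2/3)"
  proof -
    have "\<bar>x\<bar> * (\<bar>x\<bar> * \<bar>x\<bar>) \<le> \<bar>x\<bar> * (2 * 2)" using x by (intro mult_left_mono mult_mono) auto
    then show ?thesis by (simp add: power3_eq_cube)
  qed
  finally have sx: "\<bar>x\<bar> / 3 \<le> \<bar>sin x\<bar>" by linarith
  have "(norm (e2pi s - 1))\<^sup>2 = (2 * \<bar>sin x\<bar>)\<^sup>2"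
  proof -
    have "(norm (e2pi s - 1))\<^sup>2 = (cos (2 * x) - 1)\<^sup>2 + (sin (2 * x))\<^sup>2"
      by (simp add: cmod_power2 e2pi_def x_def mult_ac)
    also have "\<dots> = ((cos (2 * x))\<^sup>2 + (sin (2 * x))\<^sup>2) - 2 * cos (2 * x) + 1"
      by (simp add: power2_eq_square algebra_simps)
    also have "\<dots> = 2 - 2 * (1 - 2 * (sin x)\<^sup>2)" proof -
      have "(cos (2 * x))\<^sup>2 + (sin (2 * x))\<^sup>2 = 1" by simp
      then show ?thesis by (simp only: cos_double_sin)
    qed
    finally show ?thesis by (simp add: power_mult_distrib)
  qed
  then have "norm (e2pi s - 1) = 2 * \<bar>sin x\<bar>" by (subst (asm) power2_eq_iff_nonneg) auto
  with sx have "2 * (pi * \<bar>s\<bar>) / 3 \<le> norm (e2pi s - 1)" by (simp add: x_def abs_mult)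
  moreover have "3 * \<bar>s\<bar> / 2 \<le> pi * \<bar>s\<bar>" using pi_ge_two by (intro order_trans[OF _ mult_right_mono[of 2 pi]]) auto
  ultimately have "\<bar>s\<bar> \<le> norm (e2pi s - 1)" by linarith
  with that[of "round t"] show ?thesis by (simp add: s_def[symmetric] e)
qed

lemma trapezoid_ft_dilate:
  assumes "0 < \<epsilon>"
  shows "of_real \<epsilon> * trapezoid_ft (\<epsilon> * y) = (LBINT \<xi>. of_real (trapezoid (\<xi> / \<epsilon>)) * e2pi (y * \<xi>))"
  unfolding trapezoid_ft_def using assms
  by (subst (2) lborel_integral_real_affine[of \<epsilon> _ 0]) (auto simp: scaleR_conv_of_real mult_ac)

lemma trapezoid_divide_lipschitz:
  assumes "0 < \<epsilon>"
  shows "\<bar>trapezoid (x / \<epsilon>) - trapezoid (y / \<epsilon>)\<bar> \<le> 2 / \<epsilon> * \<bar>x - y\<bar>"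
proof -
  have "\<bar>trapezoid (x / \<epsilon>) - trapezoid (y / \<epsilon>)\<bar> \<le> 2 * \<bar>x / \<epsilon> - y / \<epsilon>\<bar>" by (rule trapezoid_lipschitz)
  also have "x / \<epsilon> - y / \<epsilon> = (x - y) / \<epsilon>" by (simp add: diff_divide_distrib)
  finally show ?thesis using assms by (simp add: abs_divide)
qed

text \<open>Poisson summation for the dilated trapezoid. Since \<epsilon> and |\<eta>| are at most
  1/2, only the untranslated copy of the bump can contribute at \<eta>. Convergence of the symmetric
  sums is obtained from Dini's criterion.\<close>

lemma poisson_trapezoid:
  fixes \<epsilon> \<eta> :: real
  assumes \<epsilon>: "0 < \<epsilon>" "\<epsilon> \<le> 1/2" and \<eta>: "\<bar>\<eta>\<bar> \<le> 1/2"
  shows "(\<lambda>N. \<Sum>k\<in>{- int N..int N}. e2pi (- (of_int k * \<eta>)) * trapezoid_kernel \<epsilon> k)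
    \<longlonglongrightarrow> of_real (trapezoid (\<eta> / \<epsilon>))"
proof -
  define I where "I = {-1/2..-1/2+1::real}"
  have [measurable]: "I \<in> sets borel" by (simp add: I_def)
  define T where "T = trapezoid (\<eta> / \<epsilon>)"
  \<comment> \<open>Subtracting the constant \<open>T\<close> on one full period makes
    \<open>h\<close> vanish at \<eta> and changes only the coefficient of frequency 0, by
    \<open>T\<close>.\<close>
  define h where "h \<xi> = complex_of_real (trapezoid (\<xi> / \<epsilon>) - T * indicator I \<xi>)" for \<xi>
  have supp: "trapezoid (x / \<epsilon>) = 0" if "1/2 \<le> \<bar>x\<bar>" for x
  proof -
    have "\<epsilon> \<le> \<bar>x\<bar>" using \<epsilon> that by linarith
    then have "1 \<le> \<bar>x / \<epsilon>\<bar>" using \<epsilon> by (simp add: field_simps)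
    then show ?thesis by (simp add: trapezoid_eq_0)
  qed
  have I: "\<xi> \<in> I \<or> 1/2 \<le> \<bar>\<xi>\<bar>" "\<xi> \<in> I \<Longrightarrow> \<bar>\<xi>\<bar> \<le> 1/2" for \<xi> by (auto simp: I_def)
  have "(\<lambda>N. \<Sum>k\<in>{- int N..int N}. e2pi (- (of_int k * \<eta>)) * (LBINT \<xi>. h \<xi> * e2pi (of_int k * \<xi>))) \<longlonglongrightarrow> 0"
  proof (rule dini_fourier_sum[where a="-1/2" and C="2/\<epsilon>"])
    show "h x = 0" if "x \<notin> {-1/2..-1/2+1}" for x
      using supp[of x] I(1)[of x] that by (auto simp: h_def I_def)
    fix \<xi> :: real
    obtain j where j: "\<bar>\<xi> - \<eta> - of_int j\<bar> \<le> norm (e2pi (\<xi> - \<eta>) - 1)"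
      by (rule abs_sub_round_le_norm_e2pi)
    have "norm (h \<xi>) \<le> 2 / \<epsilon> * \<bar>\<xi> - \<eta> - of_int j\<bar>"
    proof (cases "\<xi> \<in> I")
      case False
      then show ?thesis using supp[of \<xi>] I(1)[of \<xi>] \<epsilon> by (simp add: h_def)
    next
      case True
      then have h: "norm (h \<xi>) = \<bar>trapezoid (\<xi> / \<epsilon>) - trapezoid (\<eta> / \<epsilon>)\<bar>"
        by (simp only: h_def norm_of_real T_def) simp
      show ?thesis
      proof (cases "j = 0")
        case True
        then show ?thesis using trapezoid_divide_lipschitz[OF \<epsilon>(1), of \<xi> \<eta>] h by simp
      next
        \<comment> \<open>Here \<xi> is near a nonzero translate of \<eta>, as when both lie close
          to opposite ends of the period. Each of the two trapezoid values is then small, being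
          compared with a zero of the trapezoid at \<eta> + j or at \<xi> - j.\<close>
        case False
        then have "1 \<le> \<bar>real_of_int j\<bar>" by linarith
        then have "1/2 \<le> \<bar>\<eta> + of_int j\<bar>" "1/2 \<le> \<bar>\<xi> - of_int j\<bar>" using I(2)[OF True] \<eta> by linarith+
        then have "trapezoid ((\<eta> + of_int j) / \<epsilon>) = 0" "trapezoid ((\<xi> - of_int j) / \<epsilon>) = 0" using supp by blast+
        then have "trapezoid (\<xi> / \<epsilon>) \<le> 2 / \<epsilon> * \<bar>\<xi> - \<eta> - of_int j\<bar>" "trapezoid (\<eta> / \<epsilon>) \<le> 2 / \<epsilon> * \<bar>\<xi> - \<eta> - of_int j\<bar>"
          using trapezoid_divide_lipschitz[OF \<epsilon>(1), of \<xi> "\<eta> + of_int j"]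
            trapezoid_divide_lipschitz[OF \<epsilon>(1), of "\<xi> - of_int j" \<eta>]
          by (simp_all add: algebra_simps)
        then show ?thesis unfolding h using trapezoid_bounds(1)[of "\<xi> / \<epsilon>"] trapezoid_bounds(1)[of "\<eta> / \<epsilon>"] by linarith
      qed
    qed
    also have "\<dots> \<le> 2 / \<epsilon> * norm (e2pi (\<xi> - \<eta>) - 1)"
      using \<epsilon> j by (intro mult_left_mono) auto
    finally show "norm (h \<xi>) \<le> 2 / \<epsilon> * norm (e2pi (\<xi> - \<eta>) - 1)" .
  qed (use \<epsilon> in \<open>auto simp: h_def[abs_def]\<close>)
  moreover have "(\<Sum>k\<in>{- int N..int N}. e2pi (- (of_int k * \<eta>)) * (LBINT \<xi>. h \<xi> * e2pi (of_int k * \<xi>))) =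
      (\<Sum>k\<in>{- int N..int N}. e2pi (- (of_int k * \<eta>)) * trapezoid_kernel \<epsilon> k) - of_real T" for N
  proof -
    have it: "integrable lborel (\<lambda>\<xi>. complex_of_real (trapezoid (\<xi> / \<epsilon>)) * e2pi (of_int k * \<xi>))" for k :: int
    proof (rule integrable_bounded_support[where C=1 and a="-1/2" and b="-1/2+1"])
      show "complex_of_real (trapezoid (x / \<epsilon>)) * e2pi (of_int k * x) = 0" if "x \<notin> {-1/2..-1/2+1}" for x
        using supp[of x] I(1)[of x] that by (auto simp: I_def)
    qed (auto simp: norm_mult trapezoid_bounds)
    have "(LBINT \<xi>. h \<xi> * e2pi (of_int k * \<xi>)) =
       trapezoid_kernel \<epsilon> k - of_real T * (if k = 0 then 1 else 0)" for k :: int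
    proof -
      have "(LBINT \<xi>. h \<xi> * e2pi (of_int k * \<xi>)) =
        (LBINT \<xi>. complex_of_real (trapezoid (\<xi> / \<epsilon>)) * e2pi (of_int k * \<xi>) - of_real T * (indicator I \<xi> *\<^sub>R e2pi (of_int k * \<xi>)))"
        by (simp add: h_def left_diff_distrib scaleR_conv_of_real mult.assoc)
      also have "\<dots> = (LBINT \<xi>. complex_of_real (trapezoid (\<xi> / \<epsilon>)) * e2pi (of_int k * \<xi>)) - of_real T * (LBINT \<xi>. indicator I \<xi> *\<^sub>R e2pi (of_int k * \<xi>))"
        unfolding I_def integral_mult_right_zero[symmetric]
        by (intro Bochner_Integration.integral_diff it integrable_mult_right integral_e2pi_of_int)
      finally show ?thesis
        unfolding I_def integral_e2pi_of_int(2) trapezoid_ft_dilate[OF \<epsilon>(1)] .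
    qed
    then have "(\<Sum>k\<in>{- int N..int N}. e2pi (- (of_int k * \<eta>)) * (LBINT \<xi>. h \<xi> * e2pi (of_int k * \<xi>))) =
      (\<Sum>k\<in>{- int N..int N}. e2pi (- (of_int k * \<eta>)) * trapezoid_kernel \<epsilon> k - (if k = 0 then of_real T else 0))"
      by (intro sum.cong refl) (auto simp: right_diff_distrib)
    then show ?thesis by (simp add: sum_subtractf)
  qed
  ultimately have "(\<lambda>N. (\<Sum>k\<in>{- int N..int N}. e2pi (- (of_int k * \<eta>)) * trapezoid_kernel \<epsilon> k) - of_real T) \<longlonglongrightarrow> 0"
    by simp
  then show ?thesis by (simp add: LIM_zero_iff T_def)
qed

lemma sum_roots_of_unity:
  fixes j :: int and q :: nat
  assumes "0 < q"
  shows "(\<Sum>b\<in>{1..q}. e2pi (of_int j * (of_nat b / of_nat q))) = (if int q dvd j then of_nat q else 0)"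
proof -
  define z where "z = e2pi (of_int j / of_nat q)"
  have zb: "e2pi (of_int j * (of_nat b / of_nat q)) = z ^ b" for b
    by (simp add: z_def e2pi_power mult_ac)
  have zq: "z ^ q = 1"
    using assms e2pi_of_int[of j] by (simp add: z_def e2pi_power)
  show ?thesis
  proof (cases "int q dvd j")
    case True
    then obtain i where "j = int q * i" by blast
    then have "z = 1" using assms e2pi_of_int[of i] by (simp add: z_def)
    then show ?thesis using True by (simp only: zb) simp
  next
    case False
    have z1: "z \<noteq> 1"
    proof
      assume "z = 1"
      then have "Re z = 1" by simp
      then have "cos (2 * pi * (of_int j / of_nat q)) = 1" by (simp only: z_def e2pi_def cis.sel)
      then obtain i :: int where "2 * pi * (of_int j / of_nat q) = of_int i * 2 * pi"
        unfolding cos_one_2pi_int by blast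
      then have "(2 * pi) * (of_int j / of_nat q) = (2 * pi) * of_int i" by (simp only: mult_ac)
      then have "of_int j / of_nat q = real_of_int i" unfolding mult_cancel_left by simp
      then have "real_of_int j = real_of_int (int q * i)" using assms by (simp add: field_simps)
      then have "j = int q * i" by (simp only: of_int_eq_iff)
      with False show False by simp
    qed
    have "(\<Sum>b\<in>{1..q}. z ^ b) = z * (\<Sum>b<q. z ^ b)"
      by (simp add: sum_distrib_left sum.atLeast1_atMost_eq)
    also have "(\<Sum>b<q. z ^ b) = 0" using z1 zq by (simp add: geometric_sum)
    finally show ?thesis using False by (simp only: zb) simp
  qed
qed

section \<open>Unordered sums over the integers as symmetric limits\<close>

lemma filterlim_symmetric_int_intervals:
  "filterlim (\<lambda>N. {- int N..int N}) (finite_subsets_at_top UNIV) sequentially"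
  unfolding filterlim_finite_subsets_at_top
proof (intro allI impI)
  fix X :: "int set" assume X: "finite X \<and> X \<subseteq> UNIV"
  obtain k where k: "\<And>n. n \<in> X \<Longrightarrow> \<bar>n\<bar> \<le> k"
    using finite_imageI[of X abs] X Max_ge by (metis imageI)
  have "X \<subseteq> {- int N..int N}" if "nat k \<le> N" for N
  proof
    fix n assume "n \<in> X"
    with k[of n] that show "n \<in> {- int N..int N}" by auto
  qed
  then show "\<forall>\<^sub>F N in sequentially. finite {- int N..int N} \<and> X \<subseteq> {- int N..int N} \<and> {- int N..int N} \<subseteq> UNIV"
    by (auto simp: eventually_sequentially)
qed

lemma has_sum_int_imp_symmetric:
  "(f has_sum x) (UNIV :: int set) \<Longrightarrow> (\<lambda>N. \<Sum>k\<in>{- int N..int N}. f k) \<longlonglongrightarrow> x"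
  unfolding has_sum_def by (rule filterlim_compose[OF _ filterlim_symmetric_int_intervals])

lemma has_sum_int_symmetric:
  fixes f :: "int \<Rightarrow> complex"
  assumes "(\<lambda>k. norm (f k)) summable_on UNIV" "(\<lambda>N. \<Sum>k\<in>{- int N..int N}. f k) \<longlonglongrightarrow> x"
  shows "(f has_sum x) UNIV"
proof -
  have s: "(f has_sum (infsum f UNIV)) UNIV"
    using abs_summable_summable[OF assms(1)] by (rule has_sum_infsum)
  from LIMSEQ_unique[OF assms(2) has_sum_int_imp_symmetric[OF s]] s show ?thesis by simp
qed

lemma norm_summable_on_int:
  fixes f :: "int \<Rightarrow> 'b::real_normed_vector"
  assumes "\<And>F. finite F \<Longrightarrow> (\<Sum>k\<in>F. norm (f k)) \<le> C"
  shows "(\<lambda>k. norm (f k)) summable_on UNIV"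
proof (rule nonneg_bdd_above_summable_on)
  show "bdd_above (sum (\<lambda>k. norm (f k)) ` {F. F \<subseteq> UNIV \<and> finite F})"
    using assms by (intro bdd_aboveI[of _ C]) auto
qed simp

section \<open>Kernels of arcs around fractions with a common denominator\<close>

definition arc_sum :: "nat set \<Rightarrow> nat \<Rightarrow> int \<Rightarrow> complex" where
  "arc_sum A q n = (\<Sum>a\<in>A. e2pi (of_int n * (of_nat a / of_nat q)))"

text \<open>The kernel \<open>w\<close> of the smooth pieces is reproduced by the periodic multiplier with kernel \<open>L\<close>,
  because the cutoffs around distinct fractions \<open>a / q\<close> and \<open>b / q\<close> do not interact.\<close>

lemma arc_kernel_factorization:
  fixes m' :: "real \<Rightarrow> complex" and \<epsilon> :: real and q :: nat and A :: "nat set"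
  assumes m': "m' \<in> borel_measurable borel" "\<And>x. norm (m' x) \<le> C" "{x. m' x \<noteq> 0} \<subseteq> {-1/2<..1/2}"
    and \<epsilon>: "0 < \<epsilon>" "\<epsilon> \<le> 1/2" "2 * \<epsilon> * of_nat q \<le> 1" and q: "0 < q" and A: "A \<subseteq> {1..q}"
  defines "K \<equiv> (\<lambda>y. of_real \<epsilon> * (LBINT \<xi>. m' \<xi> * e2pi (\<epsilon> * y * \<xi>)))"
  defines "L \<equiv> (\<lambda>j::int. (if int q dvd j then of_nat q else 0) * K (of_int j))"
  defines "w \<equiv> (\<lambda>k::int. arc_sum A q k * trapezoid_kernel \<epsilon> k)"
  shows "((\<lambda>k. L (n - k) * w k) has_sum (arc_sum A q n * K (of_int n))) UNIV"
proof (rule has_sum_int_symmetric)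
  let ?e = "\<lambda>b \<xi>. e2pi (of_int n * (\<xi> + of_nat b / of_nat q))"
  note [measurable] = m'(1)
  have C: "C \<ge> 0" using m'(2)[of 0] norm_ge_zero order_trans by blast
  define \<mu> where "\<mu> \<xi> = m' (\<xi> / \<epsilon>)" for \<xi>
  have [measurable]: "\<mu> \<in> borel_measurable borel" unfolding \<mu>_def by measurable
  have \<mu>b: "norm (\<mu> \<xi>) \<le> C" for \<xi> by (simp add: \<mu>_def m')
  have \<mu>s: "\<bar>\<xi>\<bar> \<le> \<epsilon> / 2" if "\<mu> \<xi> \<noteq> 0" for \<xi>
  proof -
    have "\<bar>\<xi> / \<epsilon>\<bar> \<le> 1/2" using subsetD[OF m'(3), of "\<xi> / \<epsilon>"] that by (auto simp: \<mu>_def)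
    then show ?thesis using \<epsilon> by (simp add: field_simps)
  qed
  have \<mu>s': "\<mu> \<xi> = 0" if "\<xi> \<notin> {-1/2..1/2}" for \<xi>
  proof (rule ccontr)
    assume "\<mu> \<xi> \<noteq> 0"
    from \<mu>s[OF this] that \<epsilon> show False by auto
  qed
  have i\<mu>: "integrable lborel (\<lambda>\<xi>. norm (\<mu> \<xi>))"
    by (rule integrable_bounded_support[where C=C and a="-1/2" and b="1/2"]) (use \<mu>b \<mu>s' in auto)
  have i\<mu>e: "integrable lborel (\<lambda>\<xi>. \<mu> \<xi> * e2pi (y * \<xi>))" for y
    by (rule Bochner_Integration.integrable_bound[OF i\<mu>]) (auto simp: norm_mult)
  have K: "K y = (LBINT \<xi>. \<mu> \<xi> * e2pi (y * \<xi>))" for y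
    using \<epsilon> unfolding K_def \<mu>_def
    by (subst (2) lborel_integral_real_affine[of \<epsilon> _ 0]) (auto simp: scaleR_conv_of_real mult_ac)
  define D where "D = (LBINT \<xi>. norm (\<mu> \<xi>))"
  have Kb: "norm (K y) \<le> D" for y
    unfolding K D_def by (rule order_trans[OF integral_norm_bound]) (simp add: norm_mult)
  have finA: "finite A" using A finite_subset by blast
  have ab: "norm (arc_sum A q k) \<le> of_nat (card A)" for k
    unfolding arc_sum_def by (rule order_trans[OF norm_sum]) simp
  have Lb: "norm (L j) \<le> of_nat q * D" for j
    using Kb[of "of_int j"] order_trans[OF norm_ge_zero Kb] by (auto simp: L_def norm_mult intro!: mult_left_mono)
  show "(\<lambda>k. norm (L (n - k) * w k)) summable_on UNIV"
  proof (rule norm_summable_on_int)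
    fix F :: "int set" assume F: "finite F"
    have "(\<Sum>k\<in>F. norm (L (n - k) * w k)) \<le> (\<Sum>k\<in>F. (of_nat q * D * of_nat (card A)) * (\<epsilon> * norm (trapezoid_ft (\<epsilon> * of_int k))))"
    proof (rule sum_mono)
      fix k
      have "norm (L (n - k) * w k) \<le> (of_nat q * D) * (of_nat (card A) * (\<epsilon> * norm (trapezoid_ft (\<epsilon> * of_int k))))"
        unfolding w_def norm_mult using \<epsilon> Lb ab by (intro mult_mono) (auto intro: order_trans[OF norm_ge_zero Lb])
      then show "norm (L (n - k) * w k) \<le> (of_nat q * D * of_nat (card A)) * (\<epsilon> * norm (trapezoid_ft (\<epsilon> * of_int k)))"
        by (simp add: mult_ac)
    qed
    also have "\<dots> \<le> (of_nat q * D * of_nat (card A)) * (9 * pi)"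
      unfolding sum_distrib_left[of "of_nat q * D * of_nat (card A)", symmetric] using F \<epsilon> order_trans[OF norm_ge_zero Kb]
      by (intro mult_left_mono sum_norm_trapezoid_ft_lattice_le) auto
    finally show "(\<Sum>k\<in>F. norm (L (n - k) * w k)) \<le> (of_nat q * D * of_nat (card A)) * (9 * pi)" .
  qed
  define P where "P N \<eta> = (\<Sum>k\<in>{- int N..int N}. e2pi (- (of_int k * \<eta>)) * trapezoid_kernel \<epsilon> k)" for N \<eta>
  have Pm[measurable]: "P N \<in> borel_measurable borel" for N unfolding P_def by measurable
  have Pb: "norm (P N \<eta>) \<le> 9 * pi" for N \<eta>
  proof -
    have "norm (P N \<eta>) \<le> (\<Sum>k\<in>{- int N..int N}. \<epsilon> * norm (trapezoid_ft (\<epsilon> * of_int k)))"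
      unfolding P_def using \<epsilon> by (intro order_trans[OF norm_sum] sum_mono) (simp add: norm_mult)
    also have "\<dots> \<le> 9 * pi" using \<epsilon> by (intro sum_norm_trapezoid_ft_lattice_le) auto
    finally show ?thesis .
  qed
  define t where "t a b = (of_nat b - of_nat a) / real q" for a b :: nat
  \<comment> \<open>\<open>P N\<close> is a partial Poisson sum of the periodized trapezoid.
    Reduction modulo 1 brings the point to \<eta> in [-1/2,1/2]: for a = b it lies on the plateau,
    otherwise off the support.\<close>
  have Plim: "(\<lambda>N. P N (\<xi> + t a b)) \<longlonglongrightarrow> (if a = b then 1 else 0)"
    if \<xi>: "\<bar>\<xi>\<bar> \<le> \<epsilon> / 2" and "a \<in> A" "b \<in> {1..q}" for \<xi> a b
  proof -
    define j where "j = round (\<xi> + t a b)"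
    define \<eta> where "\<eta> = \<xi> + t a b - of_int j"
    have \<eta>: "\<bar>\<eta>\<bar> \<le> 1/2" using of_int_round_abs_le[of "\<xi> + t a b"] by (simp add: \<eta>_def j_def abs_minus_commute)
    have "e2pi (- (of_int k * (\<xi> + t a b))) = e2pi (- (of_int k * \<eta>))" for k :: int
    proof -
      have "- (of_int k * (\<xi> + t a b)) = - (of_int k * \<eta>) + of_int (- (k * j))" by (simp add: \<eta>_def algebra_simps)
      then show ?thesis by (metis e2pi_add e2pi_of_int mult.right_neutral)
    qed
    then have lim: "(\<lambda>N. P N (\<xi> + t a b)) \<longlonglongrightarrow> of_real (trapezoid (\<eta> / \<epsilon>))"
      unfolding P_def using poisson_trapezoid[OF \<epsilon>(1,2) \<eta>] by simp
    show ?thesis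
    proof (cases "a = b")
      case True
      then have "\<bar>\<xi> + t a b\<bar> < 1/2" using \<xi> \<epsilon> by (simp add: t_def)
      then have "j = 0" unfolding j_def by (intro round_unique') simp
      then have "\<bar>\<eta> / \<epsilon>\<bar> \<le> 1/2" using True \<xi> \<epsilon>(1) by (simp add: \<eta>_def t_def abs_divide field_simps)
      with True lim show ?thesis by (simp add: trapezoid_eq_1)
    next
      case False
      define i where "i = int b - int a - j * int q"
      have "i \<noteq> 0"
      proof
        assume "i = 0"
        then have "int b - int a = j * int q" by (simp add: i_def)
        moreover have "\<bar>int b - int a\<bar> < int q" "int b - int a \<noteq> 0"
          using that subsetD[OF A, of a] False by auto
        ultimately show False
          using zdvd_imp_le[of "int q" "\<bar>int b - int a\<bar>"] by simp
      qed
      then have "1 \<le> \<bar>real_of_int i\<bar>" by linarith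
      \<comment> \<open>Distinct fractions with denominator q are at least 1/q, hence 2 \<epsilon>,
        apart modulo 1. Moving by |\<xi>|, at most \<epsilon>/2, leaves a distance of at least
        \<epsilon>.\<close>
      then have "1 / real q \<le> \<bar>real_of_int i / real q\<bar>" using q by (simp add: abs_divide divide_right_mono)
      moreover have "real_of_int i / real q = t a b - of_int j"
        using q by (simp add: i_def t_def diff_divide_distrib)
      moreover have "2 * \<epsilon> \<le> 1 / real q" using \<epsilon>(3) q by (simp add: field_simps)
      ultimately have "\<epsilon> \<le> \<bar>\<eta>\<bar>" unfolding \<eta>_def using \<xi> \<epsilon>(1) by linarith
      then have "1 \<le> \<bar>\<eta> / \<epsilon>\<bar>" using \<epsilon>(1) by (simp add: abs_divide)
      with False lim show ?thesis by (simp add: trapezoid_eq_0)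
    qed
  qed
  have lim1: "(\<lambda>N. LBINT \<xi>. \<mu> \<xi> * ?e b \<xi> * P N (\<xi> + t a b)) \<longlonglongrightarrow>
     (LBINT \<xi>. \<mu> \<xi> * ?e b \<xi> * (if a = b then 1 else 0))"
    if "a \<in> A" "b \<in> {1..q}" for a b
  proof (rule integral_dominated_convergence[where w="\<lambda>\<xi>. norm (\<mu> \<xi>) * (9 * pi)"])
    show "AE \<xi> in lborel. (\<lambda>N. \<mu> \<xi> * ?e b \<xi> * P N (\<xi> + t a b)) \<longlonglongrightarrow>
       \<mu> \<xi> * ?e b \<xi> * (if a = b then 1 else 0)"
    proof (intro always_eventually allI)
      fix \<xi>
      show "(\<lambda>N. \<mu> \<xi> * ?e b \<xi> * P N (\<xi> + t a b)) \<longlonglongrightarrow>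
       \<mu> \<xi> * ?e b \<xi> * (if a = b then 1 else 0)"
      proof (cases "\<mu> \<xi> = 0")
        case False
        then show ?thesis by (intro tendsto_mult tendsto_const Plim \<mu>s that)
      qed simp
    qed
    show "AE \<xi> in lborel. norm (\<mu> \<xi> * ?e b \<xi> * P N (\<xi> + t a b)) \<le> norm (\<mu> \<xi>) * (9 * pi)" for N
      by (auto simp: norm_mult intro!: mult_left_mono Pb)
  qed (use i\<mu> in auto)
  \<comment> \<open>The factor q on multiples of q is opened as a sum of roots of unity over b, the
    factor \<open>w\<close> as a sum over a, and \<open>K\<close> as an integral. All phases then
    combine into the partial sums \<open>P N\<close> at shifted points.\<close>
  have eq: "(\<Sum>k\<in>{- int N..int N}. L (n - k) * w k) =
     (\<Sum>b\<in>{1..q}. \<Sum>a\<in>A. LBINT \<xi>. \<mu> \<xi> * ?e b \<xi> * P N (\<xi> + t a b))" for N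
  proof -
    have term_eq: "L (n - k) * w k = (\<Sum>b\<in>{1..q}. \<Sum>a\<in>A. LBINT \<xi>. \<mu> \<xi> * ?e b \<xi> *
        (e2pi (- (of_int k * (\<xi> + t a b))) * trapezoid_kernel \<epsilon> k))" for k
    proof -
      have "L (n - k) * w k = (\<Sum>b\<in>{1..q}. \<Sum>a\<in>A. e2pi (of_int (n - k) * (of_nat b / of_nat q)) * K (of_int (n - k)) *
          (e2pi (of_int k * (of_nat a / of_nat q)) * trapezoid_kernel \<epsilon> k))"
        unfolding L_def w_def arc_sum_def sum_roots_of_unity[OF q, symmetric]
        by (simp only: sum_distrib_right sum_distrib_left) (rule sum.swap)
      also have "\<dots> = (\<Sum>b\<in>{1..q}. \<Sum>a\<in>A. LBINT \<xi>. \<mu> \<xi> * ?e b \<xi> *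
        (e2pi (- (of_int k * (\<xi> + t a b))) * trapezoid_kernel \<epsilon> k))"
      proof (intro sum.cong refl)
        fix a b
        have "\<mu> \<xi> * ?e b \<xi> * (e2pi (- (of_int k * (\<xi> + t a b))) * trapezoid_kernel \<epsilon> k)
          = (\<mu> \<xi> * e2pi (of_int (n - k) * \<xi>)) * (e2pi (of_int (n - k) * (of_nat b / of_nat q)) *
          (e2pi (of_int k * (of_nat a / of_nat q)) * trapezoid_kernel \<epsilon> k))" for \<xi>
        proof -
          have "?e b \<xi> * e2pi (- (of_int k * (\<xi> + t a b))) =
             e2pi (of_int (n - k) * \<xi>) * (e2pi (of_int (n - k) * (of_nat b / of_nat q)) * e2pi (of_int k * (of_nat a / of_nat q)))"
            unfolding e2pi_add[symmetric] by (rule arg_cong[where f=e2pi]) (simp add: t_def algebra_simps diff_divide_distrib)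
          then show ?thesis by (metis (no_types, lifting) mult.assoc)
        qed
        then show "e2pi (of_int (n - k) * (of_nat b / of_nat q)) * K (of_int (n - k)) * (e2pi (of_int k * (of_nat a / of_nat q)) * trapezoid_kernel \<epsilon> k)
          = (LBINT \<xi>. \<mu> \<xi> * ?e b \<xi> * (e2pi (- (of_int k * (\<xi> + t a b))) * trapezoid_kernel \<epsilon> k))"
          by (simp only: integral_mult_left_zero K) (simp only: mult_ac)
      qed
      finally show ?thesis .
    qed
    have int: "integrable lborel (\<lambda>\<xi>. \<mu> \<xi> * ?e b \<xi> *
        (e2pi (- (of_int k * (\<xi> + t a b))) * trapezoid_kernel \<epsilon> k))" for a b k
      by (rule Bochner_Integration.integrable_bound[OF integrable_mult_left[OF i\<mu>, of "\<epsilon> * norm (trapezoid_ft (\<epsilon> * of_int k))"]])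
        (use \<epsilon> in \<open>auto simp: norm_mult\<close>)
    have "(\<Sum>k\<in>{- int N..int N}. L (n - k) * w k) = (\<Sum>b\<in>{1..q}. \<Sum>a\<in>A. \<Sum>k\<in>{- int N..int N}. LBINT \<xi>. \<mu> \<xi> * ?e b \<xi> *
        (e2pi (- (of_int k * (\<xi> + t a b))) * trapezoid_kernel \<epsilon> k))"
      unfolding term_eq by (subst sum.swap) (intro sum.cong refl sum.swap)
    also have "\<dots> = (\<Sum>b\<in>{1..q}. \<Sum>a\<in>A. LBINT \<xi>. \<mu> \<xi> * ?e b \<xi> * P N (\<xi> + t a b))"
      unfolding P_def sum_distrib_left
      by (intro sum.cong refl Bochner_Integration.integral_sum[symmetric] int)
    finally show ?thesis .
  qed
  have "(\<lambda>N. \<Sum>k\<in>{- int N..int N}. L (n - k) * w k) \<longlonglongrightarrow>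
    (\<Sum>b\<in>{1..q}. \<Sum>a\<in>A. LBINT \<xi>. \<mu> \<xi> * ?e b \<xi> * (if a = b then 1 else 0))"
    unfolding eq by (intro tendsto_sum lim1)
  also have "(\<Sum>b\<in>{1..q}. \<Sum>a\<in>A. LBINT \<xi>. \<mu> \<xi> * ?e b \<xi> * (if a = b then 1 else 0))
     = (\<Sum>a\<in>A. \<Sum>b\<in>{1..q}. if b = a then e2pi (of_int n * (of_nat a / of_nat q)) * K (of_int n) else 0)"
  proof (subst sum.swap, intro sum.cong refl)
    fix a b
    have "(LBINT \<xi>. \<mu> \<xi> * ?e b \<xi>) = e2pi (of_int n * (of_nat b / of_nat q)) * K (of_int n)"
      by (simp add: K distrib_left e2pi_add flip: mult.assoc)
    then show "(LBINT \<xi>. \<mu> \<xi> * ?e b \<xi> * (if a = b then 1 else 0)) =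
      (if b = a then e2pi (of_int n * (of_nat a / of_nat q)) * K (of_int n) else 0)" by auto
  qed
  also have "\<dots> = (\<Sum>a\<in>A. e2pi (of_int n * (of_nat a / of_nat q)) * K (of_int n))"
  proof (intro sum.cong refl)
    fix a assume "a \<in> A"
    then have "a \<in> {1..q}" using A by blast
    then show "(\<Sum>b\<in>{1..q}. if b = a then e2pi (of_int n * (of_nat a / of_nat q)) * K (of_int n) else 0) =
      e2pi (of_int n * (of_nat a / of_nat q)) * K (of_int n)" by (simp only: sum.delta finite_atLeastAtMost if_True)
  qed
  also have "\<dots> = arc_sum A q n * K (of_int n)" by (simp add: arc_sum_def sum_distrib_right)
  finally show "(\<lambda>N. \<Sum>k\<in>{- int N..int N}. L (n - k) * w k) \<longlonglongrightarrow> arc_sum A q n * K (of_int n)" .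
qed

section \<open>Ramanujan sums and the square function on finitely supported functions\<close>

definition reduced_residues :: "nat \<Rightarrow> nat set" where
  "reduced_residues q = {a \<in> {1..q}. coprime a q}"

lemma prod_distinct_primes_dvd_iff:
  fixes X :: "nat set"
  assumes "finite X" "X \<subseteq> {p. prime p}"
  shows "\<Prod>X dvd a \<longleftrightarrow> (\<forall>p\<in>X. p dvd a)"
  using assms
proof (induction X rule: finite_induct)
  case (insert p X)
  have "coprime p (\<Prod>X)"
    using insert by (intro prod_coprime_right primes_coprime) auto
  then have "p * \<Prod>X dvd a \<longleftrightarrow> p dvd a \<and> \<Prod>X dvd a"
    by (meson divides_mult dvd_mult_left dvd_mult_right)
  then show ?case using insert by simp
qed simp

text \<open>Inclusion-exclusion: the product over the primes p dividing q of one minus the indicator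
  of p dividing a is expanded. The sign is the Moebius function at \<open>\<Prod>X\<close>.\<close>

lemma indicator_coprime_expansion:
  fixes q a :: nat
  assumes "0 < q"
  shows "(if coprime a q then 1 else 0 :: complex) =
    (\<Sum>X\<in>Pow {p. prime p \<and> p dvd q}. (- 1) ^ card X * (if \<Prod>X dvd a then 1 else 0))"
proof -
  define P where "P = {p. prime p \<and> p dvd q}"
  have P: "finite P" unfolding P_def using finite_divisors_nat[OF assms] by (rule rev_finite_subset) auto
  have "(\<Prod>p\<in>P. (if p dvd a then - 1 else 0) + 1 :: complex) = (if coprime a q then 1 else 0)"
  proof (cases "coprime a q")
    case True
    have "\<not> p dvd a" if "p \<in> P" for p
    proof
      assume "p dvd a"
      moreover have "p dvd q" "prime p" using that by (auto simp: P_def)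
      ultimately have "is_unit p" using True by (intro coprime_common_divisor[of a q p])
      with \<open>prime p\<close> show False by (simp add: not_prime_unit)
    qed
    then have "(\<Prod>p\<in>P. (if p dvd a then - 1 else 0) + 1 :: complex) = (\<Prod>p\<in>P. 1)"
      by (intro prod.cong refl) simp
    with True show ?thesis by simp
  next
    case False
    then have "gcd a q \<noteq> 1" by (simp add: coprime_iff_gcd_eq_1)
    then obtain p where "prime p" "p dvd gcd a q" using prime_factor_nat by blast
    then have p: "p \<in> P" "p dvd a" by (auto simp: P_def)
    have "(\<Prod>p\<in>P. (if p dvd a then - 1 else 0) + 1 :: complex) = 0"
      using p by (intro prod_zero[OF P] bexI[of _ p]) simp_all
    with False show ?thesis by simp
  qed
  moreover have "(\<Prod>p\<in>P. (if p dvd a then - 1 else 0) + 1 :: complex) =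
      (\<Sum>X\<in>Pow P. (\<Prod>p\<in>X. if p dvd a then - 1 else 0) * (\<Prod>p\<in>P - X. 1))"
    by (rule prod_add[OF P])
  moreover have "(\<Prod>p\<in>X. if p dvd a then - 1 else 0 :: complex) = (- 1) ^ card X * (if \<Prod>X dvd a then 1 else 0)"
    if "X \<in> Pow P" for X
  proof -
    have X: "finite X" "X \<subseteq> {p. prime p}" using that P finite_subset by (auto simp: P_def)
    show ?thesis
    proof (cases "\<forall>p\<in>X. p dvd a")
      case True
      then have "\<Prod>X dvd a" by (rule prod_distinct_primes_dvd_iff[OF X, THEN iffD2])
      moreover have "(\<Prod>p\<in>X. if p dvd a then - 1 else 0 :: complex) = (\<Prod>p\<in>X. - 1)"
        using True by (intro prod.cong refl) simp
      ultimately show ?thesis by simp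
    next
      case False
      then obtain p where p: "p \<in> X" "\<not> p dvd a" by blast
      have "\<not> \<Prod>X dvd a" using False prod_distinct_primes_dvd_iff[OF X, THEN iffD1] by blast
      moreover have "(\<Prod>p\<in>X. if p dvd a then - 1 else 0 :: complex) = 0"
        using p by (intro prod_zero[OF X(1)] bexI[of _ p]) simp_all
      ultimately show ?thesis by simp
    qed
  qed
  ultimately have "(if coprime a q then 1 else 0 :: complex) = (\<Sum>X\<in>Pow P. ((- 1) ^ card X * (if \<Prod>X dvd a then 1 else 0)) * (\<Prod>p\<in>P - X. 1))"
    by (simp only: cong: sum.cong)
  then show ?thesis by (simp only: P_def prod.neutral_const mult_1_right)
qed

text \<open>For each set X of primes, the numerators divisible by \<open>\<Prod>X\<close> run
  through all fractions with denominator \<open>q div \<Prod>X\<close>, whose roots of unity sum to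
  a multiple of an indicator. The number of sets X is what later becomes the factor
  2^\<Omega>.\<close>

lemma ramanujan_sum_expansion:
  fixes q :: nat and n :: int
  assumes q: "0 < q"
  shows "arc_sum (reduced_residues q) q n =
    (\<Sum>X\<in>Pow {p. prime p \<and> p dvd q}. (- 1) ^ card X * (if int (q div \<Prod>X) dvd n then of_nat (q div \<Prod>X) else 0))"
proof -
  define P where "P = {p. prime p \<and> p dvd q}"
  have P: "finite P" unfolding P_def using finite_divisors_nat[OF q] by (rule rev_finite_subset) auto
  have "arc_sum (reduced_residues q) q n = (\<Sum>a\<in>{1..q}. (if coprime a q then 1 else 0) * e2pi (of_int n * (of_nat a / of_nat q)))"
    unfolding arc_sum_def reduced_residues_def by (intro sum.mono_neutral_cong_left) auto
  also have "\<dots> = (\<Sum>a\<in>{1..q}. \<Sum>X\<in>Pow P. (- 1) ^ card X * ((if \<Prod>X dvd a then 1 else 0) * e2pi (of_int n * (of_nat a / of_nat q))))"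
    by (simp only: indicator_coprime_expansion[OF q] P_def sum_distrib_right mult.assoc)
  also have "\<dots> = (\<Sum>X\<in>Pow P. (- 1) ^ card X * (\<Sum>a\<in>{1..q}. (if \<Prod>X dvd a then 1 else 0) * e2pi (of_int n * (of_nat a / of_nat q))))"
    by (subst sum.swap) (simp only: sum_distrib_left)
  also have "\<dots> = (\<Sum>X\<in>Pow P. (- 1) ^ card X * (if int (q div \<Prod>X) dvd n then of_nat (q div \<Prod>X) else 0))"
  proof (intro sum.cong refl arg_cong2[where f="(*)"])
    fix X assume X: "X \<in> Pow P"
    then have X': "finite X" "X \<subseteq> {p. prime p}" using P finite_subset by (auto simp: P_def)
    define D where "D = \<Prod>X"
    have "D dvd q"
      unfolding D_def by (rule prod_distinct_primes_dvd_iff[OF X', THEN iffD2]) (use X in \<open>auto simp: P_def\<close>)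
    then obtain s where s: "q = D * s" by blast
    with q have pos: "0 < D" "0 < s" by auto
    have "(\<Sum>a\<in>{1..q}. (if D dvd a then 1 else 0) * e2pi (of_int n * (of_nat a / of_nat q)))
      = (\<Sum>a\<in>(\<lambda>b. D * b) ` {1..s}. e2pi (of_int n * (of_nat a / of_nat q)))"
    proof (rule sum.mono_neutral_cong_right)
      show "(\<lambda>b. D * b) ` {1..s} \<subseteq> {1..q}" using pos s by (auto simp: Suc_le_eq)
      show "\<forall>i\<in>{1..q} - (\<lambda>b. D * b) ` {1..s}. (if D dvd i then 1 else 0) * e2pi (of_int n * (of_nat i / of_nat q)) = 0"
      proof
        fix i assume i: "i \<in> {1..q} - (\<lambda>b. D * b) ` {1..s}"
        have "\<not> D dvd i"
        proof
          assume "D dvd i"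
          then obtain b where b: "i = D * b" by blast
          have "D * b \<le> D * s" "b \<noteq> 0" using i b s by auto
          then have "b \<in> {1..s}" using pos by auto
          with b i show False by blast
        qed
        then show "(if D dvd i then 1 else 0) * e2pi (of_int n * (of_nat i / of_nat q)) = 0" by simp
      qed
    qed (use pos in auto)
    also have "\<dots> = (\<Sum>b\<in>{1..s}. e2pi (of_int n * (of_nat b / of_nat s)))"
      using pos by (subst sum.reindex) (auto simp: inj_on_def s intro!: sum.cong)
    also have "\<dots> = (if int s dvd n then of_nat s else 0)" by (rule sum_roots_of_unity[OF pos(2)])
    also have "s = q div D" using s pos by simp
    finally show "(\<Sum>a\<in>{1..q}. (if \<Prod>X dvd a then 1 else 0) * e2pi (of_int n * (of_nat a / of_nat q))) =
      (if int (q div \<Prod>X) dvd n then of_nat (q div \<Prod>X) else 0)" by (simp only: D_def)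
  qed
  finally show ?thesis by (simp only: P_def)
qed

text \<open>A term s times the indicator of multiples of s samples the kernel with step \<epsilon>
  s, and its height s restores exactly the weight of a Riemann sum. So every set of primes costs at
  most 9 pi, whatever s is. Estimating numerator by numerator would cost Euler's function of q in
  place of 2^\<omega>(q).\<close>

lemma sum_norm_smooth_arc_kernel_le:
  fixes N :: "int set" and q :: nat
  assumes N: "finite N" and q: "0 < q" and \<epsilon>: "0 < \<epsilon>" "\<epsilon> * of_nat q \<le> 1"
  shows "(\<Sum>n\<in>N. norm (arc_sum (reduced_residues q) q n * trapezoid_kernel \<epsilon> n))
    \<le> 2 ^ num_prime_divisors q * (9 * pi)"
proof -
  define P where "P = {p. prime p \<and> p dvd q}"
  have P: "finite P" unfolding P_def using finite_divisors_nat[OF q] by (rule rev_finite_subset) auto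
  have "(\<Sum>n\<in>N. norm (arc_sum (reduced_residues q) q n * trapezoid_kernel \<epsilon> n)) \<le>
    (\<Sum>n\<in>N. \<Sum>X\<in>Pow P. (if int (q div \<Prod>X) dvd n then of_nat (q div \<Prod>X) else 0) * (\<epsilon> * norm (trapezoid_ft (\<epsilon> * of_int n))))"
  proof (rule sum_mono)
    fix n
    have "norm (arc_sum (reduced_residues q) q n) \<le> (\<Sum>X\<in>Pow P. norm ((- 1 :: complex) ^ card X * (if int (q div \<Prod>X) dvd n then of_nat (q div \<Prod>X) else 0)))"
      unfolding ramanujan_sum_expansion[OF q] P_def by (rule norm_sum)
    also have "\<dots> = (\<Sum>X\<in>Pow P. (if int (q div \<Prod>X) dvd n then of_nat (q div \<Prod>X) else 0))"
      by (intro sum.cong refl) (simp add: norm_mult norm_power)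
    finally have "norm (arc_sum (reduced_residues q) q n) * (\<epsilon> * norm (trapezoid_ft (\<epsilon> * of_int n))) \<le>
      (\<Sum>X\<in>Pow P. (if int (q div \<Prod>X) dvd n then of_nat (q div \<Prod>X) else 0)) * (\<epsilon> * norm (trapezoid_ft (\<epsilon> * of_int n)))"
      using \<epsilon> by (intro mult_right_mono) auto
    then show "norm (arc_sum (reduced_residues q) q n * trapezoid_kernel \<epsilon> n) \<le>
      (\<Sum>X\<in>Pow P. (if int (q div \<Prod>X) dvd n then of_nat (q div \<Prod>X) else 0) * (\<epsilon> * norm (trapezoid_ft (\<epsilon> * of_int n))))"
      using \<epsilon> by (simp add: norm_mult sum_distrib_right)
  qed
  also have "\<dots> = (\<Sum>X\<in>Pow P. \<Sum>n\<in>N. (if int (q div \<Prod>X) dvd n then of_nat (q div \<Prod>X) else 0) * (\<epsilon> * norm (trapezoid_ft (\<epsilon> * of_int n))))"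
    by (rule sum.swap)
  also have "\<dots> \<le> (\<Sum>X\<in>Pow P. 9 * pi)"
  proof (rule sum_mono)
    fix X assume X: "X \<in> Pow P"
    then have X': "finite X" "X \<subseteq> {p. prime p}" using P finite_subset by (auto simp: P_def)
    define s where "s = q div \<Prod>X"
    have "\<Prod>X dvd q"
      by (rule prod_distinct_primes_dvd_iff[OF X', THEN iffD2]) (use X in \<open>auto simp: P_def\<close>)
    then have s: "s dvd q" "0 < s" "s \<le> q" using q by (auto simp: s_def div_dvd_iff_mult intro!: div_le_dividend)
    define J where "J = (\<lambda>n. n div int s) ` N"
    have "(\<Sum>n\<in>N. (if int s dvd n then of_nat s else 0) * (\<epsilon> * norm (trapezoid_ft (\<epsilon> * of_int n)))) =
      (\<Sum>n\<in>{n\<in>N. int s dvd n}. of_nat s * (\<epsilon> * norm (trapezoid_ft (\<epsilon> * of_int n))))"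
      using N by (intro sum.mono_neutral_cong_right) auto
    also have "\<dots> \<le> (\<Sum>n\<in>(\<lambda>j. int s * j) ` J. of_nat s * (\<epsilon> * norm (trapezoid_ft (\<epsilon> * of_int n))))"
    proof (rule sum_mono2)
      show "{n\<in>N. int s dvd n} \<subseteq> (\<lambda>j. int s * j) ` J"
      proof
        fix n assume n: "n \<in> {n\<in>N. int s dvd n}"
        then have "n = int s * (n div int s)" by simp
        with n show "n \<in> (\<lambda>j. int s * j) ` J" by (auto simp only: J_def)
      qed
    qed (use N \<epsilon> in \<open>auto simp: J_def\<close>)
    also have "\<dots> = (\<Sum>j\<in>J. (\<epsilon> * of_nat s) * norm (trapezoid_ft ((\<epsilon> * of_nat s) * of_int j)))"
      using s by (subst sum.reindex) (auto simp: inj_on_def mult_ac)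
    also have "\<dots> \<le> 9 * pi"
    proof (rule sum_norm_trapezoid_ft_lattice_le)
      have "\<epsilon> * of_nat s \<le> \<epsilon> * of_nat q" using \<epsilon> s by (intro mult_left_mono) auto
      then show "\<epsilon> * of_nat s \<le> 1" using \<epsilon> by linarith
    qed (use N s \<epsilon> in \<open>auto simp: J_def\<close>)
    finally show "(\<Sum>n\<in>N. (if int (q div \<Prod>X) dvd n then of_nat (q div \<Prod>X) else 0) * (\<epsilon> * norm (trapezoid_ft (\<epsilon> * of_int n)))) \<le> 9 * pi"
      by (simp only: s_def)
  qed
  also have "\<dots> = 2 ^ num_prime_divisors q * (9 * pi)"
    using P by (simp add: card_Pow num_prime_divisors_def P_def)
  finally show ?thesis .
qed

section \<open>Spacing of reduced fractions and the mean square bound\<close>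

lemma reduced_fraction_gap:
  fixes q q' a a' :: nat
  assumes "a \<in> reduced_residues q" "a' \<in> reduced_residues q'" "(q, a) \<noteq> (q', a')"
  shows "1 \<le> \<bar>of_nat a / of_nat q - of_nat a' / of_nat q'\<bar> * (real q * real q')"
proof -
  have pos: "0 < q" "0 < q'" using assms by (auto simp: reduced_residues_def)
  have "a * q' \<noteq> a' * q"
  proof
    assume eq: "a * q' = a' * q"
    have cop: "coprime q a" "coprime q' a'" using assms by (simp_all add: reduced_residues_def ac_simps)
    have "q dvd a * q'" unfolding eq by simp
    then have 1: "q dvd q'" using coprime_dvd_mult_right_iff[OF cop(1)] by blast
    have "q' dvd a' * q" unfolding eq[symmetric] by simp
    then have 2: "q' dvd q" using coprime_dvd_mult_right_iff[OF cop(2)] by blast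
    from 1 2 have "q = q'" by (rule dvd_antisym)
    then show False using eq pos assms(3) by simp
  qed
  then have "int (a * q') - int (a' * q) \<noteq> 0" by (simp only: right_minus_eq of_nat_eq_iff not_False_eq_True)
  then have "1 \<le> \<bar>real_of_int (int (a * q') - int (a' * q))\<bar>" by linarith
  then have "1 \<le> \<bar>real a * real q' - real a' * real q\<bar>" by simp
  also have "\<bar>real a * real q' - real a' * real q\<bar> = \<bar>(of_nat a / of_nat q - of_nat a' / of_nat q') * (real q * real q')\<bar>"
  proof -
    have "real a * real q' - real a' * real q = (of_nat a / of_nat q - of_nat a' / of_nat q') * (real q * real q')"
      using pos by (simp add: field_simps)
    then show ?thesis by simp
  qed
  finally show ?thesis by (simp add: abs_mult)
qed

text \<open>For q at least 2 the numerator q is not coprime to q, so all fractions keep a distance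
  of 1/q from 0 and 1. The arcs therefore stay inside one period and never wrap around.\<close>

lemma reduced_fraction_bounds:
  assumes "2 \<le> q" "0 < \<epsilon>" "\<epsilon> * (real q * real q) < 1" "a \<in> reduced_residues q"
  shows "\<epsilon> \<le> real a / real q" "real a / real q \<le> 1 - \<epsilon>"
proof -
  have "\<epsilon> * (real q * 1) \<le> \<epsilon> * (real q * real q)" using assms by (intro mult_left_mono) auto
  then have "\<epsilon> * real q < 1" using assms(3) by linarith
  then have e: "\<epsilon> \<le> 1 / real q" using assms(1) by (simp add: field_simps)
  have "a \<noteq> q" using assms(1,4) by (auto simp: reduced_residues_def)
  then have a: "1 \<le> a" "a + 1 \<le> q" using assms(4) by (auto simp: reduced_residues_def)
  have "1 / real q \<le> real a / real q" "real a / real q \<le> 1 - 1 / real q"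
    using a assms(1) by (auto simp: field_simps)
  with e show "\<epsilon> \<le> real a / real q" "real a / real q \<le> 1 - \<epsilon>" by linarith+
qed

text \<open>At most one fraction lies within \<epsilon> of \<xi> on each side: two on the same side
  would be at most \<epsilon> apart, against \<open>reduced_fraction_gap\<close>. The map to the
  side is thus injective into the booleans.\<close>

lemma sum_arc_cutoffs_le:
  fixes Z :: "nat set"
  assumes Z: "finite Z" and \<epsilon>: "0 < \<epsilon>" "\<And>q q'. q \<in> Z \<Longrightarrow> q' \<in> Z \<Longrightarrow> \<epsilon> * (real q * real q') < 1"
  shows "(\<Sum>q\<in>Z. \<Sum>a\<in>reduced_residues q. trapezoid ((\<xi> - of_nat a / of_nat q) / \<epsilon>)) \<le> 2"
proof -
  define \<theta> where "\<theta> = (\<lambda>(q, a). of_nat a / of_nat q :: real)"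
  define J where "J = {x \<in> Sigma Z reduced_residues. \<bar>\<xi> - \<theta> x\<bar> < \<epsilon>}"
  have fin: "finite (Sigma Z reduced_residues)" using Z by (auto simp: reduced_residues_def)
  have inj: "inj_on (\<lambda>x. \<theta> x \<le> \<xi>) J"
  proof (rule inj_onI, rule ccontr)
    fix x y assume xy: "x \<in> J" "y \<in> J" "(\<theta> x \<le> \<xi>) = (\<theta> y \<le> \<xi>)" "x \<noteq> y"
    obtain q a q' a' where eq: "x = (q, a)" "y = (q', a')" by fastforce
    have "\<bar>\<theta> x - \<theta> y\<bar> \<le> \<epsilon>" using xy by (auto simp: J_def)
    then have "\<bar>\<theta> x - \<theta> y\<bar> * (real q * real q') \<le> \<epsilon> * (real q * real q')"
      by (intro mult_right_mono) auto
    moreover have "\<epsilon> * (real q * real q') < 1" using xy eq by (intro \<epsilon>) (auto simp: J_def)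
    moreover have "1 \<le> \<bar>\<theta> x - \<theta> y\<bar> * (real q * real q')"
      using reduced_fraction_gap[of a q a' q'] xy eq by (auto simp: J_def \<theta>_def)
    ultimately show False by linarith
  qed
  have "card J \<le> card (UNIV :: bool set)" by (rule card_inj_on_le[OF inj]) auto
  then have card: "card J \<le> 2" by (simp add: card_UNIV_bool)
  have "(\<Sum>q\<in>Z. \<Sum>a\<in>reduced_residues q. trapezoid ((\<xi> - of_nat a / of_nat q) / \<epsilon>)) = (\<Sum>x\<in>Sigma Z reduced_residues. trapezoid ((\<xi> - \<theta> x) / \<epsilon>))"
    using Z by (subst sum.Sigma) (auto simp: reduced_residues_def \<theta>_def split_def)
  also have "\<dots> = (\<Sum>x\<in>J. trapezoid ((\<xi> - \<theta> x) / \<epsilon>))"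
    using fin \<epsilon> by (intro sum.mono_neutral_right) (auto simp: J_def not_less abs_divide intro!: trapezoid_eq_0)
  also have "\<dots> \<le> (\<Sum>x\<in>J. 1)" by (intro sum_mono trapezoid_bounds)
  also have "\<dots> \<le> 2" using card by simp
  finally show ?thesis .
qed

text \<open>Bessel for each q reduces the claim to the pointwise sum of the squared cutoffs
  \<open>X q\<close>. Each cutoff and their sum are at most 2, so the squares sum to at most 4;
  orthogonality of characters evaluates the remaining integral.\<close>

lemma smooth_arc_square_function_l2:
  fixes Z :: "nat set" and S N :: "int set" and f :: "int \<Rightarrow> complex"
  assumes Z: "finite Z" "\<And>q. q \<in> Z \<Longrightarrow> 2 \<le> q"
    and \<epsilon>: "0 < \<epsilon>" "\<And>q q'. q \<in> Z \<Longrightarrow> q' \<in> Z \<Longrightarrow> \<epsilon> * (real q * real q') < 1"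
    and S: "finite S" and N: "finite N"
  defines "w \<equiv> (\<lambda>q n. arc_sum (reduced_residues q) q n * trapezoid_kernel \<epsilon> n)"
  shows "(\<Sum>q\<in>Z. \<Sum>n\<in>N. (norm (\<Sum>k\<in>S. w q (n - k) * f k))\<^sup>2) \<le> 4 * (\<Sum>k\<in>S. (norm (f k))\<^sup>2)"
proof -
  define X where "X q \<xi> = (\<Sum>a\<in>reduced_residues q. trapezoid ((\<xi> - of_nat a / of_nat q) / \<epsilon>))" for q \<xi>
  define F where "F \<xi> = (\<Sum>k\<in>S. f k * e2pi (- (of_int k * \<xi>)))" for \<xi>
  have [measurable]: "X q \<in> borel_measurable borel" for q unfolding X_def by measurable
  have [measurable]: "F \<in> borel_measurable borel" unfolding F_def by measurable
  have X0: "0 \<le> X q \<xi>" for q \<xi> unfolding X_def by (intro sum_nonneg trapezoid_bounds)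
  have Xsum: "(\<Sum>q\<in>Z. X q \<xi>) \<le> 2" for \<xi> unfolding X_def by (rule sum_arc_cutoffs_le[OF Z(1) \<epsilon>])
  have X2: "X q \<xi> \<le> 2" if "q \<in> Z" for q \<xi>
    using Xsum[of \<xi>] member_le_sum[OF that, of "\<lambda>q. X q \<xi>"] X0 Z(1) by force
  have Fb: "norm (F \<xi>) \<le> (\<Sum>k\<in>S. norm (f k))" for \<xi>
    unfolding F_def by (rule order_trans[OF norm_sum]) (simp add: norm_mult)
  have tsupp: "trapezoid ((\<xi> - of_nat a / of_nat q) / \<epsilon>) = 0" if "q \<in> Z" "a \<in> reduced_residues q" "\<xi> \<notin> {0..0+1}" for q a \<xi>
  proof (rule trapezoid_eq_0)
    have "\<epsilon> \<le> \<bar>\<xi> - real a / real q\<bar>"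
      using reduced_fraction_bounds[OF Z(2)[OF that(1)] \<epsilon>(1) \<epsilon>(2)[OF that(1) that(1)] that(2)] that(3) by auto
    then show "1 \<le> \<bar>(\<xi> - of_nat a / of_nat q) / \<epsilon>\<bar>" using \<epsilon> by simp
  qed
  have Xsupp: "X q \<xi> = 0" if "q \<in> Z" "\<xi> \<notin> {0..0+1}" for q \<xi>
    unfolding X_def using that by (intro sum.neutral ballI tsupp) auto
  have tint: "integrable lborel (\<lambda>\<xi>. of_real (trapezoid ((\<xi> - of_nat a / of_nat q) / \<epsilon>)) * e2pi (of_int n * \<xi>))"
    if "q \<in> Z" "a \<in> reduced_residues q" for q a and n :: int
    by (rule integrable_bounded_support[where C=1 and a=0 and b="0+1"])
      (use tsupp[OF that] in \<open>auto simp: norm_mult trapezoid_bounds\<close>)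
  have w: "w q n = (LBINT \<xi>. of_real (X q \<xi>) * e2pi (of_int n * \<xi>))" if "q \<in> Z" for q n
  proof -
    have "w q n = (\<Sum>a\<in>reduced_residues q. e2pi (of_int n * (of_nat a / of_nat q)) *
       (LBINT \<xi>. of_real (trapezoid (\<xi> / \<epsilon>)) * e2pi (of_int n * \<xi>)))"
      by (simp add: w_def arc_sum_def sum_distrib_right trapezoid_ft_dilate[OF \<epsilon>(1)])
    also have "\<dots> = (\<Sum>a\<in>reduced_residues q. (LBINT \<xi>. of_real (trapezoid ((\<xi> - of_nat a / of_nat q) / \<epsilon>)) * e2pi (of_int n * \<xi>)))"
    proof (intro sum.cong refl)
      fix a
      have "e2pi (of_int n * (of_nat a / of_nat q)) * (LBINT \<xi>. of_real (trapezoid (\<xi> / \<epsilon>)) * e2pi (of_int n * \<xi>)) =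
        (LBINT \<xi>. of_real (trapezoid (\<xi> / \<epsilon>)) * e2pi (of_int n * (of_nat a / of_nat q + \<xi>)))"
        unfolding integral_mult_right_zero[symmetric]
        by (intro Bochner_Integration.integral_cong refl) (simp add: distrib_left e2pi_add)
      also have "\<dots> = (LBINT \<xi>. of_real (trapezoid ((\<xi> - of_nat a / of_nat q) / \<epsilon>)) * e2pi (of_int n * \<xi>))"
        by (subst (2) lborel_integral_real_affine[of 1 _ "of_nat a / of_nat q"]) auto
      finally show "e2pi (of_int n * (of_nat a / of_nat q)) * (LBINT \<xi>. of_real (trapezoid (\<xi> / \<epsilon>)) * e2pi (of_int n * \<xi>)) =
        (LBINT \<xi>. of_real (trapezoid ((\<xi> - of_nat a / of_nat q) / \<epsilon>)) * e2pi (of_int n * \<xi>))" .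
    qed
    also have "\<dots> = (LBINT \<xi>. (\<Sum>a\<in>reduced_residues q. of_real (trapezoid ((\<xi> - of_nat a / of_nat q) / \<epsilon>)) * e2pi (of_int n * \<xi>)))"
      by (rule Bochner_Integration.integral_sum[symmetric]) (rule tint[OF that])
    finally show ?thesis by (simp add: X_def sum_distrib_right)
  qed
  have Xint: "integrable lborel (\<lambda>\<xi>. of_real (X q \<xi>) * e2pi (of_int n * \<xi>))" if "q \<in> Z" for q and n :: int
    by (rule integrable_bounded_support[where C=2 and a=0 and b="0+1"])
      (use Xsupp[OF that] X2[OF that] X0 in \<open>auto simp: norm_mult\<close>)
  have conv: "(\<Sum>k\<in>S. w q (n - k) * f k) = (LBINT \<xi>. (of_real (X q \<xi>) * F \<xi>) * e2pi (of_int n * \<xi>))" if "q \<in> Z" for q n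
  proof -
    have "(\<Sum>k\<in>S. w q (n - k) * f k) = (\<Sum>k\<in>S. (LBINT \<xi>. (of_real (X q \<xi>) * e2pi (of_int (n - k) * \<xi>)) * f k))"
      by (simp only: w[OF that] integral_mult_left_zero)
    also have "\<dots> = (LBINT \<xi>. (\<Sum>k\<in>S. (of_real (X q \<xi>) * e2pi (of_int (n - k) * \<xi>)) * f k))"
      by (intro Bochner_Integration.integral_sum[symmetric] integrable_mult_left Xint that)
    also have "\<dots> = (LBINT \<xi>. (of_real (X q \<xi>) * F \<xi>) * e2pi (of_int n * \<xi>))"
    proof (intro Bochner_Integration.integral_cong refl)
      fix \<xi>
      have "e2pi (of_int (n - k) * \<xi>) = e2pi (- (of_int k * \<xi>)) * e2pi (of_int n * \<xi>)" for k
        by (simp add: left_diff_distrib flip: e2pi_add)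
      then show "(\<Sum>k\<in>S. (of_real (X q \<xi>) * e2pi (of_int (n - k) * \<xi>)) * f k) = (of_real (X q \<xi>) * F \<xi>) * e2pi (of_int n * \<xi>)"
        by (simp add: F_def sum_distrib_left sum_distrib_right mult_ac)
    qed
    finally show ?thesis .
  qed
  have XFint: "integrable lborel (\<lambda>\<xi>. (norm (of_real (X q \<xi>) * F \<xi>))\<^sup>2)" if "q \<in> Z" for q
  proof (rule integrable_bounded_support[where C="(2 * (\<Sum>k\<in>S. norm (f k)))\<^sup>2" and a=0 and b="0+1"])
    fix \<xi>
    have "norm (of_real (X q \<xi>) * F \<xi>) \<le> 2 * (\<Sum>k\<in>S. norm (f k))"
      unfolding norm_mult using X2[OF that] X0 Fb by (intro mult_mono) auto
    then have "(norm (of_real (X q \<xi>) * F \<xi>))\<^sup>2 \<le> (2 * (\<Sum>k\<in>S. norm (f k)))\<^sup>2"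
      by (rule power_mono) simp
    then show "norm ((norm (of_real (X q \<xi>) * F \<xi>))\<^sup>2) \<le> (2 * (\<Sum>k\<in>S. norm (f k)))\<^sup>2"
      by simp
  qed (use Xsupp[OF that] in auto)
  have iF2: "integrable lborel (\<lambda>\<xi>. indicator {0..0+1} \<xi> * (norm (F \<xi>))\<^sup>2)"
    by (rule integrable_bounded_support[where C="(\<Sum>k\<in>S. norm (f k))\<^sup>2" and a=0 and b="0+1"])
      (use Fb in \<open>auto simp: indicator_def intro!: power_mono\<close>)
  have "(\<Sum>q\<in>Z. \<Sum>n\<in>N. (norm (\<Sum>k\<in>S. w q (n - k) * f k))\<^sup>2) \<le> (\<Sum>q\<in>Z. LBINT \<xi>. (norm (of_real (X q \<xi>) * F \<xi>))\<^sup>2)"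
  proof (rule sum_mono)
    fix q assume q: "q \<in> Z"
    show "(\<Sum>n\<in>N. (norm (\<Sum>k\<in>S. w q (n - k) * f k))\<^sup>2) \<le> (LBINT \<xi>. (norm (of_real (X q \<xi>) * F \<xi>))\<^sup>2)"
      unfolding conv[OF q]
    proof (rule bessel_inequality[where C="2 * (\<Sum>k\<in>S. norm (f k))" and a=0])
      show "norm (of_real (X q \<xi>) * F \<xi>) \<le> 2 * (\<Sum>k\<in>S. norm (f k))" for \<xi>
        unfolding norm_mult using X2[OF q] X0 Fb by (intro mult_mono) auto
    qed (use Xsupp[OF q] N in auto)
  qed
  also have "\<dots> = (LBINT \<xi>. (\<Sum>q\<in>Z. (norm (of_real (X q \<xi>) * F \<xi>))\<^sup>2))"
    by (rule Bochner_Integration.integral_sum[symmetric]) (rule XFint)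
  also have "\<dots> \<le> (LBINT \<xi>. 4 * (indicator {0..0+1} \<xi> * (norm (F \<xi>))\<^sup>2))"
  proof (rule Bochner_Integration.integral_mono)
    fix \<xi>
    show "(\<Sum>q\<in>Z. (norm (of_real (X q \<xi>) * F \<xi>))\<^sup>2) \<le> 4 * (indicator {0..0+1} \<xi> * (norm (F \<xi>))\<^sup>2)"
    proof (cases "\<xi> \<in> {0..0+1}")
      case True
      have "(\<Sum>q\<in>Z. (X q \<xi>)\<^sup>2) \<le> (\<Sum>q\<in>Z. X q \<xi> * 2)"
        unfolding power2_eq_square using X0 X2 by (intro sum_mono mult_left_mono) auto
      also have "\<dots> \<le> 4" using Xsum[of \<xi>] by (simp flip: sum_distrib_right)
      finally have "(\<Sum>q\<in>Z. (X q \<xi>)\<^sup>2) * (norm (F \<xi>))\<^sup>2 \<le> 4 * (norm (F \<xi>))\<^sup>2" by (intro mult_right_mono) auto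
      then show ?thesis using True by (simp add: norm_mult power_mult_distrib sum_distrib_right)
    next
      case False
      then show ?thesis using Xsupp by auto
    qed
  qed (use XFint iF2 in auto)
  also have "\<dots> = 4 * (\<Sum>k\<in>S. (norm (f k))\<^sup>2)"
    unfolding F_def integral_mult_right_zero integral_trig_poly_square[OF S] ..
  finally show ?thesis .
qed

text \<open>Marcinkiewicz interpolation between the \<open>l\<^sup>2\<close> bound and the trivial \<open>l\<^sup>\<infinity>\<close> bound: the part of
  \<open>f\<close> below the level \<open>\<bar>T f j\<bar> / (2 * K)\<close> contributes at most half of \<open>\<bar>T f j\<bar>\<close>, so that for all lower levels
  \<open>t\<close> the part of \<open>f\<close> above \<open>t\<close> contributes at least the other half; integrate over \<open>t\<close>.\<close>

lemma marcinkiewicz_l2_linf: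
  fixes w :: "'j \<Rightarrow> 'k \<Rightarrow> complex" and f :: "'k \<Rightarrow> complex"
  assumes J: "finite J" and S: "finite S" and p: "2 \<le> p" and A: "0 \<le> A" and K: "0 < K"
    and l2: "\<And>f. (\<Sum>j\<in>J. (norm (\<Sum>k\<in>S. w j k * f k))\<^sup>2) \<le> A * (\<Sum>k\<in>S. (norm (f k))\<^sup>2)"
    and linf: "\<And>j. j \<in> J \<Longrightarrow> (\<Sum>k\<in>S. norm (w j k)) \<le> K"
  shows "(\<Sum>j\<in>J. norm (\<Sum>k\<in>S. w j k * f k) ^ p) \<le> 4 * (2 * K) ^ (p - 2) * A * (\<Sum>k\<in>S. norm (f k) ^ p)"
proof (cases "p = 2")
  case True
  have "0 \<le> A * (\<Sum>k\<in>S. (norm (f k))\<^sup>2)" using A by (intro mult_nonneg_nonneg sum_nonneg) auto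
  then show ?thesis using True l2[of f] by simp
next
  case False
  \<comment> \<open>The weight t^(p - 3) integrates up to a level a to a^(p - 2) / (p - 2), which
    together with the square supplies the p-th power.\<close>
  define s where "s = p - 3"
  have ps: "p = Suc s + 2" using False p by (simp add: s_def)
  define T where "T j t = (\<Sum>k\<in>S. w j k * (if t < norm (f k) then f k else 0))" for j and t :: real
  define Tf where "Tf j = (\<Sum>k\<in>S. w j k * f k)" for j
  define M where "M = (\<Sum>k\<in>S. norm (f k))"
  have fM: "norm (f k) \<le> M" if "k \<in> S" for k
    unfolding M_def using S that by (intro member_le_sum) auto
  have [measurable]: "T j \<in> borel_measurable borel" for j unfolding T_def by measurable
  have lin: "norm (\<Sum>k\<in>S. w j k * g k) \<le> K * c" if "j \<in> J" "0 \<le> c" "\<And>k. k \<in> S \<Longrightarrow> norm (g k) \<le> c" for j c and g :: "'k \<Rightarrow> complex"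
  proof -
    have "norm (\<Sum>k\<in>S. w j k * g k) \<le> (\<Sum>k\<in>S. norm (w j k) * c)"
      using that by (intro order_trans[OF norm_sum] sum_mono) (auto simp: norm_mult intro!: mult_left_mono)
    also have "\<dots> \<le> K * c" using linf[OF that(1)] that(2) unfolding sum_distrib_right[symmetric] by (intro mult_right_mono)
    finally show ?thesis .
  qed
  have M0: "0 \<le> M" unfolding M_def by (intro sum_nonneg) auto
  have diff: "norm (Tf j - T j t) \<le> K * t" if "j \<in> J" "0 \<le> t" for j t
  proof -
    have "Tf j - T j t = (\<Sum>k\<in>S. w j k * (if t < norm (f k) then 0 else f k))"
      unfolding Tf_def T_def sum_subtractf[symmetric] by (intro sum.cong) auto
    also have "norm \<dots> \<le> K * t" using that by (intro lin) auto
    finally show ?thesis .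
  qed
  have Tb: "norm (T j t) \<le> K * M" and TfM: "norm (Tf j) \<le> K * M" if "j \<in> J" for j t
    unfolding T_def Tf_def using that M0 fM by (auto intro!: lin)
  have pint: "integrable lborel (\<lambda>t::real. t ^ s * indicator {0..a} t)" for a
    by (rule integrable_bounded_support[where C="\<bar>a\<bar> ^ s" and a=0 and b=a])
      (auto simp: indicator_def abs_mult power_abs intro!: power_mono)
  have pval: "(LBINT t. t ^ s * indicator {0..a} t) = a ^ Suc s / of_nat (Suc s)" if "0 \<le> a" for a :: real
    using integral_power[OF that, of s] by simp
  have Iint: "integrable lborel (\<lambda>t. (t ^ s * indicator {0..M} t) * (norm (T j t))\<^sup>2)" if "j \<in> J" for j
  proof (rule integrable_bounded_support[where C="\<bar>M\<bar> ^ s * (K * M)\<^sup>2" and a=0 and b=M])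
    show "norm ((t ^ s * indicator {0..M} t) * (norm (T j t))\<^sup>2) \<le> \<bar>M\<bar> ^ s * (K * M)\<^sup>2" for t
      using Tb[OF that, of t] by (auto simp: indicator_def abs_mult intro!: mult_mono power_mono)
  qed (auto simp: indicator_def)
  have lower: "norm (Tf j) ^ p / (4 * (2 * K) ^ Suc s * of_nat (Suc s)) \<le> (LBINT t. (t ^ s * indicator {0..M} t) * (norm (T j t))\<^sup>2)" if j: "j \<in> J" for j
  proof -
    define a where "a = norm (Tf j) / (2 * K)"
    have a0: "0 \<le> a" using K by (simp add: a_def)
    have aM: "a \<le> M"
    proof -
      have "norm (Tf j) \<le> 2 * (K * M)" using TfM[OF j] norm_ge_zero[of "Tf j"] by linarith
      then show ?thesis using K by (simp add: a_def field_simps)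
    qed
    have "norm (Tf j) ^ p / (4 * (2 * K) ^ Suc s * of_nat (Suc s)) = ((norm (Tf j))\<^sup>2 / 4) * (a ^ Suc s / of_nat (Suc s))"
    proof -
      have "(u * v) / (4 * w * n) = (v / 4) * ((u / w) / n)" for u v w n :: real by (simp add: mult_ac)
      then show ?thesis unfolding ps power_add a_def power_divide by blast
    qed
    also have "\<dots> = (LBINT t. ((norm (Tf j))\<^sup>2 / 4) * (t ^ s * indicator {0..a} t))"
      by (simp only: pval[OF a0] integral_mult_right_zero)
    also have "\<dots> \<le> (LBINT t. (t ^ s * indicator {0..M} t) * (norm (T j t))\<^sup>2)"
    proof (rule Bochner_Integration.integral_mono)
      fix t
      show "((norm (Tf j))\<^sup>2 / 4) * (t ^ s * indicator {0..a} t) \<le> (t ^ s * indicator {0..M} t) * (norm (T j t))\<^sup>2"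
      proof (cases "t \<in> {0..a}")
        case True
        have "norm (Tf j) - norm (T j t) \<le> K * t" using diff[OF j, of t] norm_triangle_ineq2[of "Tf j" "T j t"] True by auto
        moreover have "K * t \<le> norm (Tf j) / 2" using True K by (auto simp: a_def field_simps)
        ultimately have "norm (Tf j) / 2 \<le> norm (T j t)" by linarith
        then have "(norm (Tf j) / 2)\<^sup>2 \<le> (norm (T j t))\<^sup>2" by (intro power_mono) auto
        then have "t ^ s * ((norm (Tf j) / 2)\<^sup>2) \<le> t ^ s * (norm (T j t))\<^sup>2" using True by (intro mult_left_mono) auto
        then show ?thesis using True aM by (simp add: power_divide mult_ac)
      next
        case False
        then show ?thesis by (auto simp: indicator_def)
      qed
    qed (use pint Iint[OF j] in \<open>auto intro!: integrable_mult_right\<close>)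
    finally show ?thesis .
  qed
  have "(\<Sum>j\<in>J. norm (Tf j) ^ p / (4 * (2 * K) ^ Suc s * of_nat (Suc s))) \<le> (\<Sum>j\<in>J. LBINT t. (t ^ s * indicator {0..M} t) * (norm (T j t))\<^sup>2)"
    by (intro sum_mono lower)
  also have "\<dots> = (LBINT t. (\<Sum>j\<in>J. (t ^ s * indicator {0..M} t) * (norm (T j t))\<^sup>2))"
    by (rule Bochner_Integration.integral_sum[symmetric]) (rule Iint)
  \<comment> \<open>At each level t the l^2 bound is applied to the part of \<open>f\<close> above
    t; the value at k counts only for levels up to \<open>norm (f k)\<close>.\<close>
  also have "\<dots> \<le> (LBINT t. (\<Sum>k\<in>S. (A * (norm (f k))\<^sup>2) * (t ^ s * indicator {0..norm (f k)} t)))"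
  proof (rule Bochner_Integration.integral_mono)
    fix t :: real
    show "(\<Sum>j\<in>J. (t ^ s * indicator {0..M} t) * (norm (T j t))\<^sup>2) \<le> (\<Sum>k\<in>S. (A * (norm (f k))\<^sup>2) * (t ^ s * indicator {0..norm (f k)} t))"
    proof (cases "t \<in> {0..M}")
      case True
      have "(\<Sum>j\<in>J. (norm (T j t))\<^sup>2) \<le> A * (\<Sum>k\<in>S. (norm (if t < norm (f k) then f k else 0))\<^sup>2)"
        unfolding T_def by (rule l2)
      also have "\<dots> \<le> (\<Sum>k\<in>S. A * ((norm (f k))\<^sup>2 * indicator {0..norm (f k)} t))"
        unfolding sum_distrib_left using True A by (intro sum_mono mult_left_mono) (auto simp: indicator_def)
      finally have "t ^ s * (\<Sum>j\<in>J. (norm (T j t))\<^sup>2) \<le> t ^ s * (\<Sum>k\<in>S. A * ((norm (f k))\<^sup>2 * indicator {0..norm (f k)} t))"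
        using True by (intro mult_left_mono) auto
      then show ?thesis using True by (simp add: sum_distrib_left mult_ac)
    next
      case False
      then have "(\<Sum>j\<in>J. (t ^ s * indicator {0..M} t) * (norm (T j t))\<^sup>2) = 0" by (intro sum.neutral) (auto simp: indicator_def)
      also have "0 \<le> (\<Sum>k\<in>S. (A * (norm (f k))\<^sup>2) * (t ^ s * indicator {0..norm (f k)} t))"
        using A by (intro sum_nonneg) (auto simp: indicator_def)
      finally show ?thesis .
    qed
  qed (use pint Iint in \<open>auto intro!: Bochner_Integration.integrable_sum integrable_mult_right\<close>)
  also have "\<dots> = (\<Sum>k\<in>S. (A * (norm (f k))\<^sup>2) * (norm (f k) ^ Suc s / of_nat (Suc s)))"
  proof -
    have "(LBINT t. (\<Sum>k\<in>S. (A * (norm (f k))\<^sup>2) * (t ^ s * indicator {0..norm (f k)} t))) =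
      (\<Sum>k\<in>S. (LBINT t. (A * (norm (f k))\<^sup>2) * (t ^ s * indicator {0..norm (f k)} t)))"
      by (intro Bochner_Integration.integral_sum integrable_mult_right pint)
    then show ?thesis by (simp only: integral_mult_right_zero pval[OF norm_ge_zero])
  qed
  also have "\<dots> = A * (\<Sum>k\<in>S. norm (f k) ^ p) / of_nat (Suc s)"
    unfolding ps power_add sum_distrib_left sum_divide_distrib by (intro sum.cong refl) simp
  finally have "(\<Sum>j\<in>J. norm (Tf j) ^ p) / (4 * (2 * K) ^ Suc s * of_nat (Suc s)) \<le> A * (\<Sum>k\<in>S. norm (f k) ^ p) / of_nat (Suc s)"
    by (simp only: sum_divide_distrib)
  then have "(\<Sum>j\<in>J. norm (Tf j) ^ p) / (4 * (2 * K) ^ Suc s) / of_nat (Suc s) \<le> A * (\<Sum>k\<in>S. norm (f k) ^ p) / of_nat (Suc s)"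
    by (simp only: divide_divide_eq_left)
  then have "(\<Sum>j\<in>J. norm (Tf j) ^ p) / (4 * (2 * K) ^ Suc s) \<le> A * (\<Sum>k\<in>S. norm (f k) ^ p)"
    unfolding divide_le_cancel using of_nat_0_less_iff zero_less_Suc by blast
  then have "(\<Sum>j\<in>J. norm (Tf j) ^ p) \<le> 4 * (2 * K) ^ Suc s * (A * (\<Sum>k\<in>S. norm (f k) ^ p))"
    using K by (simp add: pos_divide_le_eq mult_ac del: power_Suc)
  moreover have "p - 2 = Suc s" using ps by simp
  ultimately show ?thesis by (simp only: Tf_def mult.assoc)
qed

text \<open>Interpolation on the index set \<open>Z \<times> N\<close>, with l^2 constant 4 and K =
  9 pi 2^\<Omega>; this accounts for the factors 16 and 18 pi.\<close>

lemma smooth_arc_square_function_le: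
  fixes Z :: "nat set" and S N :: "int set" and f :: "int \<Rightarrow> complex"
  assumes Z: "finite Z" "\<And>q. q \<in> Z \<Longrightarrow> 2 \<le> q"
    and \<epsilon>: "0 < \<epsilon>" "\<And>q q'. q \<in> Z \<Longrightarrow> q' \<in> Z \<Longrightarrow> \<epsilon> * (real q * real q') < 1"
    and S: "finite S" and N: "finite N" and p: "2 \<le> p"
  defines "w \<equiv> (\<lambda>q n. arc_sum (reduced_residues q) q n * trapezoid_kernel \<epsilon> n)"
  shows "(\<Sum>q\<in>Z. \<Sum>n\<in>N. norm (\<Sum>k\<in>S. w q (n - k) * f k) ^ p) \<le>
    16 * (18 * pi * 2 ^ max_prime_divisors Z) ^ (p - 2) * (\<Sum>k\<in>S. norm (f k) ^ p)"
proof -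
  define K where "K = 2 ^ max_prime_divisors Z * (9 * pi)"
  have "(\<Sum>j\<in>Z \<times> N. norm (\<Sum>k\<in>S. w (fst j) (snd j - k) * f k) ^ p) \<le> 4 * (2 * K) ^ (p - 2) * 4 * (\<Sum>k\<in>S. norm (f k) ^ p)"
  proof (rule marcinkiewicz_l2_linf[OF _ S p])
    show "finite (Z \<times> N)" using Z N by simp
    show "0 < K" by (simp add: K_def)
    fix f :: "int \<Rightarrow> complex"
    show "(\<Sum>j\<in>Z \<times> N. (norm (\<Sum>k\<in>S. w (fst j) (snd j - k) * f k))\<^sup>2) \<le> 4 * (\<Sum>k\<in>S. (norm (f k))\<^sup>2)"
      using smooth_arc_square_function_l2[OF Z \<epsilon> S N, of f]
      by (simp add: sum.cartesian_product split_def w_def)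
  next
    fix j assume "j \<in> Z \<times> N"
    then obtain q n where j: "j = (q, n)" "q \<in> Z" "n \<in> N" by auto
    have q: "2 \<le> q" using Z j by auto
    have "\<epsilon> * (real q * 1) \<le> \<epsilon> * (real q * real q)" using q \<epsilon>(1) by (intro mult_left_mono) auto
    then have q\<epsilon>: "\<epsilon> * real q \<le> 1" using \<epsilon>(2)[OF j(2) j(2)] by linarith
    have "(\<Sum>k\<in>S. norm (w q (n - k))) = (\<Sum>i\<in>(\<lambda>k. n - k) ` S. norm (w q i))"
      by (subst sum.reindex) (auto simp: inj_on_def)
    also have "\<dots> \<le> 2 ^ num_prime_divisors q * (9 * pi)"
      unfolding w_def using S q \<epsilon>(1) q\<epsilon> by (intro sum_norm_smooth_arc_kernel_le) auto
    also have "\<dots> \<le> K"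
      unfolding K_def max_prime_divisors_def using Z j
      by (intro mult_right_mono power_increasing Max_ge) auto
    finally show "(\<Sum>k\<in>S. norm (w (fst j) (snd j - k))) \<le> K" using j by simp
  qed simp
  then show ?thesis by (simp add: sum.cartesian_product split_def K_def mult_ac)
qed

section \<open>From the smooth pieces back to the multiplier\<close>

lemma periodic_multiplier_bound:
  fixes g :: "int \<Rightarrow> complex" and m :: "real \<Rightarrow> complex" and \<epsilon> :: real
  assumes m: "Lp_multiplier (real p) B m" "{x. m x \<noteq> 0} \<subseteq> {-1/2<..1/2}"
    and p: "0 < p" and \<epsilon>: "0 < \<epsilon>" "\<epsilon> * real q \<le> 1" and q: "0 < q" and S: "finite S" and N: "finite N"
  defines "L \<equiv> (\<lambda>j::int. (if int q dvd j then of_nat q else 0) * multiplier_kernel m \<epsilon> j)"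
  shows "(\<Sum>n\<in>N. norm (\<Sum>k\<in>S. g k * L (n - k)) ^ p) \<le> transference_const p B * (\<Sum>k\<in>S. norm (g k) ^ p)"
proof -
  define R where "R = {0..<int q}"
  define c where "c s U = {n \<in> U. n mod int q = s}" for s and U :: "int set"
  have cfin: "finite (c s U)" if "finite U" for s U using that by (simp add: c_def)
  have part: "(\<Sum>n\<in>U. h n) = (\<Sum>s\<in>R. \<Sum>n\<in>c s U. h n)" if "finite U" for U and h :: "int \<Rightarrow> real"
    unfolding c_def using q that by (intro sum.group[symmetric]) (auto simp: R_def)
  have inj: "inj_on (\<lambda>n. n div int q) (c s U)" for s U
    by (rule inj_onI) (metis (mono_tags, lifting) c_def div_mult_mod_eq mem_Collect_eq)
  have rec: "int q * (n div int q) + s = n" if "n \<in> c s U" for n s U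
    using that by (auto simp: c_def)
  have class_le: "(\<Sum>n\<in>c s N. norm (\<Sum>k\<in>S. g k * L (n - k)) ^ p) \<le> transference_const p B * (\<Sum>k\<in>c s S. norm (g k) ^ p)" for s
  proof -
    \<comment> \<open>At an argument q i the factor q of \<open>L\<close> merges with \<epsilon>
      both in front of the transform and in its argument, so \<open>L\<close> becomes the multiplier
      kernel of step \<epsilon> q. Since this step is at most 1, the transference constant is the
      same for all q and all residue classes.\<close>
    define \<delta> where "\<delta> = \<epsilon> * real q"
    define g' where "g' i = g (int q * i + s)" for i
    have "(\<Sum>n\<in>c s N. norm (\<Sum>k\<in>S. g k * L (n - k)) ^ p) =
      (\<Sum>n\<in>c s N. norm (\<Sum>i\<in>(\<lambda>k. k div int q) ` c s S. g' i * multiplier_kernel m \<delta> (n div int q - i)) ^ p)"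
    proof (rule sum.cong[OF refl])
      fix n assume n: "n \<in> c s N"
      have "(\<Sum>k\<in>S. g k * L (n - k)) = (\<Sum>k\<in>c s S. g k * L (n - k))"
      proof (rule sum.mono_neutral_right[OF S])
        show "\<forall>k\<in>S - c s S. g k * L (n - k) = 0"
          using n by (auto simp: c_def L_def mod_eq_dvd_iff[symmetric])
      qed (auto simp: c_def)
      also have "\<dots> = (\<Sum>k\<in>c s S. g' (k div int q) * multiplier_kernel m \<delta> (n div int q - k div int q))"
      proof (intro sum.cong refl)
        fix k assume k: "k \<in> c s S"
        have eq: "n - k = int q * (n div int q - k div int q)"
          using rec[OF n] rec[OF k] by (simp add: right_diff_distrib)
        have "\<epsilon> * real_of_int (n - k) = \<delta> * of_int (n div int q - k div int q)"
          unfolding eq by (simp add: \<delta>_def)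
        moreover have "int q dvd n - k" unfolding eq by simp
        ultimately have "L (n - k) = of_real \<delta> * inv_fourier m (\<delta> * of_int (n div int q - k div int q))"
          by (simp only: L_def if_True) (simp add: \<delta>_def)
        then show "g k * L (n - k) = g' (k div int q) * multiplier_kernel m \<delta> (n div int q - k div int q)"
          by (simp add: g'_def rec[OF k])
      qed
      also have "\<dots> = (\<Sum>i\<in>(\<lambda>k. k div int q) ` c s S. g' i * multiplier_kernel m \<delta> (n div int q - i))"
        by (subst sum.reindex[OF inj]) simp
      finally show "norm (\<Sum>k\<in>S. g k * L (n - k)) ^ p = norm (\<Sum>i\<in>(\<lambda>k. k div int q) ` c s S. g' i * multiplier_kernel m \<delta> (n div int q - i)) ^ p"
        by (simp only:)
    qed
    also have "\<dots> = (\<Sum>j\<in>(\<lambda>n. n div int q) ` c s N. norm (\<Sum>i\<in>(\<lambda>k. k div int q) ` c s S. g' i * multiplier_kernel m \<delta> (j - i)) ^ p)"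
      by (subst sum.reindex[OF inj]) simp
    also have "\<dots> \<le> transference_const p B * (\<Sum>i\<in>(\<lambda>k. k div int q) ` c s S. norm (g' i) ^ p)"
      by (rule multiplier_transference[OF m p]) (use \<epsilon> q S N cfin in \<open>auto simp: \<delta>_def\<close>)
    also have "(\<Sum>i\<in>(\<lambda>k. k div int q) ` c s S. norm (g' i) ^ p) = (\<Sum>k\<in>c s S. norm (g k) ^ p)"
      by (subst sum.reindex[OF inj]) (auto simp: g'_def rec intro!: sum.cong)
    finally show ?thesis .
  qed
  have "(\<Sum>n\<in>N. norm (\<Sum>k\<in>S. g k * L (n - k)) ^ p) = (\<Sum>s\<in>R. \<Sum>n\<in>c s N. norm (\<Sum>k\<in>S. g k * L (n - k)) ^ p)"
    by (rule part[OF N])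
  also have "\<dots> \<le> (\<Sum>s\<in>R. transference_const p B * (\<Sum>k\<in>c s S. norm (g k) ^ p))"
    by (intro sum_mono class_le)
  also have "\<dots> = transference_const p B * (\<Sum>k\<in>S. norm (g k) ^ p)"
    by (simp only: part[OF S, of "\<lambda>k. norm (g k) ^ p"] sum_distrib_left)
  finally show ?thesis .
qed

lemma transference_const_nonneg: "0 \<le> transference_const p B"
  unfolding transference_const_def by (intro zero_le_power mult_nonneg_nonneg) auto

text \<open>Although \<open>f\<close> has finite support, the smooth pieces \<open>g q\<close> do
  not. The periodic multiplier is therefore applied to their restrictions to finite sets
  \<open>U\<close>, with a bound independent of \<open>U\<close>, before \<open>U\<close> exhausts
  the integers.\<close>

lemma arc_square_function_le:
  fixes Z :: "nat set" and S N :: "int set" and f :: "int \<Rightarrow> complex"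
  assumes m: "Lp_multiplier (real p) B m" "{x. m x \<noteq> 0} \<subseteq> {-1/2<..1/2}"
    and Z: "finite Z" "\<And>q. q \<in> Z \<Longrightarrow> 2 \<le> q"
    and \<epsilon>: "0 < \<epsilon>" "\<And>q q'. q \<in> Z \<Longrightarrow> q' \<in> Z \<Longrightarrow> \<epsilon> * (real q * real q') < 1"
    and S: "finite S" and N: "finite N" and p: "2 \<le> p"
  defines "v \<equiv> (\<lambda>q n. arc_sum (reduced_residues q) q n * multiplier_kernel m \<epsilon> n)"
  shows "(\<Sum>q\<in>Z. \<Sum>n\<in>N. norm (\<Sum>k\<in>S. f k * v q (n - k)) ^ p) \<le>
    transference_const p B * (16 * (18 * pi * 2 ^ max_prime_divisors Z) ^ (p - 2)) * (\<Sum>k\<in>S. norm (f k) ^ p)"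
proof -
  have mm: "m \<in> borel_measurable lebesgue" "bounded (range m)"
    using m(1) unfolding Lp_multiplier_def by auto
  obtain m' C where m': "m' \<in> borel_measurable borel" "\<And>x. norm (m' x) \<le> C" "{x. m' x \<noteq> 0} \<subseteq> {-1/2<..1/2}"
    and ae: "AE x in lebesgue. m x = m' x" and K: "\<And>x. inv_fourier m x = (LBINT \<xi>. m' \<xi> * e2pi (x * \<xi>))"
    by (rule inv_fourier_borel_representative[OF mm m(2)]) blast
  define w where "w = (\<lambda>q n. arc_sum (reduced_residues q) q n * trapezoid_kernel \<epsilon> n)"
  define L where "L = (\<lambda>(q::nat) (j::int). (if int q dvd j then of_nat q else 0) * multiplier_kernel m \<epsilon> j)"
  define g where "g q n = (\<Sum>k\<in>S. w q (n - k) * f k)" for q n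
  have q\<epsilon>: "\<epsilon> * real q \<le> 1" "2 * \<epsilon> * real q \<le> 1" "\<epsilon> \<le> 1/2" "0 < q" if "q \<in> Z" for q
  proof -
    have q: "2 \<le> q" using Z that by auto
    \<comment> \<open>One factor q of \<epsilon> q^2 < 1 is traded for 2, which gives the separation
      that \<open>arc_kernel_factorization\<close> requires.\<close>
    have "\<epsilon> * (real q * 2) \<le> \<epsilon> * (real q * real q)" using q \<epsilon>(1) by (intro mult_left_mono) auto
    then have *: "2 * (\<epsilon> * real q) < 1" using \<epsilon>(2)[OF that that] by linarith
    have "\<epsilon> * 1 \<le> \<epsilon> * real q" using q \<epsilon>(1) by (intro mult_left_mono) auto
    then show "\<epsilon> \<le> 1/2" using * by linarith
    show "\<epsilon> * real q \<le> 1" "2 * \<epsilon> * real q \<le> 1" using * \<epsilon>(1) by simp_all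
    show "0 < q" using q by simp
  qed
  \<comment> \<open>The kernel factorization, translated by each i in \<open>S\<close> and
    superposed with the weights \<open>f i\<close>.\<close>
  have factor: "((\<lambda>k. g q k * L q (n - k)) has_sum (\<Sum>i\<in>S. f i * v q (n - i))) UNIV" if q: "q \<in> Z" for q n
  proof -
    have rr: "reduced_residues q \<subseteq> {1..q}" by (auto simp: reduced_residues_def)
    have "((\<lambda>k. f i * (L q ((n - i) - (k - i)) * w q (k - i))) has_sum (f i * v q (n - i))) UNIV" for i
    proof (rule has_sum_cmult_right)
      have "((\<lambda>k. L q ((n - i) - k) * w q k) has_sum v q (n - i)) UNIV"
        using arc_kernel_factorization[OF m' \<epsilon>(1) q\<epsilon>(3)[OF q] q\<epsilon>(2)[OF q] q\<epsilon>(4)[OF q] rr, of "n - i"]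
        by (simp add: L_def w_def v_def K)
      moreover have "bij_betw (\<lambda>k. k - i) UNIV UNIV"
        by (rule bij_betw_byWitness[where f'="\<lambda>k. k + i"]) auto
      ultimately show "((\<lambda>k. L q ((n - i) - (k - i)) * w q (k - i)) has_sum v q (n - i)) UNIV"
        using has_sum_reindex_bij_betw[of "\<lambda>k. k - i" UNIV UNIV "\<lambda>k. L q ((n - i) - k) * w q k"] by simp
    qed
    note * = this
    have "((\<lambda>k. \<Sum>i\<in>S. f i * (L q ((n - i) - (k - i)) * w q (k - i))) has_sum (\<Sum>i\<in>S. f i * v q (n - i))) UNIV"
    proof -
      have "((\<lambda>F. \<Sum>i\<in>S. \<Sum>k\<in>F. h i k) \<longlongrightarrow> (\<Sum>i\<in>S. x i)) (finite_subsets_at_top UNIV)"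
        if "\<And>i. (h i has_sum x i) UNIV" for h :: "int \<Rightarrow> int \<Rightarrow> complex" and x
        using that unfolding has_sum_def by (intro tendsto_sum)
      moreover have "sum (\<lambda>k. \<Sum>i\<in>S. h i k) = (\<lambda>F. \<Sum>i\<in>S. \<Sum>k\<in>F. h i k)" for h :: "int \<Rightarrow> int \<Rightarrow> complex"
        by (rule ext) (rule sum.swap)
      ultimately show ?thesis using * by (simp only: has_sum_def)
    qed
    moreover have "(\<Sum>i\<in>S. f i * (L q ((n - i) - (k - i)) * w q (k - i))) = g q k * L q (n - k)" for k
      unfolding g_def sum_distrib_right by (simp add: mult_ac)
    ultimately show ?thesis by (simp only:)
  qed
  have fin: "(\<Sum>q\<in>Z. \<Sum>n\<in>N. norm (\<Sum>k\<in>U. g q k * L q (n - k)) ^ p) \<le>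
    transference_const p B * (16 * (18 * pi * 2 ^ max_prime_divisors Z) ^ (p - 2)) * (\<Sum>k\<in>S. norm (f k) ^ p)"
    if U: "finite U" for U
  proof -
    have "(\<Sum>q\<in>Z. \<Sum>n\<in>N. norm (\<Sum>k\<in>U. g q k * L q (n - k)) ^ p) \<le> (\<Sum>q\<in>Z. transference_const p B * (\<Sum>k\<in>U. norm (g q k) ^ p))"
      unfolding L_def using p by (intro sum_mono periodic_multiplier_bound[OF m _ \<epsilon>(1) q\<epsilon>(1) q\<epsilon>(4) U N]) auto
    also have "\<dots> = transference_const p B * (\<Sum>q\<in>Z. \<Sum>k\<in>U. norm (g q k) ^ p)"
      by (simp only: sum_distrib_left)
    also have "\<dots> \<le> transference_const p B * (16 * (18 * pi * 2 ^ max_prime_divisors Z) ^ (p - 2) * (\<Sum>k\<in>S. norm (f k) ^ p))"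
      unfolding g_def w_def using transference_const_nonneg
      by (intro mult_left_mono smooth_arc_square_function_le[OF Z \<epsilon> S U p]) auto
    finally show ?thesis by (simp only: mult.assoc)
  qed
  have "((\<lambda>U. \<Sum>q\<in>Z. \<Sum>n\<in>N. norm (\<Sum>k\<in>U. g q k * L q (n - k)) ^ p) \<longlongrightarrow>
     (\<Sum>q\<in>Z. \<Sum>n\<in>N. norm (\<Sum>k\<in>S. f k * v q (n - k)) ^ p)) (finite_subsets_at_top UNIV)"
    using factor unfolding has_sum_def by (intro tendsto_sum tendsto_power tendsto_norm)
  moreover have "\<forall>\<^sub>F U in finite_subsets_at_top UNIV. (\<Sum>q\<in>Z. \<Sum>n\<in>N. norm (\<Sum>k\<in>U. g q k * L q (n - k)) ^ p) \<le>
    transference_const p B * (16 * (18 * pi * 2 ^ max_prime_divisors Z) ^ (p - 2)) * (\<Sum>k\<in>S. norm (f k) ^ p)"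
    using fin by (intro eventually_finite_subsets_at_top_weakI) auto
  ultimately show ?thesis by (rule tendsto_upperbound) simp
qed

section \<open>Extension to all of the sequence space\<close>

lemma le_of_power_le:
  fixes a b :: real
  assumes "0 < p" "0 \<le> b" "a ^ p \<le> b ^ p"
  shows "a \<le> b"
  using assms by (cases p) (auto intro: power_le_imp_le_base simp del: power_Suc)

lemma powr_root_power:
  fixes a :: real
  assumes "0 < p" "0 \<le> a"
  shows "(a powr (1 / real p)) ^ p = a"
proof -
  have "(a powr (1 / real p)) ^ p = (a powr (1 / real p)) powr real p"
    using assms by (intro powr_realpow'[symmetric]) auto
  also have "\<dots> = a" using assms by (simp add: powr_powr)
  finally show ?thesis .
qed

lemma integrable_count_space_nonneg_iff:
  fixes g :: "'a \<Rightarrow> real"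
  assumes "\<And>x. 0 \<le> g x"
  shows "integrable (count_space UNIV) g \<longleftrightarrow> g summable_on UNIV"
    and "integral\<^sup>L (count_space UNIV) g = infsum g UNIV"
proof -
  have eq: "Infinite_Sum.abs_summable_on g UNIV \<longleftrightarrow> g summable_on UNIV"
    using assms by simp
  show iff: "integrable (count_space UNIV) g \<longleftrightarrow> g summable_on UNIV"
    using abs_summable_equivalent[of g UNIV] unfolding eq by (simp add: Infinite_Set_Sum.abs_summable_on_def)
  show "integral\<^sup>L (count_space UNIV) g = infsum g UNIV"
  proof (cases "g summable_on UNIV")
    case True
    then have "Infinite_Set_Sum.abs_summable_on g UNIV"
      using abs_summable_equivalent[of g UNIV] eq by simp
    then show ?thesis using infsetsum_infsum[of g UNIV] by (simp add: infsetsum_def)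
  next
    case False
    then show ?thesis using iff by (simp add: infsum_not_exists not_integrable_integral_eq)
  qed
qed

lemma ell_nat_iff:
  fixes f :: "int \<Rightarrow> 'b::{second_countable_topology, real_normed_vector}"
  assumes "0 < p"
  shows "f \<in> ell (real p) \<longleftrightarrow> (\<lambda>k. norm (f k) ^ p) summable_on UNIV"
  unfolding Lp_space_nat_iff[OF assms]
  by (simp add: integrable_count_space_nonneg_iff)

lemma ell_norm_power:
  assumes "0 < p"
  shows "ell_norm (real p) f ^ p = (\<Sum>\<^sub>\<infinity>k. norm (f k) ^ p)"
  unfolding Lp_norm_power[OF assms] by (simp add: integrable_count_space_nonneg_iff)

lemma ell_restrict:
  fixes f :: "int \<Rightarrow> 'b::{second_countable_topology, real_normed_vector}"
  assumes "0 < p" "f \<in> ell (real p)"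
  shows "(\<lambda>k. if k \<in> A then f k else 0) \<in> ell (real p)"
  using assms unfolding ell_nat_iff[OF assms(1)]
  by (elim summable_on_comparison_test) auto

lemma ell_finite_support:
  fixes f :: "int \<Rightarrow> 'b::{second_countable_topology, real_normed_vector}"
  assumes "0 < p" "finite A"
  shows "(\<lambda>k. if k \<in> A then f k else 0) \<in> ell (real p)"
proof -
  have "(\<lambda>k. norm (if k \<in> A then f k else 0) ^ p) summable_on UNIV \<longleftrightarrow> (\<lambda>k. norm (f k) ^ p) summable_on A"
    using assms by (intro summable_on_cong_neutral) auto
  then show ?thesis using assms by (simp add: ell_nat_iff)
qed

lemma ell_tail_small:
  fixes f :: "int \<Rightarrow> 'b::{second_countable_topology, real_normed_vector}"
  assumes p: "0 < p" and f: "f \<in> ell (real p)" and e: "0 < e"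
  obtains A where "finite A" "ell_norm (real p) (\<lambda>k. if k \<in> - A then f k else 0) < e"
proof -
  have s: "(\<lambda>k. norm (f k) ^ p) summable_on UNIV" using f ell_nat_iff[OF p] by blast
  have "((\<lambda>A. \<Sum>k\<in>A. norm (f k) ^ p) \<longlongrightarrow> (\<Sum>\<^sub>\<infinity>k. norm (f k) ^ p)) (finite_subsets_at_top UNIV)"
    using has_sum_infsum[OF s] unfolding has_sum_def .
  moreover have "(\<Sum>\<^sub>\<infinity>k. norm (f k) ^ p) - e ^ p < (\<Sum>\<^sub>\<infinity>k. norm (f k) ^ p)"
    using e by simp
  ultimately have "\<forall>\<^sub>F A in finite_subsets_at_top UNIV. (\<Sum>\<^sub>\<infinity>k. norm (f k) ^ p) - e ^ p < (\<Sum>k\<in>A. norm (f k) ^ p)"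
    by (rule order_tendstoD(1))
  then obtain A where A: "finite A" "(\<Sum>\<^sub>\<infinity>k. norm (f k) ^ p) - e ^ p < (\<Sum>k\<in>A. norm (f k) ^ p)"
    unfolding eventually_finite_subsets_at_top by blast
  have "(\<Sum>\<^sub>\<infinity>k. norm (f k) ^ p) = (\<Sum>\<^sub>\<infinity>k\<in>A. norm (f k) ^ p) + (\<Sum>\<^sub>\<infinity>k\<in>-A. norm (f k) ^ p)"
  proof -
    have "(\<lambda>k. norm (f k) ^ p) summable_on A" "(\<lambda>k. norm (f k) ^ p) summable_on - A"
      by (rule summable_on_subset_banach[OF s], simp)+
    from infsum_Un_disjoint[OF this Compl_disjoint] show ?thesis by (simp only: Compl_partition)
  qed
  also have "(\<Sum>\<^sub>\<infinity>k\<in>-A. norm (f k) ^ p) = (\<Sum>\<^sub>\<infinity>k. norm (if k \<in> - A then f k else 0) ^ p)"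
    by (rule infsum_cong_neutral) (use p in simp_all)
  also have "\<dots> = ell_norm (real p) (\<lambda>k. if k \<in> - A then f k else 0) ^ p"
    by (simp only: ell_norm_power[OF p])
  finally have "ell_norm (real p) (\<lambda>k. if k \<in> - A then f k else 0) ^ p < e ^ p"
    using A by (simp only: infsum_finite)
  then have "ell_norm (real p) (\<lambda>k. if k \<in> - A then f k else 0) < e"
    by (rule power_less_imp_less_base) (use e in simp)
  with A(1) show ?thesis by (rule that)
qed

lemma norm_le_ell_norm:
  fixes f :: "int \<Rightarrow> 'b::{second_countable_topology, real_normed_vector}"
  assumes p: "0 < p" and f: "f \<in> ell (real p)"
  shows "norm (f n) \<le> ell_norm (real p) f"
proof -
  have "norm (f n) ^ p = (\<Sum>k\<in>{n}. norm (f k) ^ p)" by simp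
  also have "\<dots> \<le> (\<Sum>\<^sub>\<infinity>k. norm (f k) ^ p)"
    using f unfolding ell_nat_iff[OF p] by (intro finite_sum_le_infsum) auto
  also have "\<dots> = ell_norm (real p) f ^ p" by (simp only: ell_norm_power[OF p])
  finally show ?thesis by (rule le_of_power_le[OF p Lp_norm_nonneg])
qed

text \<open>On a finite truncation of \<open>f\<close>, which lies in \<open>ell 1\<close>, both
  operators equal \<open>S\<close>. The tail has small norm, and evaluation at a point is bounded by
  the norm. This pins down the operator selected in \<open>arc_piece\<close>.\<close>

lemma bounded_ell_extension_unique:
  assumes T1: "bounded_Lp_extension (count_space UNIV) (real p) B1 (ell 1) S T1"
    and T2: "bounded_Lp_extension (count_space UNIV) (real p) B2 (ell 1) S T2"
    and p: "0 < p" and f: "f \<in> ell (real p)"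
  shows "T1 f (n::int) = T2 f n"
proof -
  have split: "norm (T f n - S (\<lambda>k. if k \<in> A then f k else 0) n) \<le> \<bar>B\<bar> * ell_norm (real p) (\<lambda>k. if k \<in> - A then f k else 0)"
    if T: "bounded_Lp_extension (count_space UNIV) (real p) B (ell 1) S T" and A: "finite A" for T B and A :: "int set"
  proof -
    define g where "g = (\<lambda>k. if k \<in> A then f k else 0)"
    define h where "h = (\<lambda>k. if k \<in> - A then f k else 0)"
    have g: "g \<in> ell (real p)" "g \<in> ell 1" and h: "h \<in> ell (real p)"
      using ell_finite_support[OF p A, of f] ell_finite_support[of 1 A f] A ell_restrict[OF p f, of "- A"]
      by (simp_all add: g_def h_def)
    have fgh: "f = (\<lambda>k. g k + h k)" by (auto simp: g_def h_def)
    have "T (\<lambda>k. g k + h k) n = T g n + T h n" "T g n = S g n"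
      using T g h unfolding bounded_Lp_extension_def by (auto simp: AE_count_space)
    then have eq: "T f n - S g n = T h n" by (simp add: fgh[symmetric])
    have Th: "T h \<in> ell (real p)" "ell_norm (real p) (T h) \<le> B * ell_norm (real p) h"
      using T h unfolding bounded_Lp_extension_def by auto
    have "norm (T h n) \<le> ell_norm (real p) (T h)" by (rule norm_le_ell_norm[OF p Th(1)])
    also have "\<dots> \<le> B * ell_norm (real p) h" by (rule Th)
    also have "\<dots> \<le> \<bar>B\<bar> * ell_norm (real p) h" by (intro mult_right_mono Lp_norm_nonneg) auto
    finally show ?thesis unfolding eq[symmetric] by (simp add: g_def h_def)
  qed
  have small: "norm (T1 f n - T2 f n) \<le> (\<bar>B1\<bar> + \<bar>B2\<bar> + 1) * e" if e: "0 < e" for e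
  proof -
    obtain A where A: "finite A" "ell_norm (real p) (\<lambda>k. if k \<in> - A then f k else 0) < e"
      by (rule ell_tail_small[OF p f e])
    define d where "d = ell_norm (real p) (\<lambda>k. if k \<in> - A then f k else 0)"
    define g where "g = (\<lambda>k. if k \<in> A then f k else 0)"
    have "norm (T1 f n - T2 f n) \<le> norm (T1 f n - S g n) + norm (T2 f n - S g n)"
      using norm_triangle_ineq4[of "T1 f n - S g n" "T2 f n - S g n"] by simp
    also have "\<dots> \<le> \<bar>B1\<bar> * d + \<bar>B2\<bar> * d"
      unfolding d_def g_def by (intro add_mono split[OF T1 A(1)] split[OF T2 A(1)])
    also have "\<dots> = (\<bar>B1\<bar> + \<bar>B2\<bar>) * d" by (simp add: distrib_right)
    also have "\<dots> \<le> (\<bar>B1\<bar> + \<bar>B2\<bar> + 1) * e"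
      using A(2) Lp_norm_nonneg[of "count_space UNIV" "real p"] by (intro mult_mono) (auto simp: d_def)
    finally show ?thesis .
  qed
  have "norm (T1 f n - T2 f n) \<le> 0"
  proof (rule field_le_epsilon)
    fix e :: real assume e: "0 < e"
    define b where "b = \<bar>B1\<bar> + \<bar>B2\<bar> + 1"
    have b: "0 < b" by (simp add: b_def)
    have "norm (T1 f n - T2 f n) \<le> b * (e / b)"
      unfolding b_def by (rule small) (use e b in \<open>simp add: b_def\<close>)
    then show "norm (T1 f n - T2 f n) \<le> 0 + e" using b by simp
  qed
  then show ?thesis by simp
qed

section \<open>Convolution operators from bounds on finite windows\<close>

lemma finite_bound_imp_ell_bound:
  fixes f :: "int \<Rightarrow> complex" and v :: "'j \<Rightarrow> int \<Rightarrow> complex"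
  assumes p: "0 < p" and f: "f \<in> ell (real p)" and A: "0 \<le> A"
    and le: "\<And>S. finite S \<Longrightarrow> (\<Sum>j\<in>J. norm (\<Sum>k\<in>S. f k * v j k) ^ p) \<le> A * (\<Sum>k\<in>S. norm (f k) ^ p)"
    and G: "\<And>j. j \<in> J \<Longrightarrow> ((\<lambda>k. f k * v j k) has_sum G j) UNIV"
  shows "(\<Sum>j\<in>J. norm (G j) ^ p) \<le> A * ell_norm (real p) f ^ p"
proof -
  have "((\<lambda>S. \<Sum>j\<in>J. norm (\<Sum>k\<in>S. f k * v j k) ^ p) \<longlongrightarrow> (\<Sum>j\<in>J. norm (G j) ^ p)) (finite_subsets_at_top UNIV)"
    using G unfolding has_sum_def by (intro tendsto_sum tendsto_power tendsto_norm)
  moreover have "\<forall>\<^sub>F S in finite_subsets_at_top UNIV. (\<Sum>j\<in>J. norm (\<Sum>k\<in>S. f k * v j k) ^ p) \<le> A * ell_norm (real p) f ^ p"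
  proof (rule eventually_finite_subsets_at_top_weakI)
    fix S :: "int set" assume S: "finite S"
    have "(\<Sum>k\<in>S. norm (f k) ^ p) \<le> (\<Sum>\<^sub>\<infinity>k. norm (f k) ^ p)"
      using f S unfolding ell_nat_iff[OF p] by (intro finite_sum_le_infsum) auto
    then have "A * (\<Sum>k\<in>S. norm (f k) ^ p) \<le> A * ell_norm (real p) f ^ p"
      unfolding ell_norm_power[OF p] using A by (intro mult_left_mono) auto
    then show "(\<Sum>j\<in>J. norm (\<Sum>k\<in>S. f k * v j k) ^ p) \<le> A * ell_norm (real p) f ^ p"
      using le[OF S] by linarith
  qed
  ultimately show ?thesis by (rule tendsto_upperbound) simp
qed

text \<open>Choosing the phases of \<open>f\<close> makes all terms nonnegative; hence the finite bounds give absolute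
  convergence.\<close>

lemma convolution_abs_summable:
  fixes f \<kappa> :: "int \<Rightarrow> complex"
  assumes p: "0 < p" and f: "f \<in> ell (real p)" and A: "0 \<le> A"
    and le: "\<And>S N f. finite S \<Longrightarrow> finite N \<Longrightarrow> (\<Sum>n\<in>N. norm (\<Sum>k\<in>S. f k * \<kappa> (n - k)) ^ p) \<le> A * (\<Sum>k\<in>S. norm (f k) ^ p)"
  shows "(\<lambda>k. norm (f k * \<kappa> (n - k))) summable_on UNIV"
proof (rule norm_summable_on_int)
  fix S :: "int set" assume S: "finite S"
  define g where "g k = of_real (norm (f k)) * cnj (sgn (\<kappa> (n - k)))" for k
  have gk: "g k * \<kappa> (n - k) = of_real (norm (f k * \<kappa> (n - k)))" for k
  proof -
    have "cnj (sgn z) * z = of_real (norm z)" for z :: complex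
    proof (cases "z = 0")
      case False
      have "cnj (sgn z) * z = (z * cnj z) / of_real (norm z)" by (simp add: sgn_eq)
      also have "\<dots> = of_real (norm z)" using False by (simp add: complex_norm_square[symmetric] power2_eq_square)
      finally show ?thesis .
    qed simp
    then show ?thesis by (simp add: g_def norm_mult mult.assoc)
  qed
  have gn: "norm (g k) \<le> norm (f k)" for k by (simp add: g_def norm_mult norm_sgn)
  define X where "X = (\<Sum>k\<in>S. norm (f k * \<kappa> (n - k)))"
  have "(\<Sum>k\<in>S. g k * \<kappa> (n - k)) = of_real X" unfolding X_def gk by (simp only: of_real_sum)
  moreover have "0 \<le> X" unfolding X_def by (intro sum_nonneg) auto
  ultimately have "norm (\<Sum>k\<in>S. g k * \<kappa> (n - k)) = X" by (simp only: norm_of_real abs_of_nonneg)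
  then have "X ^ p = (\<Sum>i\<in>{n}. norm (\<Sum>k\<in>S. g k * \<kappa> (i - k)) ^ p)" by simp
  also have "\<dots> \<le> A * (\<Sum>k\<in>S. norm (g k) ^ p)" using S by (intro le) auto
  also have "\<dots> \<le> A * (\<Sum>k\<in>S. norm (f k) ^ p)" using A gn by (intro mult_left_mono sum_mono power_mono) auto
  also have "\<dots> \<le> A * ell_norm (real p) f ^ p"
    unfolding ell_norm_power[OF p] using A f[unfolded ell_nat_iff[OF p]] S
    by (intro mult_left_mono finite_sum_le_infsum) auto
  also have "\<dots> = (A powr (1 / real p) * ell_norm (real p) f) ^ p"
    by (simp only: power_mult_distrib powr_root_power[OF p A])
  finally show "X \<le> A powr (1 / real p) * ell_norm (real p) f"
    by (rule le_of_power_le[OF p mult_nonneg_nonneg[OF powr_ge_zero Lp_norm_nonneg]])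
qed

lemma ell_convolution_bound:
  fixes f \<kappa> :: "int \<Rightarrow> complex"
  assumes p: "0 < p" and f: "f \<in> ell (real p)" and A: "0 \<le> A"
    and le: "\<And>S N f. finite S \<Longrightarrow> finite N \<Longrightarrow> (\<Sum>n\<in>N. norm (\<Sum>k\<in>S. f k * \<kappa> (n - k)) ^ p) \<le> A * (\<Sum>k\<in>S. norm (f k) ^ p)"
  defines "T \<equiv> (\<lambda>f n. \<Sum>\<^sub>\<infinity>k. f k * \<kappa> (n - k))"
  shows "((\<lambda>k. f k * \<kappa> (n - k)) has_sum T f n) UNIV"
    and "T f \<in> ell (real p)"
    and "ell_norm (real p) (T f) \<le> A powr (1 / real p) * ell_norm (real p) f"
proof -
  show hs: "((\<lambda>k. f k * \<kappa> (n - k)) has_sum T f n) UNIV" for n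
    unfolding T_def
    by (rule has_sum_infsum, rule abs_summable_summable, rule convolution_abs_summable[OF p f A]) (rule le)
  have fin: "(\<Sum>n\<in>N. norm (T f n) ^ p) \<le> A * ell_norm (real p) f ^ p" if "finite N" for N
    by (rule finite_bound_imp_ell_bound[OF p f A, where v="\<lambda>n k. \<kappa> (n - k)"]) (rule le that hs | assumption)+
  have s: "(\<lambda>n. norm (T f n) ^ p) summable_on UNIV"
  proof (rule nonneg_bdd_above_summable_on)
    show "bdd_above (sum (\<lambda>n. norm (T f n) ^ p) ` {F. F \<subseteq> UNIV \<and> finite F})"
      using fin by (intro bdd_aboveI[of _ "A * ell_norm (real p) f ^ p"]) auto
  qed simp
  then show "T f \<in> ell (real p)" using ell_nat_iff[OF p] by blast
  have "ell_norm (real p) (T f) ^ p \<le> A * ell_norm (real p) f ^ p"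
    unfolding ell_norm_power[OF p, of "T f"] by (rule infsum_le_finite_sums[OF s]) (rule fin)
  also have "\<dots> = (A powr (1 / real p) * ell_norm (real p) f) ^ p"
    by (simp only: power_mult_distrib powr_root_power[OF p A])
  finally show "ell_norm (real p) (T f) \<le> A powr (1 / real p) * ell_norm (real p) f"
    by (rule le_of_power_le[OF p mult_nonneg_nonneg[OF powr_ge_zero Lp_norm_nonneg]])
qed

lemma convolution_bounded_Lp_extension:
  fixes \<kappa> :: "int \<Rightarrow> complex"
  assumes p: "0 < p" and A: "0 \<le> A"
    and le: "\<And>S N f. finite S \<Longrightarrow> finite N \<Longrightarrow> (\<Sum>n\<in>N. norm (\<Sum>k\<in>S. f k * \<kappa> (n - k)) ^ p) \<le> A * (\<Sum>k\<in>S. norm (f k) ^ p)"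
    and S: "\<And>f n. f \<in> ell 1 \<Longrightarrow> ((\<lambda>k. f k * \<kappa> (n - k)) has_sum S f n) UNIV"
  shows "bounded_Lp_extension (count_space UNIV) (real p) (A powr (1 / real p)) (ell 1) S (\<lambda>f n. \<Sum>\<^sub>\<infinity>k. f k * \<kappa> (n - k))"
proof -
  define T where "T = (\<lambda>f n. \<Sum>\<^sub>\<infinity>k. f k * \<kappa> (n - k))"
  have conv: "((\<lambda>k. f k * \<kappa> (n - k)) has_sum T f n) UNIV" "T f \<in> ell (real p)"
    "ell_norm (real p) (T f) \<le> A powr (1 / real p) * ell_norm (real p) f" if "f \<in> ell (real p)" for f n
    unfolding T_def by (rule ell_convolution_bound[OF p that A], rule le, assumption+)+
  have "T (\<lambda>y. f y + g y) x = T f x + T g x" if "f \<in> ell (real p)" "g \<in> ell (real p)" for f g x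
    using infsumI[OF has_sum_add[OF conv(1)[OF that(1), of x] conv(1)[OF that(2), of x]]]
    by (simp only: T_def distrib_right)
  moreover have "T (\<lambda>y. c * f y) x = c * T f x" for c f x
    by (simp add: T_def mult.assoc infsum_cmult_right')
  moreover have "T f x = S f x" if "f \<in> ell 1" for f x
    unfolding T_def by (rule infsumI) (rule S[OF that])
  ultimately show ?thesis
    unfolding T_def[symmetric] bounded_Lp_extension_def AE_count_space
    by (intro conjI ballI allI conv(2,3)) (assumption | simp)+
qed

section \<open>The pieces of the theorem as convolutions\<close>

lemma arc_piece_ell1_has_sum:
  fixes m :: "real \<Rightarrow> complex" and \<epsilon> \<theta> :: real
  assumes m: "m \<in> borel_measurable lebesgue" "bounded (range m)" "{x. m x \<noteq> 0} \<subseteq> {-1/2<..1/2}"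
    and \<epsilon>: "0 < \<epsilon>" "\<epsilon> \<le> \<theta>" "\<theta> \<le> 1 - \<epsilon>" and f: "f \<in> ell 1"
  shows "((\<lambda>k. f k * (e2pi (of_int (n - k) * \<theta>) * multiplier_kernel m \<epsilon> (n - k)))
    has_sum arc_piece_ell1 m \<epsilon> \<theta> f n) UNIV"
proof (rule has_sum_int_symmetric)
  let ?K = "\<lambda>k. e2pi (of_int (n - k) * \<theta>) * multiplier_kernel m \<epsilon> (n - k)"
  obtain m' C where m': "m' \<in> borel_measurable borel" "\<And>x. norm (m' x) \<le> C" "{x. m' x \<noteq> 0} \<subseteq> {-1/2<..1/2}"
    and ae: "AE x in lebesgue. m x = m' x" and K: "\<And>x. inv_fourier m x = (LBINT \<xi>. m' \<xi> * e2pi (x * \<xi>))"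
    by (rule inv_fourier_borel_representative[OF m]) blast
  note [measurable] = m'(1)
  have Kb: "norm (inv_fourier m x) \<le> C" for x unfolding K by (rule norm_inv_fourier_le(2)[OF m'])
  have fs: "(\<lambda>k. norm (f k)) summable_on UNIV" using f ell_nat_iff[of 1 f] by simp
  define D where "D = (\<Sum>\<^sub>\<infinity>k. norm (f k))"
  have D: "(\<Sum>k\<in>F. norm (f k)) \<le> D" if "finite F" for F
    unfolding D_def using fs that by (intro finite_sum_le_infsum) auto
  show "(\<lambda>k. norm (f k * ?K k)) summable_on UNIV"
  proof (rule norm_summable_on_int)
    fix F :: "int set" assume F: "finite F"
    have "(\<Sum>k\<in>F. norm (f k * ?K k)) \<le> (\<Sum>k\<in>F. norm (f k) * (\<epsilon> * C))"
      using \<epsilon> Kb by (intro sum_mono) (auto simp: norm_mult intro!: mult_left_mono)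
    also have "\<dots> \<le> D * (\<epsilon> * C)"
      unfolding sum_distrib_right[symmetric] using \<epsilon> D[OF F] order_trans[OF norm_ge_zero Kb]
      by (intro mult_right_mono) auto
    finally show "(\<Sum>k\<in>F. norm (f k * ?K k)) \<le> D * (\<epsilon> * C)" .
  qed
  define P where "P N \<xi> = (\<Sum>k\<in>{- int N..int N}. f k * e2pi (- (of_int k * \<xi>)))" for N \<xi>
  have Pm[measurable]: "P N \<in> borel_measurable borel" for N unfolding P_def by measurable
  have Pb: "norm (P N \<xi>) \<le> D" for N \<xi>
    unfolding P_def by (rule order_trans[OF norm_sum]) (simp add: norm_mult D)
  have Plim: "(\<lambda>N. P N \<xi>) \<longlonglongrightarrow> fourier_series f \<xi>" for \<xi>
  proof -
    have "(\<lambda>k. f k * e2pi (- (of_int k * \<xi>))) summable_on UNIV"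
      by (rule abs_summable_summable) (simp add: norm_mult fs)
    from has_sum_int_imp_symmetric[OF has_sum_infsum[OF this]]
    show ?thesis by (simp add: P_def fourier_series_def e2pi_def mult_ac)
  qed
  have fsm[measurable]: "fourier_series f \<in> borel_measurable borel"
    by (rule borel_measurable_LIMSEQ_metric[OF Pm Plim])
  define \<mu> where "\<mu> \<xi> = m' ((\<xi> - \<theta>) / \<epsilon>)" for \<xi>
  have [measurable]: "\<mu> \<in> borel_measurable borel" unfolding \<mu>_def by measurable
  have half: "\<bar>y\<bar> \<le> 1/2" if "y \<in> {-1/2<..1/2}" for y :: real using that by auto
  have supp: "\<xi> \<in> {0..1}" if "(\<xi> - \<theta>) / \<epsilon> \<in> {-1/2<..1/2}" for \<xi>
  proof -
    from half[OF that] have "\<bar>(\<xi> - \<theta>) / \<epsilon>\<bar> \<le> 1/2" .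
    then have "\<bar>\<xi> - \<theta>\<bar> \<le> \<epsilon> / 2" using \<epsilon> by (simp add: field_simps)
    then have "0 \<le> \<xi>" "\<xi> \<le> 1" using \<epsilon> by linarith+
    then show ?thesis by simp
  qed
  \<comment> \<open>Because \<theta> keeps distance \<epsilon> from 0 and 1, only the translate l =
    0 of the arc meets the interval of integration.\<close>
  have shift0: "m ((\<xi> - of_int l - \<theta>) / \<epsilon>) = 0" if "\<xi> \<in> {0..1}" "l \<noteq> 0" for \<xi> l
  proof (rule ccontr)
    assume "m ((\<xi> - of_int l - \<theta>) / \<epsilon>) \<noteq> 0"
    then have "(\<xi> - of_int l - \<theta>) / \<epsilon> \<in> {-1/2<..1/2}" using m(3) by blast
    from half[OF this] have "\<bar>(\<xi> - of_int l - \<theta>) / \<epsilon>\<bar> \<le> 1/2" .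
    then have "\<bar>\<xi> - of_int l - \<theta>\<bar> \<le> \<epsilon> / 2" using \<epsilon> by (simp add: field_simps)
    moreover have "real_of_int l \<le> -1 \<or> 1 \<le> real_of_int l" using that(2) by linarith
    ultimately show False using that(1) \<epsilon> by auto
  qed
  have ae\<mu>: "AE \<xi> in lebesgue. m ((\<xi> - \<theta>) / \<epsilon>) = \<mu> \<xi>"
  proof -
    have "{x. m x \<noteq> m' x} \<in> null_sets lebesgue"
    proof -
      obtain X where "{x \<in> space lebesgue. \<not> m x = m' x} \<subseteq> X" "X \<in> null_sets lebesgue"
        using ae by (auto elim!: AE_E simp: null_sets_def)
      then show ?thesis using null_sets_completion_subset[of "{x. m x \<noteq> m' x}" X lborel] by simp
    qed
    \<comment> \<open>The exceptional set is enclosed in a Borel null set, which can be pulled back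
      along the affine map.\<close>
    then obtain X where X: "X \<in> null_sets lborel" "{x. m x \<noteq> m' x} \<subseteq> X"
      unfolding null_sets_completion_iff2 by blast
    have [measurable]: "X \<in> sets borel" using X(1) by auto
    have "AE x in lborel. x \<notin> X" by (rule AE_not_in[OF X(1)])
    then have "AE x in lborel. - \<theta> / \<epsilon> + (1 / \<epsilon>) * x \<notin> X"
      using \<epsilon> by (intro AE_borel_affine) auto
    then have "AE x in lborel. m ((x - \<theta>) / \<epsilon>) = \<mu> x"
    proof eventually_elim
      case (elim x)
      have "- \<theta> / \<epsilon> + (1 / \<epsilon>) * x = (x - \<theta>) / \<epsilon>" by (simp add: diff_divide_distrib)
      then show ?case using elim X(2) by (auto simp: \<mu>_def)
    qed
    then show ?thesis by (rule AE_completion)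
  qed
  have "arc_piece_ell1 m \<epsilon> \<theta> f n = (LINT \<xi>|lebesgue. m ((\<xi> - \<theta>) / \<epsilon>) * fourier_series f \<xi> * e2pi (of_int n * \<xi>))"
    unfolding arc_piece_ell1_def set_lebesgue_integral_def
  proof (intro Bochner_Integration.integral_cong refl)
    fix \<xi>
    show "indicat_real {0..1} \<xi> *\<^sub>R ((\<Sum>\<^sub>\<infinity>l. m ((\<xi> - of_int l - \<theta>) / \<epsilon>) * fourier_series f \<xi>) * cis (2 * pi * of_int n * \<xi>)) =
      m ((\<xi> - \<theta>) / \<epsilon>) * fourier_series f \<xi> * e2pi (of_int n * \<xi>)"
    proof (cases "\<xi> \<in> {0..1}")
      case True
      have "(\<Sum>\<^sub>\<infinity>l. m ((\<xi> - of_int l - \<theta>) / \<epsilon>) * fourier_series f \<xi>) = (\<Sum>\<^sub>\<infinity>l\<in>{0::int}. m ((\<xi> - of_int l - \<theta>) / \<epsilon>) * fourier_series f \<xi>)"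
        using shift0[OF True] by (intro infsum_cong_neutral) auto
      then show ?thesis using True by (simp add: e2pi_def mult_ac)
    next
      case False
      have "m ((\<xi> - \<theta>) / \<epsilon>) = 0" using supp[of \<xi>] False subsetD[OF m(3), of "(\<xi> - \<theta>) / \<epsilon>"] by blast
      then show ?thesis using False by simp
    qed
  qed
  also have "\<dots> = (LINT \<xi>|lebesgue. \<mu> \<xi> * fourier_series f \<xi> * e2pi (of_int n * \<xi>))"
  proof (rule integral_cong_AE)
    have 1: "(\<lambda>\<xi>. \<mu> \<xi> * fourier_series f \<xi> * e2pi (of_int n * \<xi>)) \<in> borel_measurable lebesgue"
      by (intro measurable_completion) measurable
    then show "(\<lambda>\<xi>. \<mu> \<xi> * fourier_series f \<xi> * e2pi (of_int n * \<xi>)) \<in> borel_measurable lebesgue" .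
    show "AE \<xi> in lebesgue. m ((\<xi> - \<theta>) / \<epsilon>) * fourier_series f \<xi> * e2pi (of_int n * \<xi>) = \<mu> \<xi> * fourier_series f \<xi> * e2pi (of_int n * \<xi>)"
      using ae\<mu> by eventually_elim simp
    have "(\<lambda>x::real. - \<theta> / \<epsilon> + 1 / \<epsilon> * x) \<in> lebesgue \<rightarrow>\<^sub>M lebesgue"
      using lebesgue_affine_measurable[where c="\<lambda>x::real. 1 / \<epsilon>" and t="- \<theta> / \<epsilon>"] \<epsilon> by simp
    from measurable_compose[OF this m(1)] have [measurable]: "(\<lambda>\<xi>. m ((\<xi> - \<theta>) / \<epsilon>)) \<in> borel_measurable lebesgue"
      by (simp add: diff_divide_distrib)
    have [measurable]: "(\<lambda>\<xi>. fourier_series f \<xi> * e2pi (of_int n * \<xi>)) \<in> borel_measurable lebesgue"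
      by (intro measurable_completion) measurable
    have "(\<lambda>\<xi>. m ((\<xi> - \<theta>) / \<epsilon>) * (fourier_series f \<xi> * e2pi (of_int n * \<xi>))) \<in> borel_measurable lebesgue"
      by measurable
    then show "(\<lambda>\<xi>. m ((\<xi> - \<theta>) / \<epsilon>) * fourier_series f \<xi> * e2pi (of_int n * \<xi>)) \<in> borel_measurable lebesgue"
      by (simp only: mult.assoc)
  qed
  also have "\<dots> = (LBINT \<xi>. \<mu> \<xi> * fourier_series f \<xi> * e2pi (of_int n * \<xi>))"
    by (intro integral_completion) measurable
  finally have piece: "arc_piece_ell1 m \<epsilon> \<theta> f n = (LBINT \<xi>. \<mu> \<xi> * fourier_series f \<xi> * e2pi (of_int n * \<xi>))" .
  have \<mu>b: "norm (\<mu> \<xi>) \<le> C" for \<xi> by (simp add: \<mu>_def m')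
  have \<mu>s: "\<mu> \<xi> = 0" if "\<xi> \<notin> {0..1}" for \<xi>
    using supp[of \<xi>] that subsetD[OF m'(3), of "(\<xi> - \<theta>) / \<epsilon>"] by (auto simp: \<mu>_def)
  have i\<mu>: "integrable lborel (\<lambda>\<xi>. norm (\<mu> \<xi>))"
    by (rule integrable_bounded_support[where C=C and a=0 and b=1]) (use \<mu>b \<mu>s in auto)
  have i\<mu>e: "integrable lborel (\<lambda>\<xi>. \<mu> \<xi> * e2pi (y * \<xi>))" for y
    by (rule Bochner_Integration.integrable_bound[OF i\<mu>]) (auto simp: norm_mult)
  have K\<mu>: "(LBINT \<xi>. \<mu> \<xi> * e2pi (y * \<xi>)) = e2pi (y * \<theta>) * (of_real \<epsilon> * inv_fourier m (\<epsilon> * y))" for y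
  proof -
    have "(LBINT \<xi>. \<mu> \<xi> * e2pi (y * \<xi>)) = \<epsilon> *\<^sub>R (LBINT \<xi>. \<mu> (\<theta> + \<epsilon> * \<xi>) * e2pi (y * (\<theta> + \<epsilon> * \<xi>)))"
      using \<epsilon> by (subst lborel_integral_real_affine[of \<epsilon> _ \<theta>]) auto
    also have "(\<lambda>\<xi>. \<mu> (\<theta> + \<epsilon> * \<xi>) * e2pi (y * (\<theta> + \<epsilon> * \<xi>))) = (\<lambda>\<xi>. e2pi (y * \<theta>) * (m' \<xi> * e2pi (\<epsilon> * y * \<xi>)))"
      using \<epsilon> by (simp add: \<mu>_def fun_eq_iff distrib_left e2pi_add mult_ac)
    finally show ?thesis unfolding integral_mult_right_zero K scaleR_conv_of_real
      by (simp only: mult.left_commute)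
  qed
  have eq: "(\<Sum>k\<in>{- int N..int N}. f k * ?K k) =
    (LBINT \<xi>. \<mu> \<xi> * P N \<xi> * e2pi (of_int n * \<xi>))" for N
  proof -
    have "(\<Sum>k\<in>{- int N..int N}. f k * ?K k) =
      (\<Sum>k\<in>{- int N..int N}. LBINT \<xi>. f k * (\<mu> \<xi> * e2pi (of_int (n - k) * \<xi>)))"
      by (simp only: K\<mu>[symmetric] integral_mult_right_zero)
    also have "\<dots> = (LBINT \<xi>. (\<Sum>k\<in>{- int N..int N}. f k * (\<mu> \<xi> * e2pi (of_int (n - k) * \<xi>))))"
      by (intro Bochner_Integration.integral_sum[symmetric] integrable_mult_right i\<mu>e)
    also have "\<dots> = (LBINT \<xi>. \<mu> \<xi> * P N \<xi> * e2pi (of_int n * \<xi>))"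
    proof (intro Bochner_Integration.integral_cong refl)
      fix \<xi>
      have "e2pi (of_int (n - k) * \<xi>) = e2pi (- (of_int k * \<xi>)) * e2pi (of_int n * \<xi>)" for k
        by (simp add: left_diff_distrib flip: e2pi_add)
      then show "(\<Sum>k\<in>{- int N..int N}. f k * (\<mu> \<xi> * e2pi (of_int (n - k) * \<xi>))) = \<mu> \<xi> * P N \<xi> * e2pi (of_int n * \<xi>)"
        by (simp add: P_def sum_distrib_left sum_distrib_right mult_ac)
    qed
    finally show ?thesis .
  qed
  show "(\<lambda>N. \<Sum>k\<in>{- int N..int N}. f k * ?K k) \<longlonglongrightarrow>
    arc_piece_ell1 m \<epsilon> \<theta> f n"
    unfolding eq piece
  proof (rule integral_dominated_convergence[where w="\<lambda>\<xi>. norm (\<mu> \<xi>) * D"])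
    show "AE \<xi> in lborel. (\<lambda>N. \<mu> \<xi> * P N \<xi> * e2pi (of_int n * \<xi>)) \<longlonglongrightarrow> \<mu> \<xi> * fourier_series f \<xi> * e2pi (of_int n * \<xi>)"
      by (intro always_eventually allI tendsto_intros Plim)
    show "AE \<xi> in lborel. norm (\<mu> \<xi> * P N \<xi> * e2pi (of_int n * \<xi>)) \<le> norm (\<mu> \<xi>) * D" for N
      by (auto simp: norm_mult intro!: mult_left_mono Pb)
  qed (use i\<mu> in auto)
qed

text \<open>Transference provides one bounded extension, namely the convolution. Its existence turns
  the choice in \<open>arc_piece\<close> into a genuine extension, and uniqueness identifies the
  two.\<close>

lemma arc_piece_has_sum:
  fixes m :: "real \<Rightarrow> complex" and \<epsilon> \<theta> :: real
  assumes m: "Lp_multiplier (real p) B m" "{x. m x \<noteq> 0} \<subseteq> {-1/2<..1/2}"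
    and \<epsilon>: "0 < \<epsilon>" "\<epsilon> \<le> \<theta>" "\<theta> \<le> 1 - \<epsilon>" and p: "0 < p" and f: "f \<in> ell (real p)"
  shows "((\<lambda>k. f k * (e2pi (of_int (n - k) * \<theta>) * multiplier_kernel m \<epsilon> (n - k)))
    has_sum arc_piece (real p) m \<epsilon> \<theta> f n) UNIV"
proof -
  have mm: "m \<in> borel_measurable lebesgue" "bounded (range m)"
    using m(1) unfolding Lp_multiplier_def by auto
  define \<kappa> where "\<kappa> j = e2pi (of_int j * \<theta>) * multiplier_kernel m \<epsilon> j" for j :: int
  define A where "A = transference_const p B"
  have A: "0 \<le> A" by (simp add: A_def transference_const_nonneg)
  have le: "(\<Sum>n\<in>N. norm (\<Sum>k\<in>S. f k * \<kappa> (n - k)) ^ p) \<le> A * (\<Sum>k\<in>S. norm (f k) ^ p)"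
    if S: "finite S" and N: "finite N" for S N :: "int set" and f
  proof -
    \<comment> \<open>Modulation moves the frequency \<theta> to 0 without changing any modulus, so
      the bound for the multiplier itself applies.\<close>
    define g where "g k = f k * e2pi (- (of_int k * \<theta>))" for k
    have "f k * \<kappa> (n - k) = e2pi (of_int n * \<theta>) * (g k * multiplier_kernel m \<epsilon> (n - k))" for n k
    proof -
      have "e2pi (of_int (n - k) * \<theta>) = e2pi (- (of_int k * \<theta>)) * e2pi (of_int n * \<theta>)"
        by (simp add: left_diff_distrib flip: e2pi_add)
      then show ?thesis by (simp add: \<kappa>_def g_def mult_ac)
    qed
    then have "norm (\<Sum>k\<in>S. f k * \<kappa> (n - k)) = norm (\<Sum>k\<in>S. g k * multiplier_kernel m \<epsilon> (n - k))" for n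
      by (simp only: sum_distrib_left[symmetric] norm_mult norm_e2pi mult_1)
    then have "(\<Sum>n\<in>N. norm (\<Sum>k\<in>S. f k * \<kappa> (n - k)) ^ p) \<le> transference_const p B * (\<Sum>k\<in>S. norm (g k) ^ p)"
      using multiplier_transference[OF m p \<epsilon>(1) _ S N, of g] \<epsilon> by simp
    then show ?thesis by (simp add: g_def A_def norm_mult)
  qed
  have ext: "bounded_Lp_extension (count_space UNIV) (real p) (A powr (1 / real p)) (ell 1) (arc_piece_ell1 m \<epsilon> \<theta>) (\<lambda>f n. \<Sum>\<^sub>\<infinity>k. f k * \<kappa> (n - k))"
  proof (rule convolution_bounded_Lp_extension[OF p A])
    show "((\<lambda>k. f k * \<kappa> (n - k)) has_sum arc_piece_ell1 m \<epsilon> \<theta> f n) UNIV" if "f \<in> ell 1" for f n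
      unfolding \<kappa>_def by (rule arc_piece_ell1_has_sum[OF mm m(2) \<epsilon> that])
  qed (rule le)
  obtain B' where ext': "bounded_Lp_extension (count_space UNIV) (real p) B' (ell 1) (arc_piece_ell1 m \<epsilon> \<theta>) (arc_piece (real p) m \<epsilon> \<theta>)"
    using someI_ex[of "\<lambda>T. \<exists>B. bounded_Lp_extension (count_space UNIV) (real p) B (ell 1) (arc_piece_ell1 m \<epsilon> \<theta>) T"] ext
    unfolding arc_piece_def by blast
  have "arc_piece (real p) m \<epsilon> \<theta> f n = (\<Sum>\<^sub>\<infinity>k. f k * \<kappa> (n - k))"
    by (rule bounded_ell_extension_unique[OF ext' ext p f])
  then show ?thesis
    using ell_convolution_bound(1)[OF p f A, of \<kappa> n] le by (simp only: \<kappa>_def)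
qed

lemma reduced_fractions_eq_image: "reduced_fractions q = (\<lambda>a. real a / real q) ` reduced_residues q"
  by (auto simp: reduced_fractions_def reduced_residues_def)

lemma arc_piece_square_function_le:
  fixes m :: "real \<Rightarrow> complex" and Z :: "nat set" and \<epsilon> :: real
  assumes m: "Lp_multiplier (real p) B m" "{x. m x \<noteq> 0} \<subseteq> {-1/2<..1/2}"
    and Z: "finite Z" "\<And>q. q \<in> Z \<Longrightarrow> 2 \<le> q"
    and \<epsilon>: "0 < \<epsilon>" "\<And>q q'. q \<in> Z \<Longrightarrow> q' \<in> Z \<Longrightarrow> \<epsilon> * (real q * real q') < 1"
    and p: "2 \<le> p" and N: "finite N" and f: "f \<in> ell (real p)"
  shows "(\<Sum>n\<in>N. \<Sum>q\<in>Z. norm (\<Sum>\<theta>\<in>reduced_fractions q. arc_piece (real p) m \<epsilon> \<theta> f n) ^ p) \<le>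
    transference_const p B * (16 * (18 * pi * 2 ^ max_prime_divisors Z) ^ (p - 2)) * ell_norm (real p) f ^ p"
proof -
  define v where "v = (\<lambda>q n. arc_sum (reduced_residues q) q n * multiplier_kernel m \<epsilon> n)"
  define G where "G q n = (\<Sum>\<theta>\<in>reduced_fractions q. arc_piece (real p) m \<epsilon> \<theta> f n)" for q n
  define A where "A = transference_const p B * (16 * (18 * pi * 2 ^ max_prime_divisors Z) ^ (p - 2))"
  have A: "0 \<le> A" unfolding A_def using transference_const_nonneg by (intro mult_nonneg_nonneg) auto
  have p0: "0 < p" using p by simp
  have hs: "((\<lambda>k. f k * v q (n - k)) has_sum G q n) UNIV" if q: "q \<in> Z" for q n
  proof -
    have q2: "2 \<le> q" using Z q by auto
    note th = reduced_fraction_bounds[OF q2 \<epsilon>(1) \<epsilon>(2)[OF q q]]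
    have inj: "inj_on (\<lambda>a. real a / real q) (reduced_residues q)"
      using q2 by (auto simp: inj_on_def)
    have "((\<lambda>F. \<Sum>a\<in>reduced_residues q. \<Sum>k\<in>F. f k * (e2pi (of_int (n - k) * (real a / real q)) * multiplier_kernel m \<epsilon> (n - k)))
      \<longlongrightarrow> (\<Sum>a\<in>reduced_residues q. arc_piece (real p) m \<epsilon> (real a / real q) f n)) (finite_subsets_at_top UNIV)"
      by (intro tendsto_sum arc_piece_has_sum[unfolded has_sum_def, OF m \<epsilon>(1) th p0 f])
    moreover have "(\<lambda>F. \<Sum>a\<in>reduced_residues q. \<Sum>k\<in>F. f k * (e2pi (of_int (n - k) * (real a / real q)) * multiplier_kernel m \<epsilon> (n - k)))
      = sum (\<lambda>k. f k * v q (n - k))"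
      by (rule ext, subst sum.swap) (simp add: v_def arc_sum_def sum_distrib_left sum_distrib_right)
    moreover have "(\<Sum>a\<in>reduced_residues q. arc_piece (real p) m \<epsilon> (real a / real q) f n) = G q n"
      unfolding G_def reduced_fractions_eq_image by (subst sum.reindex[OF inj]) simp
    ultimately show ?thesis by (simp only: has_sum_def)
  qed
  have "(\<Sum>j\<in>Z \<times> N. norm (G (fst j) (snd j)) ^ p) \<le> A * ell_norm (real p) f ^ p"
  proof (rule finite_bound_imp_ell_bound[OF p0 f A])
    show "((\<lambda>k. f k * v (fst j) (snd j - k)) has_sum G (fst j) (snd j)) UNIV" if "j \<in> Z \<times> N" for j
      using that by (intro hs) auto
    show "(\<Sum>j\<in>Z \<times> N. norm (\<Sum>k\<in>S. f k * v (fst j) (snd j - k)) ^ p) \<le> A * (\<Sum>k\<in>S. norm (f k) ^ p)"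
      if "finite S" for S
      using arc_square_function_le[OF m Z \<epsilon> that N p, of f]
      by (simp add: sum.cartesian_product split_def v_def A_def)
  qed
  then have "(\<Sum>q\<in>Z. \<Sum>n\<in>N. norm (G q n) ^ p) \<le> A * ell_norm (real p) f ^ p"
    by (simp add: sum.cartesian_product split_def)
  then show ?thesis by (subst sum.swap) (simp only: G_def A_def)
qed

theorem proposition5p6:
  fixes r :: nat and B :: real
  assumes "r \<ge> 1"
  shows "\<exists>C::real. \<forall>(m :: real \<Rightarrow> complex) (Z :: nat set) (qZ :: real) (\<epsilon> :: real).
    Lp_multiplier (2 * real r) B m \<and> {x. m x \<noteq> 0} \<subseteq> {-1/2<..1/2} \<and>
    finite Z \<and> real ` Z \<subseteq> {1<..qZ} \<and> 0 < \<epsilon> \<and> \<epsilon> < 1 / qZ ^ 2 \<longrightarrow>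
    (\<forall>f \<in> ell (2 * real r).
      let F = (\<lambda>n::int. (\<Sum>q\<in>Z. norm (\<Sum>\<theta>\<in>reduced_fractions q.
                 arc_piece (2 * real r) m \<epsilon> \<theta> f n) ^ (2 * r)) powr (1 / (2 * real r)))
      in F \<in> ell (2 * real r) \<and>
         ell_norm (2 * real r) F
           \<le> C * (2 ^ max_prime_divisors Z) powr (1 - 1 / real r) * ell_norm (2 * real r) f)"
proof -
  define p where "p = 2 * r"
  have p: "2 \<le> p" "0 < p" "2 * real r = real p" using assms by (auto simp: p_def)
  \<comment> \<open>The constant of \<open>arc_piece_square_function_le\<close> without its power of
    2^\<Omega>; it depends on r and \<open>B\<close> alone, and its p-th root is the
    witness.\<close>
  define D where "D = transference_const p B * (16 * (18 * pi) ^ (p - 2))"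
  have D: "0 \<le> D" unfolding D_def using transference_const_nonneg by (intro mult_nonneg_nonneg) auto
  have "F \<in> ell (real p) \<and> ell_norm (real p) F \<le> D powr (1 / real p) * (2 ^ max_prime_divisors Z) powr (1 - 1 / real r) * ell_norm (real p) f"
    if m: "Lp_multiplier (real p) B m" "{x. m x \<noteq> 0} \<subseteq> {-1/2<..1/2}" and Z: "finite Z" "real ` Z \<subseteq> {1<..qZ}"
      and \<epsilon>: "0 < \<epsilon>" "\<epsilon> < 1 / qZ ^ 2" and f: "f \<in> ell (real p)"
      and F: "F = (\<lambda>n::int. (\<Sum>q\<in>Z. norm (\<Sum>\<theta>\<in>reduced_fractions q. arc_piece (real p) m \<epsilon> \<theta> f n) ^ p) powr (1 / real p))"
    for m :: "real \<Rightarrow> complex" and Z :: "nat set" and qZ \<epsilon> :: real and f and F :: "int \<Rightarrow> real"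
  proof -
    define W :: real where "W = 2 ^ max_prime_divisors Z"
    have W: "0 < W" by (simp add: W_def)
    have q2: "2 \<le> q" if "q \<in> Z" for q
      using Z(2) that by fastforce
    have gap: "\<epsilon> * (real q * real q') < 1" if "q \<in> Z" "q' \<in> Z" for q q'
    proof -
      have q: "1 < real q" "real q \<le> qZ" "1 < real q'" "real q' \<le> qZ" using Z(2) that by auto
      have "real q * real q' \<le> qZ * qZ" using q by (intro mult_mono) auto
      then have "\<epsilon> * (real q * real q') \<le> \<epsilon> * qZ ^ 2" using \<epsilon>(1) by (simp add: power2_eq_square)
      also have "\<dots> < 1" using \<epsilon>(2) q by (simp add: field_simps)
      finally show ?thesis .
    qed
    define X where "X n = (\<Sum>q\<in>Z. norm (\<Sum>\<theta>\<in>reduced_fractions q. arc_piece (real p) m \<epsilon> \<theta> f n) ^ p)" for n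
    have X0: "0 \<le> X n" for n unfolding X_def by (intro sum_nonneg) auto
    have FX: "norm (F n) ^ p = X n" for n
      using powr_root_power[OF p(2) X0[of n]] by (simp add: F X_def[symmetric])
    have fin: "(\<Sum>n\<in>N. norm (F n) ^ p) \<le> D * W ^ (p - 2) * ell_norm (real p) f ^ p" if "finite N" for N
      using arc_piece_square_function_le[OF m Z(1) q2 \<epsilon>(1) gap p(1) that f]
      unfolding FX by (simp add: X_def D_def W_def power_mult_distrib mult_ac)
    have s: "(\<lambda>n. norm (F n) ^ p) summable_on UNIV"
    proof (rule nonneg_bdd_above_summable_on)
      show "bdd_above (sum (\<lambda>n. norm (F n) ^ p) ` {N. N \<subseteq> UNIV \<and> finite N})"
        using fin by (intro bdd_aboveI[of _ "D * W ^ (p - 2) * ell_norm (real p) f ^ p"]) auto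
    qed simp
    \<comment> \<open>The exponents match because (1 - 1/r) 2r = 2r - 2 = p - 2.\<close>
    have W_pow: "(W powr (1 - 1 / real r)) ^ p = W ^ (p - 2)"
    proof -
      have "(W powr (1 - 1 / real r)) ^ p = W powr ((1 - 1 / real r) * real p)"
        using W p by (simp add: powr_powr flip: powr_realpow)
      also have "(1 - 1 / real r) * real p = real (p - 2)"
        using assms by (simp add: p_def field_simps of_nat_diff)
      finally show ?thesis using W by (simp add: powr_realpow)
    qed
    have "ell_norm (real p) F ^ p \<le> D * W ^ (p - 2) * ell_norm (real p) f ^ p"
      unfolding ell_norm_power[OF p(2), of F] by (rule infsum_le_finite_sums[OF s]) (rule fin)
    also have "\<dots> = (D powr (1 / real p) * W powr (1 - 1 / real r) * ell_norm (real p) f) ^ p"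
    proof -
      show ?thesis by (simp only: power_mult_distrib W_pow powr_root_power[OF p(2) D])
    qed
    finally have "ell_norm (real p) F \<le> D powr (1 / real p) * W powr (1 - 1 / real r) * ell_norm (real p) f"
      by (rule le_of_power_le[OF p(2) mult_nonneg_nonneg[OF mult_nonneg_nonneg[OF powr_ge_zero powr_ge_zero] Lp_norm_nonneg]])
    with s show ?thesis using ell_nat_iff[OF p(2), of F] by (simp add: W_def)
  qed
  then show ?thesis
    unfolding p(3) p_def[symmetric] Let_def by (intro exI[of _ "D powr (1 / real p)"]) blast
qed

end
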